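(* Let $B$ be a thin Blaschke product. If the Riemann surface $S_B$ has no nontrivial component of finite multiplicity, then $\mathcal{V}^*(B)$ is trivial, i.e. $\mathcal{V}^*(B)=\mathbb{C}I$. Equivalently, $M_B$ has no nontrivial reducing subspace on $L^2_a(\mathbb{D})$.
   Context: $L^2_a(\mathbb{D})$ is the Bergman space of holomorphic functions on the open unit disk $\mathbb{D}$ that are square integrable with respect to normalized area measure. For a bounded holomorphic $\phi$ on $\mathbb{D}$, $M_\phi$ is the operator of multiplication by $\phi$ on $L^2_a(\mathbb{D})$. A closed subspace $M$ is reducing for $M_\phi$ if $M_\phi M\subseteq M$ and $M_\phi^*M\subseteq M$; it is nontrivial if $M\ne\{0\}$ and $M\neq L^2_a(\mathbb{D})$. $\mathcal{V}^*(\phi)=\{M_\phi,M_\phi^*\}'$ is the von Neumann algebra of bounded operators on $L^2_a(\mathbb{D})$ commuting with both $M_\phi$ and $M_\phi^*$. A thin Blaschke product is an infinite Blaschke product $B$ whose zero sequence $\{z_n\}$ satisfies $\lim_{k\to\infty}\prod_{j\ne k} d(z_j,z_k)=1$, where $d(z,\lambda)=\left|\frac{\lambda-z}{1-\overline{\lambda}z}\right|$. Let $\mathcal{E}_B=\{B(z): z\in\mathbb{D},\,B'(z)=0\}$ and $E=\mathbb{D}\setminus B^{-1}(\mathcal{E}_B)$, a connected open set. Let $S_B=\{(z,w)\in\mathbb{D}^2: z\in E,\ B(z)=B(w)\}$ with the topology inherited from $\mathbb{D}^2$; it is a (not necessarily connected) Riemann surface. Its connected components are called its components; the trivial component is $\{(z,z):z\in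 E\}$, and every other component is nontrivial. For each component $G$, the projection $G\to E$, $(z,w)\mapsto z$, is a covering map; the multiplicity of $G$ is its number of sheets, i.e. the number (possibly $\infty$) of $w$ with $(z,w)\in G$, which is independent of $z\in E$. *)

theory Defs
  imports "HOL-Analysis.Analysis" "HOL-Library.FuncSet"
begin

section \<open>The Bergman space and its operators\<close>

abbreviation unit_disk :: "complex set" where
  "unit_disk \<equiv> ball 0 1"

definition disk_measure :: "complex measure" where
  "disk_measure = uniform_measure lborel unit_disk"

text \<open>
  A function on the disk is represented by its extension by zero to the whole plane, so that
  equality in the Bergman space is equality of functions.
\<close>

definition bergman_space :: "(complex \<Rightarrow> complex) set" where
  "bergman_space =
     {f. f holomorphic_on unit_disk \<and> (\<forall>z. z \<notin> unit_disk \<longrightarrow> f z = 0) \<and>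
         integrable disk_measure (\<lambda>z. (cmod (f z))\<^sup>2)}"

definition bergman_inner :: "(complex \<Rightarrow> complex) \<Rightarrow> (complex \<Rightarrow> complex) \<Rightarrow> complex" where
  "bergman_inner f g = (LINT z|disk_measure. f z * cnj (g z))"

definition bergman_norm :: "(complex \<Rightarrow> complex) \<Rightarrow> real" where
  "bergman_norm f = sqrt (LINT z|disk_measure. (cmod (f z))\<^sup>2)"

type_synonym bergman_op = "(complex \<Rightarrow> complex) \<Rightarrow> (complex \<Rightarrow> complex)"

text \<open>
  Operators are extensional (\<open>undefined\<close> off the Bergman space), so that equality of operators
  is plain equality.
\<close>

definition bergman_operators :: "bergman_op set" where
  "bergman_operators =
     {T \<in> bergman_space \<rightarrow>\<^sub>E bergman_space.
        (\<forall>f\<in>bergman_space. \<forall>g\<in>bergman_space. T (\<lambda>z. f z + g z) = (\<lambda>z. T f z + T g z)) \<and>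
        (\<forall>c. \<forall>f\<in>bergman_space. T (\<lambda>z. c * f z) = (\<lambda>z. c * T f z)) \<and>
        (\<exists>C. \<forall>f\<in>bergman_space. bergman_norm (T f) \<le> C * bergman_norm f)}"

definition scalar_operator :: "complex \<Rightarrow> bergman_op" where
  "scalar_operator c = restrict (\<lambda>f z. c * f z) bergman_space"

definition mult_operator :: "(complex \<Rightarrow> complex) \<Rightarrow> bergman_op" where
  "mult_operator \<phi> = restrict (\<lambda>f z. \<phi> z * f z) bergman_space"

definition bergman_adjoint :: "bergman_op \<Rightarrow> bergman_op" where
  "bergman_adjoint T =
     (THE S. S \<in> bergman_operators \<and>
        (\<forall>f\<in>bergman_space. \<forall>g\<in>bergman_space.
            bergman_inner (T f) g = bergman_inner f (S g)))"

definition vn_algebra :: "(complex \<Rightarrow> complex) \<Rightarrow> bergman_op set" where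
  "vn_algebra \<phi> =
     {T \<in> bergman_operators. \<forall>f\<in>bergman_space.
        T (mult_operator \<phi> f) = mult_operator \<phi> (T f) \<and>
        T (bergman_adjoint (mult_operator \<phi>) f) = bergman_adjoint (mult_operator \<phi>) (T f)}"

definition closed_bergman_subspace :: "(complex \<Rightarrow> complex) set \<Rightarrow> bool" where
  "closed_bergman_subspace M \<longleftrightarrow>
     M \<subseteq> bergman_space \<and> (\<lambda>z. 0) \<in> M \<and>
     (\<forall>f\<in>M. \<forall>g\<in>M. (\<lambda>z. f z + g z) \<in> M) \<and>
     (\<forall>c. \<forall>f\<in>M. (\<lambda>z. c * f z) \<in> M) \<and>
     (\<forall>F g. (\<forall>n::nat. F n \<in> M) \<and> g \<in> bergman_space \<and>
            (\<lambda>n. bergman_norm (\<lambda>z. F n z - g z)) \<longlonglongrightarrow> 0 \<longrightarrow> g \<in> M)"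

definition reducing_subspace ::
    "(complex \<Rightarrow> complex) \<Rightarrow> (complex \<Rightarrow> complex) set \<Rightarrow> bool" where
  "reducing_subspace \<phi> M \<longleftrightarrow>
     closed_bergman_subspace M \<and>
     mult_operator \<phi> ` M \<subseteq> M \<and> bergman_adjoint (mult_operator \<phi>) ` M \<subseteq> M"

definition nontrivial_subspace :: "(complex \<Rightarrow> complex) set \<Rightarrow> bool" where
  "nontrivial_subspace M \<longleftrightarrow> M \<noteq> {\<lambda>z. 0} \<and> M \<noteq> bergman_space"

section \<open>Thin Blaschke products\<close>

definition blaschke_factor :: "complex \<Rightarrow> complex \<Rightarrow> complex" where
  "blaschke_factor a z =
     (if a = 0 then z else (of_real (cmod a) / a) * ((a - z) / (1 - cnj a * z)))"

text \<open>
  The sequence \<open>a\<close> lists the zeros with multiplicity.  Only the values of \<open>B\<close> on the disk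
  matter.
\<close>

definition infinite_blaschke_product :: "(complex \<Rightarrow> complex) \<Rightarrow> (nat \<Rightarrow> complex) \<Rightarrow> bool" where
  "infinite_blaschke_product B a \<longleftrightarrow>
     (\<forall>n. a n \<in> unit_disk) \<and> summable (\<lambda>n. 1 - cmod (a n)) \<and>
     (\<exists>c. cmod c = 1 \<and> (\<forall>z\<in>unit_disk. B z = c * (\<Prod>n. blaschke_factor (a n) z)))"

definition hyp_dist :: "complex \<Rightarrow> complex \<Rightarrow> real" where
  "hyp_dist z w = cmod ((w - z) / (1 - cnj w * z))"

definition thin_blaschke_product :: "(complex \<Rightarrow> complex) \<Rightarrow> bool" where
  "thin_blaschke_product B \<longleftrightarrow>
     (\<exists>a. infinite_blaschke_product B a \<and>
          (\<lambda>k. \<Prod>j. if j = k then 1 else hyp_dist (a j) (a k)) \<longlonglongrightarrow> 1)"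

section \<open>The Riemann surface\<close>

definition critical_values :: "(complex \<Rightarrow> complex) \<Rightarrow> complex set" where
  "critical_values B = {B z |z. z \<in> unit_disk \<and> deriv B z = 0}"

definition regular_domain :: "(complex \<Rightarrow> complex) \<Rightarrow> complex set" where
  "regular_domain B = unit_disk - B -` critical_values B"

definition riemann_surface :: "(complex \<Rightarrow> complex) \<Rightarrow> (complex \<times> complex) set" where
  "riemann_surface B =
     {(z, w). z \<in> unit_disk \<and> w \<in> unit_disk \<and> z \<in> regular_domain B \<and> B z = B w}"

definition trivial_component :: "(complex \<Rightarrow> complex) \<Rightarrow> (complex \<times> complex) set" where
  "trivial_component B = {(z, z) |z. z \<in> regular_domain B}"

definition has_finite_multiplicity ::
    "(complex \<Rightarrow> complex) \<Rightarrow> (complex \<times> complex) set \<Rightarrow> nat \<Rightarrow> bool" where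
  "has_finite_multiplicity B G n \<longleftrightarrow>
     (\<forall>z\<in>regular_domain B. finite {w. (z, w) \<in> G} \<and> card {w. (z, w) \<in> G} = n)"

end

theory Submission
  imports Defs "HOL-Complex_Analysis.Complex_Analysis"
begin

text \<open>
  For an operator \<open>T\<close> commuting with \<open>M\<^sub>B\<close> and its adjoint, the forms
  \<open>u \<mapsto> \<langle>u(B) T f, g\<rangle>\<close> and \<open>u \<mapsto> \<langle>u(B) f, T\<^sup>* g\<rangle>\<close> agree for polynomials \<open>u\<close> in \<open>z\<close> and its conjugate,
  hence for all continuous \<open>u\<close>.  Localising to a disk over which \<open>B\<close> is evenly covered and changing
  variables on each sheet, one finds that \<open>T\<close> acts on the vectors
  \<open>(f(w) / B'(w))\<close>, \<open>w\<close> in the fibre of \<open>B z\<close>, through a matrix \<open>coef z w\<close> with square summable rows.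
  Polarising the identity shows that the entries are both holomorphic and antiholomorphic in the base
  point, so they are constant on every component of the Riemann surface.  Square summability kills
  the components of infinite multiplicity; if only the trivial component is left, \<open>T\<close> is a scalar.
  Reducing subspaces are treated in the same way through their orthogonal projections.

  Thinness enters only through the covering property of \<open>B\<close> over its regular values: near its
  zeros of large index \<open>B\<close> is, in hyperbolic coordinates, almost a rotation, and away from these zeros
  small values of \<open>B\<close> occur only in a compact part of the disk.
\<close>

section \<open>The Riesz representation theorem\<close>

text \<open>The fibres of \<open>B\<close> are infinite, so the inverse function theorem alone gives
  sections whose domains may shrink along a fibre. What thinness buys is one disk that serves every
  sheet, and both the sheetwise change of variables and the sums over a fibre rest on it. The radius
  of that disk shrinks twice. Passing from \<rho> to \<rho>/2 leaves room for a mean value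
  inequality, which bounds each branch by its mass on the sheet; passing to \<rho>/4 leaves room for
  the complexified coordinates of the polarisation. The central statement concerns a pair
  \<open>T\<close>, \<open>T'\<close> in adjoint position, both commuting with multiplication by
  \<open>B\<close>. Commutation of \<open>T\<close> with the adjoint of multiplication by
  \<open>B\<close> is thereby shifted to \<open>T'\<close>, so that this adjoint is never computed;
  a self-adjoint projection is the case \<open>T' = T\<close>. The Riesz theorem enters twice:
  \<open>bergman_adjoint\<close> is a definite description whose referent has to be produced, and
  the orthogonal projection of \<open>f\<close> onto a closed subspace is the representative of the
  inner product with \<open>f\<close>.\<close>

lemma riesz_closed_subspace:
  fixes M :: "'a::{real_inner,complete_space} set" and \<phi> :: "'a \<Rightarrow> real"
  assumes sub: "subspace M" and cl: "closed M"
    and add: "\<And>x y. x \<in> M \<Longrightarrow> y \<in> M \<Longrightarrow> \<phi> (x + y) = \<phi> x + \<phi> y"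
    and scale: "\<And>c x. x \<in> M \<Longrightarrow> \<phi> (c *\<^sub>R x) = c * \<phi> x"
    and bd: "\<And>x. x \<in> M \<Longrightarrow> \<bar>\<phi> x\<bar> \<le> C * norm x"
  obtains y where "y \<in> M" "\<And>x. x \<in> M \<Longrightarrow> \<phi> x = x \<bullet> y"
proof -
  \<comment> \<open>Completing the square, a representing vector \<open>y\<close> would give
    \<open>J x = (norm (x - y))\<^sup>2 - (norm y)\<^sup>2\<close>, so \<open>y\<close> is sought as
    the minimiser of \<open>J\<close> on \<open>M\<close>.\<close>
  define J where "J x = (norm x)\<^sup>2 - 2 * \<phi> x" for x
  define m where "m = Inf (J ` M)"
  have J_ge: "- C\<^sup>2 \<le> J x" if "x \<in> M" for x
  proof -
    have "0 \<le> (norm x - C)\<^sup>2" by simp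
    then show ?thesis using bd[OF that] unfolding J_def power2_diff by (auto simp: abs_le_iff mult.commute)
  qed
  then have bdd: "bdd_below (J ` M)" by (auto intro!: bdd_belowI)
  have m_le: "m \<le> J x" if "x \<in> M" for x
    unfolding m_def by (rule cInf_lower) (use bdd that in auto)
  have ne: "J ` M \<noteq> {}" using subspace_0[OF sub] by auto
  have "\<exists>x\<in>M. J x < m + 1 / real (Suc n)" for n
  proof -
    have "Inf (J ` M) < m + 1 / real (Suc n)" unfolding m_def by simp
    then show ?thesis using cInf_lessD[OF ne] by auto
  qed
  then obtain x where xM: "\<And>n. x n \<in> M" and xJ: "\<And>n. J (x n) < m + 1 / real (Suc n)"
    by metis
  \<comment> \<open>Parallelogram law: the midpoint lies in \<open>M\<close> too and has
    \<open>J\<close> at least \<open>m\<close>, so near-minimisers are close to each other.\<close>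
  have par: "(norm (u - v))\<^sup>2 = 2 * J u + 2 * J v - 4 * J ((1/2) *\<^sub>R (u + v))"
    if "u \<in> M" "v \<in> M" for u v
  proof -
    have "\<phi> ((1/2) *\<^sub>R (u + v)) = (\<phi> u + \<phi> v) / 2"
      using scale[of "u + v" "1/2"] add[OF that] subspace_add[OF sub that] by simp
    moreover have "(norm ((1/2) *\<^sub>R (u + v)))\<^sup>2 = (norm (u + v))\<^sup>2 / 4"
      by (simp add: power2_eq_square)
    moreover have "(norm (u - v))\<^sup>2 + (norm (u + v))\<^sup>2 = 2 * (norm u)\<^sup>2 + 2 * (norm v)\<^sup>2"
      by (simp add: power2_norm_eq_inner inner_simps inner_commute)
    ultimately show ?thesis unfolding J_def by simp
  qed
  have dist: "(norm (x i - x j))\<^sup>2 \<le> 4 / real (Suc N)" if "N \<le> i" "N \<le> j" for i j N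
  proof -
    have "(1/2) *\<^sub>R (x i + x j) \<in> M"
      by (intro subspace_scale[OF sub] subspace_add[OF sub] xM)
    then have "(norm (x i - x j))\<^sup>2 \<le> 2 / real (Suc i) + 2 / real (Suc j)"
      using par[OF xM xM, of i j] m_le xJ[of i] xJ[of j] by fastforce
    also have "\<dots> \<le> 2 / real (Suc N) + 2 / real (Suc N)"
      by (intro add_mono divide_left_mono) (use that in auto)
    finally show ?thesis by simp
  qed
  have "Cauchy x"
  proof (rule metric_CauchyI)
    fix e :: real assume e: "0 < e"
    obtain N where N: "4 / e\<^sup>2 < real (Suc N)"
      using reals_Archimedean2 less_Suc_eq by (metis less_trans of_nat_less_iff lessI)
    then have "4 / real (Suc N) < e\<^sup>2" using e by (simp add: field_simps)
    then have "(dist (x i) (x j))\<^sup>2 < e\<^sup>2" if "N \<le> i" "N \<le> j" for i j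
      using dist[OF that] by (simp add: dist_norm)
    then have "dist (x i) (x j) < e" if "N \<le> i" "N \<le> j" for i j
      using that e power2_less_imp_less by (metis less_imp_le)
    then show "\<exists>M. \<forall>m\<ge>M. \<forall>n\<ge>M. dist (x m) (x n) < e" by blast
  qed
  then obtain y where y: "x \<longlonglongrightarrow> y" using Cauchy_convergent_iff convergentD by metis
  have yM: "y \<in> M" using closed_sequentially[OF cl] xM y by blast
  have phi_diff: "\<phi> (u - v) = \<phi> u - \<phi> v" if "u \<in> M" "v \<in> M" for u v
    using add[of u "- v"] scale[of v "-1"] that subspace_neg[OF sub] by simp
  have "(\<lambda>n. \<phi> (x n)) \<longlonglongrightarrow> \<phi> y"
  proof (rule Lim_null_comparison[where g = "\<lambda>n. C * norm (x n - y)", THEN LIM_zero_cancel])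
    show "\<forall>\<^sub>F n in sequentially. norm (\<phi> (x n) - \<phi> y) \<le> C * norm (x n - y)"
      using bd subspace_diff[OF sub xM yM] phi_diff[OF xM yM] by (auto simp flip: phi_diff[OF xM yM])
    show "(\<lambda>n. C * norm (x n - y)) \<longlonglongrightarrow> 0"
      using y by (intro tendsto_mult_right_zero tendsto_norm_zero) (simp add: LIM_zero_iff)
  qed
  then have "(\<lambda>n. J (x n)) \<longlonglongrightarrow> J y" unfolding J_def by (intro tendsto_intros y)
  moreover have "(\<lambda>n. m + 1 / real (Suc n)) \<longlonglongrightarrow> m + 0"
    by (intro tendsto_intros) (use LIMSEQ_inverse_real_of_nat in \<open>simp add: inverse_eq_divide\<close>)
  ultimately have Jy: "J y \<le> m"
    using LIMSEQ_le[of "\<lambda>n. J (x n)" "J y" "\<lambda>n. m + 1 / real (Suc n)" "m + 0"] xJ less_imp_le by auto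
  have "\<phi> u = u \<bullet> y" if u: "u \<in> M" for u
  proof -
    define d where "d = u \<bullet> y - \<phi> u"
    define N where "N = (norm u)\<^sup>2"
    have N0: "0 \<le> N" unfolding N_def by simp
    have var: "0 \<le> 2 * t * d + t\<^sup>2 * N" for t
    proof -
      have "J (y + t *\<^sub>R u) = J y + 2 * t * d + t\<^sup>2 * N"
      proof -
        have "(norm (y + t *\<^sub>R u))\<^sup>2 = (norm y)\<^sup>2 + 2 * t * (u \<bullet> y) + t\<^sup>2 * (norm u)\<^sup>2"
          unfolding power2_norm_eq_inner by (simp add: inner_simps inner_commute[of y u] power2_eq_square algebra_simps)
        then show ?thesis
          unfolding J_def d_def N_def using add[OF yM subspace_scale[OF sub u]] scale[OF u]
          by (simp add: algebra_simps)
      qed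
      moreover have "y + t *\<^sub>R u \<in> M" by (intro subspace_add[OF sub] yM subspace_scale[OF sub] u)
      ultimately show ?thesis using m_le Jy by fastforce
    qed
    \<comment> \<open>The optimal step for this quadratic would be \<open>d / N\<close>; the
      denominator \<open>N + 1\<close> is positive even for \<open>u = 0\<close> and still forces
      \<open>d = 0\<close>.\<close>
    define q where "q = d / (N + 1)"
    have q: "q * (N + 1) = d" using N0 by (simp add: q_def)
    have "0 \<le> (2 * (- q) * d + (- q)\<^sup>2 * N) * (N + 1)\<^sup>2"
      using var[of "- q"] by simp
    also have "\<dots> = - 2 * (q * (N + 1)) * d * (N + 1) + (q * (N + 1))\<^sup>2 * N" by algebra
    also have "\<dots> = - (d\<^sup>2 * (N + 2))" unfolding q by algebra
    finally have "d\<^sup>2 * (N + 2) \<le> 0" by simp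
    then have "d = 0" using N0 by (simp add: mult_le_0_iff)
    then show ?thesis unfolding d_def by simp
  qed
  then show ?thesis using yM that by blast
qed

section \<open>Change of variables and mean values in the complex plane\<close>

unbundle no fps_syntax

text \<open>
  The change of variables theorem of the library is stated for \<open>real^'n\<close>, so it is applied in
  \<open>real^2\<close> and transported to the complex plane.
\<close>

definition complex_of_vec :: "real^2 \<Rightarrow> complex" where
  "complex_of_vec v = Complex (v $ 1) (v $ 2)"

definition vec_of_complex :: "complex \<Rightarrow> real^2" where
  "vec_of_complex z = vector [Re z, Im z]"

lemma complex_of_vec_inverse [simp]:
  "vec_of_complex (complex_of_vec v) = v" "complex_of_vec (vec_of_complex z) = z"
  by (auto simp: complex_of_vec_def vec_of_complex_def vec_eq_iff forall_2)

lemma bounded_linear_complex_of_vec: "bounded_linear complex_of_vec"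
  unfolding linear_conv_bounded_linear[symmetric] complex_of_vec_def
  by (intro linearI) (auto simp: complex_eq_iff)

lemma bounded_linear_vec_of_complex: "bounded_linear vec_of_complex"
  unfolding linear_conv_bounded_linear[symmetric] vec_of_complex_def
  by (intro linearI) (auto simp: vec_eq_iff forall_2)

lemma measurable_complex_of_vec [measurable]: "complex_of_vec \<in> borel_measurable borel"
  by (intro borel_measurable_continuous_onI linear_continuous_on bounded_linear_complex_of_vec)

lemma prod_Basis_vec2: "(\<Prod>b\<in>(Basis :: (real^2) set). v \<bullet> b) = v $ 1 * v $ 2"
proof -
  have B: "(Basis :: (real^2) set) = {axis 1 1, axis 2 1}"
    by (auto simp: Basis_vec_def UNIV_2)
  have "axis 1 (1::real) \<noteq> (axis 2 1 :: real^2)" by (simp add: axis_eq_axis)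
  then show ?thesis unfolding B by (simp add: inner_axis)
qed

lemma distr_complex_of_vec: "distr lborel borel complex_of_vec = lborel"
proof (rule lborel_eqI[symmetric])
  fix l u :: complex assume le: "\<And>b. b \<in> Basis \<Longrightarrow> l \<bullet> b \<le> u \<bullet> b"
  have vb: "complex_of_vec -` box l u = box (vec_of_complex l) (vec_of_complex u)"
    by (auto simp: mem_box_cart in_box_complex_iff complex_of_vec_def vec_of_complex_def forall_2)
  have le': "\<forall>b\<in>Basis. vec_of_complex l \<bullet> b \<le> vec_of_complex u \<bullet> b"
    using le by (force simp: Basis_vec_def inner_axis vec_of_complex_def Basis_complex_def UNIV_2)
  have "emeasure (distr lborel borel complex_of_vec) (box l u) = (\<Prod>b\<in>Basis. (vec_of_complex u - vec_of_complex l) \<bullet> b)"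
    using le' by (subst emeasure_distr) (auto simp: vb emeasure_lborel_box_eq)
  also have "\<dots> = (\<Prod>b\<in>Basis. (u - l) \<bullet> b)"
    unfolding prod_Basis_vec2 by (simp add: vec_of_complex_def Basis_complex_def)
  finally show "emeasure (distr lborel borel complex_of_vec) (box l u) = (\<Prod>b\<in>Basis. (u - l) \<bullet> b)" .
qed simp

section \<open>Holomorphic change of variables\<close>

lemma borel_image_holomorphic:
  assumes hol: "s holomorphic_on D" and D: "open D" and inj: "inj_on s D"
    and A: "A \<in> sets borel" "A \<subseteq> D"
  shows "s ` A \<in> sets borel"
proof -
  obtain g where g: "g holomorphic_on s ` D" "\<And>z. z \<in> D \<Longrightarrow> g (s z) = z"
    using holomorphic_has_inverse[OF hol D inj] by metis
  have op: "open (s ` D)"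
    using open_mapping_thm3[OF hol D inj] .
  \<comment> \<open>The image of a Borel set under a Borel map need not be Borel; through the
    holomorphic inverse \<open>g\<close> it becomes a preimage.\<close>
  have eq: "s ` A = s ` D \<inter> g -` A" using g(2) A(2) by force
  have "g \<in> borel_measurable (restrict_space borel (s ` D))"
    by (intro borel_measurable_continuous_on_restrict holomorphic_on_imp_continuous_on g(1))
  then have "g -` A \<inter> space (restrict_space borel (s ` D)) \<in> sets (restrict_space borel (s ` D))"
    using A(1) by (rule measurable_sets)
  then have "g -` A \<inter> (s ` D) \<in> sets borel"
    using op by (subst (asm) sets_restrict_space_iff) (auto simp: space_restrict_space)
  then show ?thesis unfolding eq by (simp add: Int_commute)
qed

text \<open>As a real linear map of the plane, multiplication by \<open>c\<close> has determinant
  \<open>(cmod c)\<^sup>2\<close>. Boundedness makes the measure of the image a finite real number,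
  as the gauge integral form of the substitution rule requires.\<close>

lemma emeasure_holomorphic_image:
  assumes hol: "s holomorphic_on D" and D: "open D" and inj: "inj_on s D" and bdd: "bounded (s ` D)"
    and A: "A \<in> sets borel" "A \<subseteq> D"
  shows "emeasure lborel (s ` A) = (\<integral>\<^sup>+z. indicator A z * ennreal ((cmod (deriv s z))\<^sup>2) \<partial>lborel)"
proof -
  define S where "S = complex_of_vec -` A"
  define f where "f v = vec_of_complex (s (complex_of_vec v))" for v
  define f' where "f' v h = vec_of_complex (deriv s (complex_of_vec v) * complex_of_vec h)" for v h
  have Sb: "S \<in> sets borel" unfolding S_def
    using measurable_sets[OF measurable_complex_of_vec A(1)] by simp
  have fS: "f ` S = complex_of_vec -` (s ` A)"
  proof
    show "f ` S \<subseteq> complex_of_vec -` (s ` A)" by (auto simp: f_def S_def)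
    show "complex_of_vec -` (s ` A) \<subseteq> f ` S"
    proof
      fix v assume "v \<in> complex_of_vec -` (s ` A)"
      then obtain a where a: "a \<in> A" "complex_of_vec v = s a" by auto
      then have "v = f (vec_of_complex a)" unfolding f_def by (simp flip: a(2))
      moreover have "vec_of_complex a \<in> S" using a by (simp add: S_def)
      ultimately show "v \<in> f ` S" by blast
    qed
  qed
  \<comment> \<open>\<open>deriv s\<close> is unspecified off \<open>D\<close>; cutting it off there
    gives a Borel function on the whole plane without changing integrals over
    \<open>A\<close>.\<close>
  define d where "d z = indicat_real D z *\<^sub>R deriv s z" for z
  have [measurable]: "d \<in> borel_measurable borel" unfolding d_def using D
    by (intro borel_measurable_continuous_on_indicator holomorphic_on_imp_continuous_on holomorphic_deriv hol) auto
  have sA: "s ` A \<in> sets borel" by (rule borel_image_holomorphic[OF hol D inj A])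
  have fSb: "f ` S \<in> sets borel" unfolding fS
    using measurable_sets[OF measurable_complex_of_vec sA] by simp
  have "f ` S = vec_of_complex ` (s ` A)"
  proof -
    have "complex_of_vec ` S = A" unfolding S_def by (rule surj_image_vimage_eq) (metis complex_of_vec_inverse(2) surjI)
    then show ?thesis unfolding f_def by (metis image_image)
  qed
  then have bd: "bounded (f ` S)"
    using bounded_subset[OF bdd image_mono[OF A(2)]] bounded_linear_image[OF _ bounded_linear_vec_of_complex] by simp
  have lm: "f ` S \<in> lmeasurable" using bd fSb by (intro bounded_set_imp_lmeasurable) auto
  have der: "(f has_derivative f' v) (at v within S)" if "v \<in> S" for v
  proof -
    have "complex_of_vec v \<in> D" using that A(2) by (auto simp: S_def)
    then have "(s has_field_derivative deriv s (complex_of_vec v)) (at (complex_of_vec v))"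
      by (rule holomorphic_derivI[OF hol D])
    then have s': "(s has_derivative (\<lambda>h. deriv s (complex_of_vec v) * h)) (at (complex_of_vec v) within complex_of_vec ` S)"
      by (simp add: has_field_derivative_def has_derivative_at_withinI)
    have "((\<lambda>v. s (complex_of_vec v)) has_derivative (\<lambda>h. deriv s (complex_of_vec v) * complex_of_vec h)) (at v within S)"
      by (rule has_derivative_in_compose[OF bounded_linear_imp_has_derivative[OF bounded_linear_complex_of_vec] s'])
    from bounded_linear.has_derivative[OF bounded_linear_vec_of_complex this]
    show ?thesis unfolding f_def f'_def .
  qed
  have injf: "inj_on f S"
    by (rule inj_on_inverseI[where g = "\<lambda>v. vec_of_complex (inv_into D s (complex_of_vec v))"])
       (use A(2) in \<open>auto simp: f_def S_def inv_into_f_f[OF inj]\<close>)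
  have det: "\<bar>det (matrix (f' v))\<bar> = (cmod (deriv s (complex_of_vec v)))\<^sup>2" for v
    unfolding det_2 matrix_def f'_def
    unfolding cmod_power2 by (simp add: vec_of_complex_def complex_of_vec_def axis_def power2_eq_square)
  have "((\<lambda>x. \<bar>det (matrix (f' x))\<bar>) has_integral measure lebesgue (f ` S)) S"
    using has_measure_differentiable_image[OF _ der injf, of "measure lebesgue (f ` S)"] lm Sb by auto
  then have hi: "((\<lambda>x. (cmod (deriv s (complex_of_vec x)))\<^sup>2) has_integral measure lebesgue (f ` S)) S"
    unfolding det .
  have "emeasure lborel (s ` A) = emeasure (distr lborel borel complex_of_vec) (s ` A)"
    by (simp add: distr_complex_of_vec)
  also have "\<dots> = emeasure lborel (f ` S)"
    using sA by (subst emeasure_distr) (auto simp: fS)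
  also have "\<dots> = ennreal (measure lebesgue (f ` S))"
    using fSb emeasure_bounded_finite[OF bd] by (simp add: measure_completion emeasure_eq_ennreal_measure)
  also have "\<dots> = (\<integral>\<^sup>+x. ennreal ((cmod (deriv s (complex_of_vec x)))\<^sup>2) * indicator S x \<partial>lborel)"
    by (rule nn_integral_has_integral_lebesgue'[OF _ hi, symmetric]) simp
  also have "\<dots> = (\<integral>\<^sup>+x. indicator A (complex_of_vec x) * ennreal ((cmod (d (complex_of_vec x)))\<^sup>2) \<partial>lborel)"
    using A(2) by (intro nn_integral_cong) (auto simp: S_def indicator_def d_def)
  also have "\<dots> = (\<integral>\<^sup>+z. indicator A z * ennreal ((cmod (d z))\<^sup>2) \<partial>distr lborel borel complex_of_vec)"
    using A(1) by (subst nn_integral_distr) auto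
  also have "\<dots> = (\<integral>\<^sup>+z. indicator A z * ennreal ((cmod (deriv s z))\<^sup>2) \<partial>lborel)"
    unfolding distr_complex_of_vec using A(2) by (intro nn_integral_cong) (auto simp: indicator_def d_def)
  finally show ?thesis .
qed

lemma borel_measurable_holomorphic_indicator:
  assumes "s holomorphic_on D" "open D"
  shows "(\<lambda>z. indicat_real D z *\<^sub>R s z) \<in> borel_measurable borel"
  using assms by (intro borel_measurable_continuous_on_indicator holomorphic_on_imp_continuous_on) auto

lemma borel_measurable_deriv_norm_sq:
  assumes "s holomorphic_on D" "open D"
  shows "(\<lambda>z. indicat_real D z * (cmod (deriv s z))\<^sup>2) \<in> borel_measurable borel"
proof -
  have [measurable]: "(\<lambda>z. indicat_real D z *\<^sub>R deriv s z) \<in> borel_measurable borel"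
    by (intro borel_measurable_holomorphic_indicator holomorphic_deriv assms)
  have "(\<lambda>z. indicat_real D z * (cmod (deriv s z))\<^sup>2) = (\<lambda>z. (cmod (indicat_real D z *\<^sub>R deriv s z))\<^sup>2)"
    by (auto simp: indicator_def)
  moreover have "(\<lambda>z. (cmod (indicat_real D z *\<^sub>R deriv s z))\<^sup>2) \<in> borel_measurable borel" by measurable
  ultimately show ?thesis by (simp only:)
qed

text \<open>As an identity of measures, the substitution rule transfers integrability and integrals
  for every Banach space valued integrand through \<open>density\<close> and \<open>distr\<close>.
  The map is extended by 0 off \<open>D\<close>, where the density vanishes anyway.\<close>

lemma density_holomorphic_image:
  assumes hol: "s holomorphic_on D" and D: "open D" and inj: "inj_on s D" and bdd: "bounded (s ` D)"
  shows "density lborel (\<lambda>w. ennreal (indicat_real (s ` D) w)) =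
    distr (density lborel (\<lambda>z. ennreal (indicat_real D z * (cmod (deriv s z))\<^sup>2))) borel (\<lambda>z. indicat_real D z *\<^sub>R s z)"
    (is "?L = distr ?R borel ?s")
proof (rule measure_eqI)
  have smeas [measurable]: "?s \<in> borel_measurable borel"
    by (rule borel_measurable_holomorphic_indicator[OF hol D])
  have dmeas [measurable]: "(\<lambda>z. indicat_real D z * (cmod (deriv s z))\<^sup>2) \<in> borel_measurable borel"
    by (rule borel_measurable_deriv_norm_sq[OF hol D])
  fix A assume "A \<in> sets ?L"
  then have A [measurable]: "A \<in> sets borel" by simp
  define A' where "A' = D \<inter> ?s -` A"
  have A': "A' \<in> sets borel" unfolding A'_def
    using measurable_sets[OF smeas A] D by auto
  have sD: "s ` D \<in> sets borel" using open_mapping_thm3[OF hol D inj] by auto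
  have im: "s ` A' = s ` D \<inter> A" unfolding A'_def by auto
  have "emeasure ?L A = (\<integral>\<^sup>+w. indicator (s ` D \<inter> A) w \<partial>lborel)"
  proof -
    have "emeasure ?L A = (\<integral>\<^sup>+w. ennreal (indicat_real (s ` D) w) * indicator A w \<partial>lborel)"
      using sD by (intro emeasure_density) auto
    also have "\<dots> = (\<integral>\<^sup>+w. indicator (s ` D \<inter> A) w \<partial>lborel)"
      by (intro nn_integral_cong) (auto simp: indicator_def)
    finally show ?thesis .
  qed
  also have "\<dots> = emeasure lborel (s ` A')" unfolding im using A sD by (subst nn_integral_indicator) auto
  also have "\<dots> = (\<integral>\<^sup>+z. indicator A' z * ennreal ((cmod (deriv s z))\<^sup>2) \<partial>lborel)"
    by (rule emeasure_holomorphic_image[OF hol D inj bdd A']) (simp add: A'_def)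
  also have "\<dots> = (\<integral>\<^sup>+z. ennreal (indicat_real D z * (cmod (deriv s z))\<^sup>2) * indicator (?s -` A) z \<partial>lborel)"
    by (intro nn_integral_cong) (auto simp: A'_def indicator_def)
  also have "\<dots> = emeasure (distr ?R borel ?s) A"
    using A measurable_sets[OF smeas A] by (simp add: emeasure_distr emeasure_density)
  finally show "emeasure ?L A = emeasure (distr ?R borel ?s) A" .
qed simp

lemma set_integral_holomorphic_image:
  fixes f :: "complex \<Rightarrow> 'a::{banach,second_countable_topology}"
  assumes hol: "s holomorphic_on D" and D: "open D" and inj: "inj_on s D" and bdd: "bounded (s ` D)"
    and f [measurable]: "f \<in> borel_measurable borel"
  shows "set_integrable lborel (s ` D) f \<longleftrightarrow> set_integrable lborel D (\<lambda>z. (cmod (deriv s z))\<^sup>2 *\<^sub>R f (s z))"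
    and "(LINT w:s ` D|lborel. f w) = (LINT z:D|lborel. (cmod (deriv s z))\<^sup>2 *\<^sub>R f (s z))"
proof -
  let ?s = "\<lambda>z. indicat_real D z *\<^sub>R s z"
  have smeas [measurable]: "?s \<in> borel_measurable borel"
    by (rule borel_measurable_holomorphic_indicator[OF hol D])
  have dmeas [measurable]: "(\<lambda>z. indicat_real D z * (cmod (deriv s z))\<^sup>2) \<in> borel_measurable borel"
    by (rule borel_measurable_deriv_norm_sq[OF hol D])
  have sD [measurable]: "s ` D \<in> sets borel" using open_mapping_thm3[OF hol D inj] by auto
  have eq: "(indicat_real D z * (cmod (deriv s z))\<^sup>2) *\<^sub>R f (?s z) = indicat_real D z *\<^sub>R ((cmod (deriv s z))\<^sup>2 *\<^sub>R f (s z))" for z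
    by (simp add: indicator_def)
  have "set_integrable lborel (s ` D) f \<longleftrightarrow> integrable (density lborel (\<lambda>w. ennreal (indicat_real (s ` D) w))) f"
    unfolding set_integrable_def by (subst integrable_density) auto
  also have "\<dots> \<longleftrightarrow> integrable lborel (\<lambda>z. (indicat_real D z * (cmod (deriv s z))\<^sup>2) *\<^sub>R f (?s z))"
    unfolding density_holomorphic_image[OF hol D inj bdd]
    by (subst integrable_distr_eq, simp, simp, subst integrable_density) auto
  finally show "set_integrable lborel (s ` D) f \<longleftrightarrow> set_integrable lborel D (\<lambda>z. (cmod (deriv s z))\<^sup>2 *\<^sub>R f (s z))"
    unfolding eq set_integrable_def .
  have "(LINT w:s ` D|lborel. f w) = (LINT w|density lborel (\<lambda>w. ennreal (indicat_real (s ` D) w)). f w)"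
    unfolding set_lebesgue_integral_def by (subst integral_density) auto
  also have "\<dots> = (LINT z|lborel. (indicat_real D z * (cmod (deriv s z))\<^sup>2) *\<^sub>R f (?s z))"
    unfolding density_holomorphic_image[OF hol D inj bdd]
    by (subst integral_distr, simp, simp, subst integral_density) auto
  finally show "(LINT w:s ` D|lborel. f w) = (LINT z:D|lborel. (cmod (deriv s z))\<^sup>2 *\<^sub>R f (s z))"
    unfolding eq set_lebesgue_integral_def .
qed

section \<open>Mean values of holomorphic functions over disks\<close>

lemma set_integral_ball_power:
  fixes c :: complex
  assumes "0 < n"
  shows "(LINT z:ball c r|lborel. (z - c) ^ n) = 0"
proof -
  \<comment> \<open>The rotation about \<open>c\<close> by this number preserves the disk and area,
    while \<open>\<omega> ^ n = - 1\<close> changes the sign of the integrand.\<close>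
  define \<omega> where "\<omega> = cis (pi / real n)"
  define s where "s z = c + \<omega> * (z - c)" for z
  have w: "cmod \<omega> = 1" "\<omega> ^ n = - 1" using assms by (auto simp: \<omega>_def Complex.DeMoivre)
  have "s ` ball c r = ball c r"
  proof (intro equalityI subsetI)
    fix z assume z: "z \<in> ball c r"
    have "z = s (c + cnj \<omega> * (z - c))" using w(1) by (simp add: s_def complex_norm_square[symmetric] flip: mult.assoc)
    moreover have "c + cnj \<omega> * (z - c) \<in> ball c r" using z w(1) by (simp add: dist_norm norm_mult norm_minus_commute)
    ultimately show "z \<in> s ` ball c r" by blast
  qed (auto simp: s_def dist_norm norm_mult w norm_minus_commute)
  moreover have "(s has_field_derivative \<omega>) (at z)" for z unfolding s_def by (auto intro!: derivative_eq_intros)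
  then have "deriv s z = \<omega>" for z by (rule DERIV_imp_deriv)
  moreover have "s holomorphic_on ball c r" unfolding s_def by (intro holomorphic_intros)
  moreover have "inj_on s (ball c r)" using w by (auto simp: inj_on_def s_def)
  ultimately have "(LINT z:ball c r|lborel. (z - c) ^ n) = (LINT z:ball c r|lborel. (s z - c) ^ n)"
    using set_integral_holomorphic_image(2)[of s "ball c r" "\<lambda>z. (z - c) ^ n"] w by simp
  also have "\<dots> = (LINT z:ball c r|lborel. - ((z - c) ^ n))"
    by (simp add: s_def power_mult_distrib w)
  also have "\<dots> = - (LINT z:ball c r|lborel. (z - c) ^ n)"
    by (simp add: set_lebesgue_integral_def)
  finally show ?thesis by simp
qed

lemma set_integrable_ball_continuous:
  fixes f :: "complex \<Rightarrow> 'a::{banach,second_countable_topology}"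
  assumes "continuous_on (cball c s) f"
  shows "set_integrable lborel (ball c s) f"
proof (rule set_integrable_subset)
  show "set_integrable lborel (cball c s) f"
    unfolding set_integrable_def by (rule borel_integrable_compact[OF compact_cball assms])
qed auto

lemma measure_ball_complex: "0 \<le> r \<Longrightarrow> measure lborel (ball c r :: complex set) = pi * r\<^sup>2"
  by (simp add: content_ball unit_ball_vol_2)

text \<open>The power series is integrated term by term, and only the constant term survives by
  \<open>set_integral_ball_power\<close>. Staying strictly inside the disk of holomorphy provides a
  summable majorant.\<close>

lemma holomorphic_ball_mean_value:
  assumes hol: "f holomorphic_on ball c r" and s: "0 < s" "s < r"
  shows "(LINT z:ball c s|lborel. f z) = of_real (pi * s\<^sup>2) * f c"
proof -
  define a where "a n = (deriv ^^ n) f c / fact n" for n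
  have sums: "(\<lambda>n. a n * (z - c) ^ n) sums f z" if "z \<in> ball c r" for z
    unfolding a_def by (rule holomorphic_power_series[OF hol that])
  have summ: "summable (\<lambda>n. cmod (a n) * s ^ n)"
  proof -
    \<comment> \<open>Convergence at the larger radius \<open>q\<close> gives absolute convergence
      at radius \<open>s\<close>.\<close>
    define q where "q = (s + r) / 2"
    have q: "s < q" "q < r" using s by (auto simp: q_def)
    then have "c + of_real q \<in> ball c r" using s by (simp add: dist_norm)
    from sums_summable[OF sums[OF this]] have "summable (\<lambda>n. a n * (of_real q) ^ n)" by simp
    then have "summable (\<lambda>n. norm (a n * (of_real s) ^ n))"
      by (rule powser_insidea) (use s q in auto)
    then show ?thesis using s by (simp add: norm_mult norm_power)
  qed
  define F where "F n z = indicat_real (ball c s) z *\<^sub>R (a n * (z - c) ^ n)" for n z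
  have int: "integrable lborel (F n)" for n
    unfolding F_def set_integrable_def[symmetric]
    by (intro set_integrable_ball_continuous continuous_intros)
  have branch_majorant: "norm (F n z) \<le> indicat_real (ball c s) z * (cmod (a n) * s ^ n)" for n z
    unfolding F_def by (auto simp: indicator_def norm_mult norm_power dist_norm norm_minus_commute intro!: mult_left_mono power_mono)
  have "(\<lambda>n. integral\<^sup>L lborel (F n)) sums (LINT z|lborel. (\<Sum>n. F n z))"
  proof (rule sums_integral[OF int])
    show "AE z in lborel. summable (\<lambda>n. norm (F n z))"
      by (intro AE_I2 summable_comparison_test'[OF summable_mult[OF summ]]) (use branch_majorant in auto)
    show "summable (\<lambda>n. LINT z|lborel. norm (F n z))"
    proof (rule summable_comparison_test'[OF summable_mult[OF summ, of "measure lborel (ball c s)"]])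
      fix n
      have "(LINT z|lborel. norm (F n z)) \<le> (LINT z|lborel. indicat_real (ball c s) z * (cmod (a n) * s ^ n))"
        by (intro integral_mono integrable_norm int branch_majorant integrable_mult_left integrable_real_indicator)
           (use emeasure_bounded_finite[OF bounded_ball, of c s] in auto)
      also have "\<dots> = measure lborel (ball c s) * (cmod (a n) * s ^ n)" by simp
      finally show "norm (LINT z|lborel. norm (F n z)) \<le> measure lborel (ball c s) * (cmod (a n) * s ^ n)"
        by simp
    qed
  qed
  moreover have "(\<lambda>n. integral\<^sup>L lborel (F n)) = (\<lambda>n. if n = 0 then of_real (pi * s\<^sup>2) * f c else 0)"
  proof
    fix n
    have "integral\<^sup>L lborel (F n) = a n * (LINT z:ball c s|lborel. (z - c) ^ n)"
      unfolding F_def set_lebesgue_integral_def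
      by (subst integral_mult_right_zero[symmetric]) (auto intro!: Bochner_Integration.integral_cong)
    moreover have "(LINT z:ball c s|lborel. 1) = complex_of_real (pi * s\<^sup>2)"
      unfolding set_lebesgue_integral_def
      by (subst integral_scaleR_left)
         (use s emeasure_bounded_finite[OF bounded_ball, of c s] in \<open>auto simp: measure_ball_complex scaleR_conv_of_real\<close>)
    ultimately show "integral\<^sup>L lborel (F n) = (if n = 0 then of_real (pi * s\<^sup>2) * f c else 0)"
      using set_integral_ball_power[of n c s] by (simp add: a_def)
  qed
  moreover have "(LINT z|lborel. (\<Sum>n. F n z)) = (LINT z:ball c s|lborel. f z)"
    unfolding set_lebesgue_integral_def
  proof (rule Bochner_Integration.integral_cong)
    fix z
    show "(\<Sum>n. F n z) = indicat_real (ball c s) z *\<^sub>R f z"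
    proof (cases "z \<in> ball c s")
      case True
      then have "(\<lambda>n. F n z) sums f z" using sums[of z] s by (simp add: F_def)
      then show ?thesis using True by (simp add: sums_iff)
    qed (simp add: F_def)
  qed simp
  moreover have "(\<lambda>n. if n = 0 then of_real (pi * s\<^sup>2) * f c else 0) sums (of_real (pi * s\<^sup>2) * f c)"
    using sums_single[of 0 "\<lambda>_. of_real (pi * s\<^sup>2) * f c"] by simp
  ultimately show ?thesis using sums_unique2 by metis
qed

text \<open>The mean value property is applied to the square of \<open>f\<close> on the ball of half
  the radius, which accounts for the factor 4.\<close>

lemma holomorphic_norm_sq_le_integral:
  assumes hol: "f holomorphic_on ball c r" and r: "0 < r"
    and int: "set_integrable lborel (ball c r) (\<lambda>z. (cmod (f z))\<^sup>2)"
  shows "(cmod (f c))\<^sup>2 \<le> 4 / (pi * r\<^sup>2) * (LINT z:ball c r|lborel. (cmod (f z))\<^sup>2)"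
proof -
  have "(\<lambda>z. (f z)\<^sup>2) holomorphic_on ball c r" by (intro holomorphic_intros hol)
  then have "(LINT z:ball c (r/2)|lborel. (f z)\<^sup>2) = of_real (pi * (r/2)\<^sup>2) * (f c)\<^sup>2"
    by (rule holomorphic_ball_mean_value) (use r in auto)
  then have "pi * (r/2)\<^sup>2 * (cmod (f c))\<^sup>2 = norm (LINT z:ball c (r/2)|lborel. (f z)\<^sup>2)"
    using r by (simp add: norm_mult norm_power norm_divide)
  also have "\<dots> \<le> (LINT z:ball c (r/2)|lborel. norm ((f z)\<^sup>2))"
    unfolding set_lebesgue_integral_def
    by (rule order_trans[OF integral_norm_bound]) (simp add: norm_mult norm_power)
  also have "\<dots> = (LINT z:ball c (r/2)|lborel. (cmod (f z))\<^sup>2)" by (simp add: norm_power)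
  also have "\<dots> \<le> (LINT z:ball c r|lborel. (cmod (f z))\<^sup>2)"
    unfolding set_lebesgue_integral_def
    by (intro integral_mono set_integrable_subset[OF int, unfolded set_integrable_def] int[unfolded set_integrable_def])
       (use r in \<open>auto simp: indicator_def\<close>)
  finally show ?thesis using r by (simp add: field_simps power2_eq_square)
qed

section \<open>Local sections of thin Blaschke products\<close>

lemma Schwarz_Pick_diff_bound:
  assumes hol: "h holomorphic_on ball 0 1" and bd: "\<And>z. cmod z < 1 \<Longrightarrow> cmod (h z) < 1" and z: "cmod z < 1"
  shows "cmod (h z - h 0) \<le> (1 - (cmod (h 0))\<^sup>2) / (1 - cmod z)"
proof -
  \<comment> \<open>The Moebius map that sends \<open>h 0\<close> to 0 reduces the claim to the
    Schwarz lemma \<open>cmod (F z) \<le> cmod z\<close>; the rest solves this inequality for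
    \<open>cmod (h z - h 0)\<close>.\<close>
  define F where "F z = Moebius_function 0 (h 0) (h z)" for z
  have h0: "cmod (h 0) < 1" using bd[of 0] by simp
  have "F holomorphic_on ball 0 1"
    unfolding F_def
    by (rule holomorphic_on_compose_gen[OF hol Moebius_function_holomorphic[OF h0], unfolded o_def]) (use bd in auto)
  moreover have "F 0 = 0" by (simp add: F_def Moebius_function_eq_zero)
  moreover have "cmod (F w) < 1" if "cmod w < 1" for w
    unfolding F_def by (rule Moebius_function_norm_lt_1[OF h0 bd[OF that]])
  ultimately have "cmod (F z) \<le> cmod z" using Schwarz_Lemma(1) z by blast
  define d where "d = cmod (h z - h 0)"
  have "cmod (1 - cnj (h 0) * h z) = cmod (of_real (1 - (cmod (h 0))\<^sup>2) - cnj (h 0) * (h z - h 0))"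
    by (simp add: algebra_simps complex_norm_square[symmetric] flip: of_real_power)
  also have "\<dots> \<le> (1 - (cmod (h 0))\<^sup>2) + cmod (h 0) * d"
  proof -
    have "cmod (of_real (1 - (cmod (h 0))\<^sup>2)) = 1 - (cmod (h 0))\<^sup>2"
      unfolding norm_of_real using h0 by (simp add: power_le_one)
    then show ?thesis
      using norm_triangle_ineq4[of "of_real (1 - (cmod (h 0))\<^sup>2)" "cnj (h 0) * (h z - h 0)"] by (simp add: norm_mult d_def)
  qed
  also have "\<dots> \<le> (1 - (cmod (h 0))\<^sup>2) + d"
    using h0 by (simp add: d_def mult_left_le_one_le)
  finally have le: "cmod (1 - cnj (h 0) * h z) \<le> (1 - (cmod (h 0))\<^sup>2) + d" .
  have "1 - cnj (h 0) * h z \<noteq> 0"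
  proof
    assume "1 - cnj (h 0) * h z = 0"
    then have "cmod (h 0) * cmod (h z) = 1" by (metis complex_mod_cnj eq_iff_diff_eq_0 norm_mult norm_one)
    moreover have "cmod (h 0) * cmod (h z) < 1 * 1"
      using h0 bd[OF z] by (intro mult_strict_mono) auto
    ultimately show False by simp
  qed
  then have "d = cmod (F z) * cmod (1 - cnj (h 0) * h z)"
    by (simp add: F_def Moebius_function_simple norm_divide d_def)
  also have "\<dots> \<le> cmod z * ((1 - (cmod (h 0))\<^sup>2) + d)"
    by (intro mult_mono le \<open>cmod (F z) \<le> cmod z\<close>) auto
  finally have "(1 - cmod z) * d \<le> cmod z * (1 - (cmod (h 0))\<^sup>2)" by (simp add: algebra_simps)
  also have "\<dots> \<le> 1 * (1 - (cmod (h 0))\<^sup>2)"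
    using z h0 by (intro mult_right_mono) (auto simp: power_le_one)
  finally show ?thesis using z by (simp add: d_def field_simps)
qed

text \<open>Quantified over all self-maps \<open>h\<close> at once, so that \<delta> and
  \<open>r\<close> depend on \<open>t\<close> only and serve all zeros of large index
  simultaneously.\<close>

definition almost_rotating :: "real \<Rightarrow> real \<Rightarrow> real \<Rightarrow> bool" where
  "almost_rotating t \<delta> r \<longleftrightarrow>
     (\<forall>h. h holomorphic_on ball 0 1 \<longrightarrow> (\<forall>z. cmod z < 1 \<longrightarrow> cmod (h z) < 1) \<longrightarrow> \<delta> \<le> cmod (h 0) \<longrightarrow>
       inj_on (\<lambda>z. z * h z) (ball 0 r) \<and> (\<forall>z. cmod z = r \<longrightarrow> t < cmod (z * h z)))"

text \<open>When \<open>cmod (h 0)\<close> is close to 1, the Schwarz-Pick bound leaves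
  \<open>h\<close> almost no room to vary, so \<open>z * h z\<close> differs from the linear map
  \<open>h 0 * z\<close> by a term with small Lipschitz constant.\<close>

lemma almost_rotation:
  assumes t: "0 < t" "t < (1::real)"
  obtains \<delta> r where "\<delta> < 1" "t < r" "r < 1" "almost_rotating t \<delta> r"
proof -
  define r where "r = (1 + t) / 2"
  define q where "q = (1 + r) / 2"
  have r: "t < r" "r < q" "q < 1" using t by (auto simp: r_def q_def)
  \<comment> \<open>The bound by \<open>(q - r) / 4\<close> keeps the derivative of the perturbation
    at most 1/4 on \<open>ball 0 r\<close>; the bound by \<open>(r - t) / 4\<close> keeps the
    modulus on the boundary circle above \<open>t\<close>.\<close>
  define e where "e = min ((r - t) / 4) ((q - r) / 4)"
  have e: "0 < e" "4 * e \<le> r - t" "4 * e \<le> q - r" "e < 1/4" using r t by (auto simp: e_def min_def)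
  \<comment> \<open>Chosen so that \<open>1 - (cmod (h 0))\<^sup>2 \<le> e * (1 - q)\<close>, where
    \<open>1 - q\<close> cancels the denominator of the Schwarz-Pick bound.\<close>
  define \<delta> where "\<delta> = 1 - e * (1 - q) / 2"
  have d1: "\<delta> < 1" using e r by (simp add: \<delta>_def)
  have "e * (1 - q) \<le> e * 1" using e r t by (intro mult_left_mono) auto
  then have d2: "1 - \<delta> \<le> e" "0 < \<delta>" unfolding \<delta>_def using e by linarith+
  have "almost_rotating t \<delta> r"
    unfolding almost_rotating_def
  proof (intro allI impI)
    fix h :: "complex \<Rightarrow> complex"
    assume hol: "h holomorphic_on ball 0 1" and bd': "\<forall>z. cmod z < 1 \<longrightarrow> cmod (h z) < 1" and hd: "\<delta> \<le> cmod (h 0)"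
    have bd: "cmod (h z) < 1" if "cmod z < 1" for z using bd' that by blast
    have h0: "cmod (h 0) < 1" using bd[of 0] by simp
    have sq: "1 - (cmod (h 0))\<^sup>2 \<le> e * (1 - q)"
    proof -
      have "1 - (cmod (h 0))\<^sup>2 = (1 - cmod (h 0)) * (1 + cmod (h 0))" by algebra
      also have "\<dots> \<le> (1 - \<delta>) * 2" using hd h0 by (intro mult_mono) auto
      finally show ?thesis by (simp add: \<delta>_def)
    qed
    have diff: "cmod (h z - h 0) \<le> e" if "cmod z \<le> q" for z
    proof -
      have "cmod (h z - h 0) \<le> (1 - (cmod (h 0))\<^sup>2) / (1 - cmod z)"
        by (rule Schwarz_Pick_diff_bound[OF hol bd]) (use that r in auto)
      also have "\<dots> \<le> (e * (1 - q)) / (1 - q)"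
        using sq that r e by (intro frac_le) auto
      finally show ?thesis using r by simp
    qed
    \<comment> \<open>The perturbation: \<open>z * h z = h 0 * z + k z\<close>. Cauchy estimates on
      disks of radius \<open>q - r\<close> control its derivative.\<close>
    define k where "k z = z * (h z - h 0)" for z
    have holk: "k holomorphic_on ball 0 1" unfolding k_def by (intro holomorphic_intros hol)
    have kb: "cmod (k z) \<le> e" if "cmod z \<le> q" for z
    proof -
      have "cmod (k z) \<le> 1 * e"
        unfolding k_def norm_mult using diff[OF that] that r by (intro mult_mono) auto
      then show ?thesis by simp
    qed
    have dk: "cmod (deriv k z) \<le> e / (q - r)" if "z \<in> ball 0 r" for z
    proof -
      have sub: "cball z (q - r) \<subseteq> ball 0 1"
      proof
        fix w assume "w \<in> cball z (q - r)"
        then have "cmod w \<le> cmod z + (q - r)" using norm_triangle_sub[of w z] by (simp add: dist_norm norm_minus_commute)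
        then show "w \<in> ball 0 1" using that r by simp
      qed
      have "norm ((deriv ^^ 1) k z) \<le> fact 1 * e / (q - r) ^ 1"
      proof (rule Cauchy_inequality)
        show "k holomorphic_on ball z (q - r)" using holk sub by (meson ball_subset_cball holomorphic_on_subset order_trans)
        show "continuous_on (cball z (q - r)) k" using holk sub holomorphic_on_imp_continuous_on continuous_on_subset by blast
        show "0 < q - r" using r by simp
        fix x assume "cmod (z - x) = q - r"
        then have "cmod x \<le> q" using norm_triangle_sub[of x z] that by (simp add: norm_minus_commute)
        then show "cmod (k x) \<le> e" by (rule kb)
      qed
      then show ?thesis by simp
    qed
    have "e / (q - r) \<le> 1/4" using e r by (simp add: field_simps)
    then have er: "e / (q - r) < cmod (h 0)" using hd d2 e by linarith
    have "inj_on (\<lambda>z. z * h z) (ball 0 r)"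
    proof (rule inj_onI)
      fix x y assume xy: "x \<in> ball 0 r" "y \<in> ball 0 r" "x * h x = y * h y"
      have "norm (k x - k y) \<le> e / (q - r) * norm (x - y)"
      proof (rule field_differentiable_bound[where S = "ball 0 r" and f' = "deriv k"])
        fix z :: complex assume z: "z \<in> ball 0 r"
        then have "(k has_field_derivative deriv k z) (at z)"
          using r by (intro holomorphic_derivI[OF holk]) auto
        then show "(k has_field_derivative deriv k z) (at z within ball 0 r)" by (rule has_field_derivative_at_within)
      qed (use dk xy in auto)
      moreover have "k x - k y = - (h 0 * (x - y))" using xy(3) by (simp add: k_def algebra_simps)
      ultimately have "cmod (h 0) * cmod (x - y) \<le> e / (q - r) * cmod (x - y)" by (simp add: norm_mult)
      then show "x = y" using er by (smt (verit) mult_le_cancel_right norm_le_zero_iff right_minus_eq)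
    qed
    moreover have "t < cmod (z * h z)" if "cmod z = r" for z
    proof -
      have "cmod (h 0) \<le> cmod (h z) + cmod (h z - h 0)" by (metis norm_minus_commute norm_triangle_sub)
      then have "1 - 2 * e \<le> cmod (h z)" using diff[of z] that r hd d2 by linarith
      then have "r * (1 - 2 * e) \<le> r * cmod (h z)" using r t by (intro mult_left_mono) auto
      moreover have "r * (2 * e) \<le> 1 * (2 * e)" using r e t by (intro mult_right_mono) auto
      ultimately have "r - 2 * e \<le> r * cmod (h z)" by (simp add: algebra_simps)
      then show ?thesis using that e r by (simp add: norm_mult)
    qed
    ultimately show "inj_on (\<lambda>z. z * h z) (ball 0 r) \<and> (\<forall>z. cmod z = r \<longrightarrow> t < cmod (z * h z))" by blast
  qed
  then show ?thesis using that[OF d1 r(1)] r by auto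
qed

text \<open>The frontier of the image of \<open>ball 0 r\<close> lies in the image of the circle,
  where \<open>g\<close> exceeds \<open>t\<close> in modulus. The connected set
  \<open>ball 0 t\<close> meets the image at 0 and cannot cross that frontier, so it lies inside the
  image.\<close>

lemma inverse_on_ball:
  assumes hol: "g holomorphic_on ball 0 1" and r: "0 < r" "r < 1" and inj: "inj_on g (ball 0 r)"
    and g0: "g 0 = 0" and sph: "\<And>z. cmod z = r \<Longrightarrow> t < cmod (g z)" and t: "0 < t"
  obtains u where "u holomorphic_on ball 0 t" "u ` ball 0 t \<subseteq> ball 0 r" "\<And>w. w \<in> ball 0 t \<Longrightarrow> g (u w) = w"
    "\<And>z. z \<in> ball 0 r \<Longrightarrow> u (g z) = z"
proof -
  have holr: "g holomorphic_on ball 0 r" by (rule holomorphic_on_subset[OF hol]) (use r in auto)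
  obtain u where u: "u holomorphic_on g ` ball 0 r" "\<And>z. z \<in> ball 0 r \<Longrightarrow> u (g z) = z"
    using holomorphic_has_inverse[OF holr open_ball inj] by metis
  let ?W = "g ` ball 0 r"
  have op: "open ?W" by (rule open_mapping_thm3[OF holr open_ball inj])
  have sub: "ball 0 t \<subseteq> ?W"
  proof (rule ccontr)
    assume "\<not> ball 0 t \<subseteq> ?W"
    then have "ball 0 t - ?W \<noteq> {}" by auto
    moreover have "ball 0 t \<inter> ?W \<noteq> {}"
    proof
      assume "ball 0 t \<inter> ?W = {}"
      moreover have "0 \<in> ball 0 t \<inter> ?W" using t r g0 by (metis IntI centre_in_ball imageI)
      ultimately show False by (simp only: empty_iff)
    qed
    ultimately have "ball 0 t \<inter> frontier ?W \<noteq> {}"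
      by (intro connected_Int_frontier[OF connected_ball])
    then obtain w where w: "w \<in> ball 0 t" "w \<in> closure ?W" "w \<notin> ?W"
      using op by (auto simp: frontier_def interior_open)
    have "compact (g ` cball 0 r)"
      by (intro compact_continuous_image holomorphic_on_imp_continuous_on holomorphic_on_subset[OF hol]) (use r in auto)
    then have "closure ?W \<subseteq> g ` cball 0 r"
      by (intro closure_minimal compact_imp_closed image_mono) auto
    then obtain z where z: "z \<in> cball 0 r" "w = g z" using w by auto
    with w(3) have "cmod z = r" by (cases "cmod z < r") auto
    with sph z(2) w(1) show False by fastforce
  qed
  show ?thesis
  proof (rule that[OF holomorphic_on_subset[OF u(1) sub]])
    show "u ` ball 0 t \<subseteq> ball 0 r" using sub u(2) by (force simp: subset_iff)
    show "g (u w) = w" if "w \<in> ball 0 t" for w using sub that u(2) by force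
    show "u (g z) = z" if "z \<in> ball 0 r" for z using u(2) that .
  qed
qed

section \<open>Local sections and even covering\<close>

definition local_section :: "(complex \<Rightarrow> complex) \<Rightarrow> complex set \<Rightarrow> (complex \<Rightarrow> complex) \<Rightarrow> bool" where
  "local_section B D s \<longleftrightarrow> s holomorphic_on D \<and> s ` D \<subseteq> unit_disk \<and> (\<forall>x\<in>D. B (s x) = x)"

text \<open>Only a section through every point over \<open>D\<close> is demanded; that distinct
  sheets are disjoint follows, for connected open \<open>D\<close> and holomorphic \<open>B\<close>,
  from uniqueness of sections.\<close>

definition evenly_covered :: "(complex \<Rightarrow> complex) \<Rightarrow> complex set \<Rightarrow> bool" where
  "evenly_covered B D \<longleftrightarrow> (\<forall>z\<in>unit_disk. B z \<in> D \<longrightarrow> (\<exists>s. local_section B D s \<and> s (B z) = z))"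

lemma local_section_subset: "local_section B D s \<Longrightarrow> D' \<subseteq> D \<Longrightarrow> local_section B D' s"
  unfolding local_section_def by (auto intro: holomorphic_on_subset)

text \<open>One radius \<rho> serves all points of the neighbourhood \<open>N\<close>, which is the
  form that a compactness argument over the preimages can use.\<close>

lemma local_section_at_regular_point:
  assumes hol: "B holomorphic_on unit_disk" and w: "w \<in> unit_disk" and dB: "deriv B w \<noteq> 0"
  obtains N \<rho> where "open N" "w \<in> N" "0 < \<rho>"
    "\<And>z. z \<in> N \<Longrightarrow> B z \<in> ball (B w) \<rho> \<Longrightarrow> \<exists>s. local_section B (ball (B w) \<rho>) s \<and> s (B z) = z"
proof -
  obtain r where r: "r > 0" "ball w r \<subseteq> unit_disk" "open (B ` ball w r)" "inj_on B (ball w r)"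
    using has_complex_derivative_locally_invertible[OF hol w open_ball dB] by metis
  have holr: "B holomorphic_on ball w r" by (rule holomorphic_on_subset[OF hol r(2)])
  obtain u where u: "u holomorphic_on B ` ball w r" "\<And>z. z \<in> ball w r \<Longrightarrow> u (B z) = z"
    using holomorphic_has_inverse[OF holr open_ball r(4)] by metis
  obtain \<rho> where rho: "0 < \<rho>" "ball (B w) \<rho> \<subseteq> B ` ball w r"
    using r(1,3) by (meson centre_in_ball imageI open_contains_ball)
  have sec: "local_section B (ball (B w) \<rho>) u"
    unfolding local_section_def
  proof (intro conjI ballI)
    show "u holomorphic_on ball (B w) \<rho>" by (rule holomorphic_on_subset[OF u(1) rho(2)])
    show "u ` ball (B w) \<rho> \<subseteq> unit_disk" using rho(2) u(2) r(2) by fastforce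
    show "B (u x) = x" if "x \<in> ball (B w) \<rho>" for x using rho(2) that u(2) by force
  qed
  show ?thesis
    by (rule that[of "ball w r" \<rho>]) (use r(1) rho(1) sec u(2) in auto)
qed

section \<open>Blaschke factors and Blaschke products\<close>

lemma cmod_blaschke_factor: "cmod (blaschke_factor a z) = cmod (Moebius_function 0 a z)"
  by (auto simp: blaschke_factor_def Moebius_function_simple norm_divide norm_mult norm_minus_commute)

lemma cmod_blaschke_factor_less_1: "cmod a < 1 \<Longrightarrow> cmod z < 1 \<Longrightarrow> cmod (blaschke_factor a z) < 1"
  by (simp add: cmod_blaschke_factor Moebius_function_norm_lt_1)

lemma one_minus_cnj_mult_nonzero:
  assumes "cmod a < 1" "cmod z \<le> 1"
  shows "1 - cnj a * z \<noteq> 0"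
proof
  assume "1 - cnj a * z = 0"
  then have "cmod a * cmod z = 1" by (metis complex_mod_cnj eq_iff_diff_eq_0 norm_mult norm_one)
  moreover have "cmod a * cmod z \<le> cmod a * 1" using assms by (intro mult_left_mono) auto
  ultimately show False using assms by simp
qed

lemma holomorphic_blaschke_factor: "cmod a < 1 \<Longrightarrow> blaschke_factor a holomorphic_on ball 0 1"
  unfolding blaschke_factor_def
  using one_minus_cnj_mult_nonzero[of a] by (cases "a = 0") (auto intro!: holomorphic_intros)

lemma continuous_on_blaschke_factor: "cmod a < 1 \<Longrightarrow> continuous_on (cball 0 1) (blaschke_factor a)"
  unfolding blaschke_factor_def
  using one_minus_cnj_mult_nonzero[of a] by (cases "a = 0") (auto intro!: continuous_intros)

lemma cmod_blaschke_factor_sphere: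
  assumes "cmod a < 1" "cmod z = 1"
  shows "cmod (blaschke_factor a z) = 1"
proof -
  have "1 - cnj a * z = z * (cnj z - cnj a)"
    using assms(2) by (simp add: algebra_simps complex_norm_square[symmetric])
  then have "cmod (1 - cnj a * z) = cmod (a - z)"
    using assms(2) by (simp add: norm_mult norm_minus_commute flip: complex_cnj_diff)
  then show ?thesis
    using one_minus_cnj_mult_nonzero[of a z] assms by (auto simp: blaschke_factor_def norm_mult norm_divide)
qed

lemma hyp_dist_blaschke: "cmod a < 1 \<Longrightarrow> cmod w < 1 \<Longrightarrow> hyp_dist a w = cmod (blaschke_factor a w)"
proof -
  have "cmod (1 - cnj w * a) = cmod (1 - cnj a * w)"
    by (metis complex_cnj_cnj complex_cnj_diff complex_cnj_mult complex_cnj_one complex_mod_cnj mult.commute)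
  then show ?thesis
    unfolding hyp_dist_def cmod_blaschke_factor Moebius_function_simple by (simp add: norm_divide)
qed

text \<open>Up to sign, the numerator of \<open>blaschke_factor a z - 1\<close> contains the factor
  \<open>1 - cmod a\<close>. Summability of these numbers thus majorises the product uniformly on
  smaller disks.\<close>

lemma blaschke_factor_minus_1_bound:
  assumes a: "cmod a < 1" and z: "cmod z \<le> r" "r < 1"
  shows "cmod (blaschke_factor a z - 1) \<le> (1 - cmod a) * (2 / (1 - r))"
proof -
  have r0: "0 \<le> r" using z(1) norm_ge_zero order_trans by blast
  have "cmod (blaschke_factor a z - 1) \<le> (1 - cmod a) * (1 + cmod z) / (1 - cmod z)"
  proof (cases "a = 0")
    case True
    have "cmod (z - 1) \<le> 1 + cmod z" using norm_triangle_ineq4[of z 1] by simp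
    also have "\<dots> \<le> (1 + cmod z) / (1 - cmod z)" using z by (simp add: field_simps)
    finally show ?thesis using True by (simp add: blaschke_factor_def)
  next
    case False
    have nz: "1 - cnj a * z \<noteq> 0" using one_minus_cnj_mult_nonzero[OF a] z by simp
    have aa: "a * cnj a = of_real (cmod a) * of_real (cmod a)"
      by (simp add: complex_norm_square[symmetric] power2_eq_square flip: of_real_mult)
    have "blaschke_factor a z - 1 = (of_real (cmod a) * (a - z) - a * (1 - cnj a * z)) / (a * (1 - cnj a * z))"
      using False nz by (simp add: blaschke_factor_def field_simps)
    also have "of_real (cmod a) * (a - z) - a * (1 - cnj a * z) = - (of_real (1 - cmod a) * (a + of_real (cmod a) * z))"
      using aa by (simp add: algebra_simps)
    finally have "cmod (blaschke_factor a z - 1) = (1 - cmod a) * cmod (a + of_real (cmod a) * z) / (cmod a * cmod (1 - cnj a * z))"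
      using a by (simp add: norm_divide norm_mult del: of_real_diff)
    also have "\<dots> \<le> ((1 - cmod a) * (cmod a * (1 + cmod z))) / (cmod a * (1 - cmod z))"
    proof (rule frac_le)
      show "(1 - cmod a) * cmod (a + of_real (cmod a) * z) \<le> (1 - cmod a) * (cmod a * (1 + cmod z))"
        using a norm_triangle_ineq[of a "of_real (cmod a) * z"] by (intro mult_left_mono) (auto simp: norm_mult algebra_simps)
      have "cmod (cnj a * z) \<le> 1 * cmod z" unfolding norm_mult using a by (intro mult_right_mono) auto
      then have "1 - cmod z \<le> cmod (1 - cnj a * z)" using norm_triangle_ineq2[of 1 "cnj a * z"] by simp
      then show "cmod a * (1 - cmod z) \<le> cmod a * cmod (1 - cnj a * z)" by (intro mult_left_mono) auto
      show "0 < cmod a * (1 - cmod z)" using False z by simp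
      show "0 \<le> (1 - cmod a) * (cmod a * (1 + cmod z))" using a by simp
    qed
    also have "\<dots> = (cmod a * ((1 - cmod a) * (1 + cmod z))) / (cmod a * (1 - cmod z))"
      by (simp add: mult.left_commute)
    also have "\<dots> = (1 - cmod a) * (1 + cmod z) / (1 - cmod z)"
      by (rule mult_divide_mult_cancel_left) (use False in simp)
    finally show ?thesis .
  qed
  also have "\<dots> = (1 - cmod a) * ((1 + cmod z) / (1 - cmod z))" by simp
  also have "\<dots> \<le> (1 - cmod a) * (2 / (1 - r))"
    using a z by (intro mult_left_mono frac_le) auto
  finally show ?thesis .
qed

locale blaschke_sequence =
  fixes a :: "nat \<Rightarrow> complex"
  assumes a_less_1: "\<And>n. cmod (a n) < 1"
    and summable_a: "summable (\<lambda>n. 1 - cmod (a n))"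
begin

text \<open>Factors outside \<open>J\<close> are replaced by 1, so every subproduct runs over all
  natural numbers and splitting an index set is termwise multiplication.\<close>

definition bterm :: "nat set \<Rightarrow> nat \<Rightarrow> complex \<Rightarrow> complex" where
  "bterm J n z = (if n \<in> J then blaschke_factor (a n) z else 1)"

definition bprod :: "nat set \<Rightarrow> complex \<Rightarrow> complex" where
  "bprod J z = (\<Prod>n. bterm J n z)"

lemma norm_bterm_le: "cmod z < 1 \<Longrightarrow> cmod (bterm J n z) \<le> 1"
  using cmod_blaschke_factor_less_1[OF a_less_1[of n], of z] by (auto simp: bterm_def)

lemma bterm_minus_1_bound: "cmod z \<le> r \<Longrightarrow> r < 1 \<Longrightarrow> cmod (bterm J n z - 1) \<le> (1 - cmod (a n)) * (2 / (1 - r))"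
  using blaschke_factor_minus_1_bound[OF a_less_1, of z r n] a_less_1[of n]
  by (auto simp: bterm_def less_imp_le)

lemma convergent_bterm:
  assumes "cmod z < 1" shows "convergent_prod (\<lambda>n. bterm J n z)"
proof (rule abs_convergent_prod_imp_convergent_prod, rule summable_imp_abs_convergent_prod)
  show "summable (\<lambda>n. norm (bterm J n z - 1))"
    by (rule summable_comparison_test'[OF summable_mult2[OF summable_a, of "2 / (1 - cmod z)"]])
       (use bterm_minus_1_bound[of z "cmod z" J] assms in auto)
qed

lemma has_prod_bprod: "cmod z < 1 \<Longrightarrow> (\<lambda>n. bterm J n z) has_prod bprod J z"
  unfolding bprod_def by (intro convergent_prod_has_prod convergent_bterm)

lemma LIMSEQ_bprod: "cmod z < 1 \<Longrightarrow> (\<lambda>n. \<Prod>i\<le>n. bterm J i z) \<longlonglongrightarrow> bprod J z"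
  unfolding bprod_def by (intro convergent_prod_LIMSEQ convergent_bterm)

lemma norm_bprod_le_1: "cmod z < 1 \<Longrightarrow> cmod (bprod J z) \<le> 1"
  by (rule Lim_bounded[OF tendsto_norm[OF LIMSEQ_bprod]])
     (auto simp: prod_norm[symmetric] intro!: prod_le_1 norm_bterm_le)

lemma bprod_mult: "J \<inter> K = {} \<Longrightarrow> cmod z < 1 \<Longrightarrow> bprod (J \<union> K) z = bprod J z * bprod K z"
  unfolding bprod_def
  by (subst prodinf_mult[OF convergent_bterm convergent_bterm]) (auto simp: bterm_def intro!: prodinf_cong)

lemma bprod_finite: "finite J \<Longrightarrow> bprod J z = (\<Prod>n\<in>J. blaschke_factor (a n) z)"
  unfolding bprod_def by (subst prodinf_finite[of J]) (auto simp: bterm_def)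

lemma norm_bprod_less_1:
  assumes "n \<in> J" "cmod z < 1" shows "cmod (bprod J z) < 1"
proof -
  have "bprod J z = bprod {n} z * bprod (J - {n}) z"
    using bprod_mult[of "{n}" "J - {n}" z] assms by (simp add: insert_absorb)
  then have "cmod (bprod J z) = cmod (blaschke_factor (a n) z) * cmod (bprod (J - {n}) z)"
    by (simp add: norm_mult bprod_finite)
  also have "\<dots> \<le> cmod (blaschke_factor (a n) z) * 1"
    by (intro mult_left_mono norm_bprod_le_1 assms) auto
  also have "\<dots> < 1" using cmod_blaschke_factor_less_1[OF a_less_1 assms(2)] by simp
  finally show ?thesis .
qed

lemma norm_bprod_antimono:
  assumes "J \<subseteq> K" "cmod z < 1" shows "cmod (bprod K z) \<le> cmod (bprod J z)"
proof -
  have "bprod K z = bprod J z * bprod (K - J) z"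
    using bprod_mult[of J "K - J" z] assms by (simp add: Un_absorb1)
  then show ?thesis
    using mult_left_mono[OF norm_bprod_le_1[OF assms(2), of "K - J"], of "cmod (bprod J z)"] by (simp add: norm_mult)
qed

lemma holomorphic_bprod: "bprod J holomorphic_on ball 0 1"
proof -
  have "\<exists>d>0. cball z d \<subseteq> ball 0 1 \<and> uniform_limit (cball z d) (\<lambda>n z. \<Prod>i<n. bterm J i z) (bprod J) sequentially"
    if "z \<in> ball 0 1" for z
  proof -
    define d where "d = (1 - cmod z) / 2"
    have d: "0 < d" "cmod z + d < 1" using that by (auto simp: d_def field_simps)
    have le: "cmod w \<le> cmod z + d" if "w \<in> cball z d" for w
      using that norm_triangle_sub[of w z] by (simp add: dist_norm norm_minus_commute)
    have sub: "cball z d \<subseteq> ball 0 1" using le d by fastforce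
    have "uniformly_convergent_on (cball z d) (\<lambda>n w. \<Prod>i<n. bterm J i w)"
    proof (rule uniformly_convergent_on_prod')
      show "continuous_on (cball z d) (bterm J i)" for i
      proof (cases "i \<in> J")
        case True
        then show ?thesis unfolding bterm_def
          using continuous_on_subset[OF continuous_on_blaschke_factor[OF a_less_1]] sub by (auto simp: subset_iff less_imp_le)
      qed (simp add: bterm_def)
      show "uniformly_convergent_on (cball z d) (\<lambda>n w. \<Sum>i<n. norm (bterm J i w - 1))"
        by (rule Weierstrass_m_test'[OF _ summable_mult2[OF summable_a, of "2 / (1 - (cmod z + d))"]])
           (use bterm_minus_1_bound le d in auto)
    qed auto
    then obtain l where l: "uniform_limit (cball z d) (\<lambda>n w. \<Prod>i<n. bterm J i w) l sequentially"
      by (auto simp: uniformly_convergent_on_def)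
    have "l w = bprod J w" if "w \<in> cball z d" for w
    proof (rule LIMSEQ_unique)
      show "(\<lambda>n. \<Prod>i<n. bterm J i w) \<longlonglongrightarrow> l w" by (rule tendsto_uniform_limitI[OF l that])
      show "(\<lambda>n. \<Prod>i<n. bterm J i w) \<longlonglongrightarrow> bprod J w"
        using LIMSEQ_bprod[of w J] le[OF that] d by (subst LIMSEQ_lessThan_iff_atMost) auto
    qed
    then show ?thesis using l d sub by (metis (no_types, lifting) uniform_limit_cong')
  qed
  then show ?thesis
  proof (rule holomorphic_uniform_sequence[OF open_ball, rotated])
    show "(\<lambda>z. \<Prod>i<n. bterm J i z) holomorphic_on ball 0 1" for n
    proof (rule holomorphic_on_prod)
      show "bterm J i holomorphic_on ball 0 1" for i
        using holomorphic_blaschke_factor[OF a_less_1, of i] unfolding bterm_def by (cases "i \<in> J") auto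
    qed
  qed
qed

lemma continuous_on_bprod_finite: "finite J \<Longrightarrow> continuous_on (cball 0 1) (bprod J)"
  by (subst continuous_on_cong[OF refl bprod_finite]) (auto intro!: continuous_intros continuous_on_blaschke_factor a_less_1)

lemma norm_bprod_finite_sphere: "finite J \<Longrightarrow> cmod z = 1 \<Longrightarrow> cmod (bprod J z) = 1"
  by (auto simp: bprod_finite prod_norm[symmetric] cmod_blaschke_factor_sphere[OF a_less_1] intro!: prod.neutral)

lemma norm_bprod_at_zero:
  "cmod (bprod (- {k}) (a k)) = (\<Prod>j. if j = k then 1 else hyp_dist (a j) (a k))"
proof -
  have "(\<lambda>n. norm (bterm (- {k}) n (a k))) has_prod norm (bprod (- {k}) (a k))"
    by (intro has_prod_norm has_prod_bprod a_less_1)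
  moreover have "(\<lambda>n. norm (bterm (- {k}) n (a k))) = (\<lambda>j. if j = k then 1 else hyp_dist (a j) (a k))"
    by (auto simp: bterm_def hyp_dist_blaschke a_less_1)
  ultimately show ?thesis using has_prod_unique by fastforce
qed

text \<open>
  The minimum modulus principle for the quotient of the finite products with indices up to \<open>m\<close> and
  below \<open>k0\<close>: it is zero free off the hyperbolic disks around the zeros of index at least \<open>k0\<close>, and
  where the larger product has modulus \<open>t\<close>, the quotient has modulus at least \<open>t\<close>.
\<close>

lemma norm_bprod_initial_le:
  assumes z: "cmod z < 1" "cmod (bprod UNIV z) < s" and st: "s < t" "t < 1" and r: "0 < r"
    and sph: "\<And>k w. k0 \<le> k \<Longrightarrow> cmod w < 1 \<Longrightarrow> cmod (blaschke_factor (a k) w) = r \<Longrightarrow> t < cmod (bprod UNIV w)"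
    and far: "\<And>k. k0 \<le> k \<Longrightarrow> r \<le> cmod (blaschke_factor (a k) z)"
  shows "cmod (bprod {..<k0} z) \<le> s / t"
proof -
  have s0: "0 < s" using z(2) norm_ge_zero order_le_less_trans by blast
  have t0: "0 < t" using s0 st by simp
  have "(\<lambda>n. norm (\<Prod>i\<le>n. bterm UNIV i z)) \<longlonglongrightarrow> norm (bprod UNIV z)"
    by (intro tendsto_norm LIMSEQ_bprod z)
  then have "\<forall>\<^sub>F n in sequentially. norm (\<Prod>i\<le>n. bterm UNIV i z) < s"
    using z(2) by (rule order_tendstoD)
  then obtain n0 where n0: "\<And>n. n0 \<le> n \<Longrightarrow> norm (\<Prod>i\<le>n. bterm UNIV i z) < s"
    by (auto simp: eventually_sequentially)
  \<comment> \<open>A finite product is continuous on the closed disk with modulus one on the unit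
    circle, so a sublevel set with \<open>t < 1\<close> stays away from that circle. This boundary
    control is the reason for truncating at \<open>m\<close>.\<close>
  obtain m where m: "k0 \<le> m" "norm (\<Prod>i\<le>m. bterm UNIV i z) < s"
    by (rule that[of "max n0 k0"]) (use n0 in auto)
  let ?P = "bprod {..m}" and ?Q = "bprod {k0..m}" and ?R = "bprod {..<k0}"
  have Pz: "cmod (?P z) < s" using m(2) by (simp add: bprod_finite bterm_def)
  have PRQ: "?P w = ?R w * ?Q w" if "cmod w < 1" for w
  proof -
    have "{..m} = {..<k0} \<union> {k0..m}" using m(1) by auto
    moreover have "{..<k0} \<inter> {k0..m} = {}" by auto
    ultimately show ?thesis using bprod_mult that by metis
  qed
  define U where "U = {w \<in> ball 0 1. cmod (?P w) < t \<and> (\<forall>k\<in>{k0..m}. r < cmod (blaschke_factor (a k) w))}"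
  define V where "V = {w \<in> cball 0 1. cmod (?P w) \<le> t \<and> (\<forall>k\<in>{k0..m}. r \<le> cmod (blaschke_factor (a k) w))}"
  have contP: "continuous_on (cball 0 1) ?P" by (rule continuous_on_bprod_finite) simp
  have contb: "continuous_on (cball 0 1) (blaschke_factor (a k))" for k
    by (rule continuous_on_blaschke_factor[OF a_less_1])
  have "closed (cball 0 1 \<inter> (\<lambda>w. cmod (?P w)) -` {..t})"
    by (intro continuous_closed_preimage continuous_on_norm contP) auto
  moreover have "closed (\<Inter>k\<in>{k0..m}. cball 0 1 \<inter> (\<lambda>w. cmod (blaschke_factor (a k) w)) -` {r..})"
    by (intro closed_INT ballI continuous_closed_preimage continuous_on_norm contb) auto
  ultimately have "closed ((cball 0 1 \<inter> (\<lambda>w. cmod (?P w)) -` {..t}) \<inter> (\<Inter>k\<in>{k0..m}. cball 0 1 \<inter> (\<lambda>w. cmod (blaschke_factor (a k) w)) -` {r..}))"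
    by (rule closed_Int)
  moreover have "(cball 0 1 \<inter> (\<lambda>w. cmod (?P w)) -` {..t}) \<inter> (\<Inter>k\<in>{k0..m}. cball 0 1 \<inter> (\<lambda>w. cmod (blaschke_factor (a k) w)) -` {r..}) = V"
    using m(1) by (auto simp: V_def)
  ultimately have "closed V" by simp
  have "U \<subseteq> V" by (auto simp: U_def V_def)
  then have UV: "closure U \<subseteq> V" by (rule closure_minimal[OF _ \<open>closed V\<close>])
  have V1: "cmod w < 1" if "w \<in> V" for w
  proof (rule ccontr)
    assume "\<not> cmod w < 1"
    then have "cmod w = 1" using that by (auto simp: V_def)
    then have "cmod (?P w) = 1" by (intro norm_bprod_finite_sphere) auto
    then show False using that st by (auto simp: V_def)
  qed
  have "open (ball 0 1 \<inter> (\<lambda>w. cmod (?P w)) -` {..<t})"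
    by (intro continuous_open_preimage continuous_on_norm continuous_on_subset[OF contP]) auto
  moreover have "open (\<Inter>k\<in>{k0..m}. ball 0 1 \<inter> (\<lambda>w. cmod (blaschke_factor (a k) w)) -` {r<..})"
    by (intro open_INT ballI continuous_open_preimage continuous_on_norm continuous_on_subset[OF contb]) auto
  ultimately have "open ((ball 0 1 \<inter> (\<lambda>w. cmod (?P w)) -` {..<t}) \<inter> (\<Inter>k\<in>{k0..m}. ball 0 1 \<inter> (\<lambda>w. cmod (blaschke_factor (a k) w)) -` {r<..}))"
    by (rule open_Int)
  moreover have "(ball 0 1 \<inter> (\<lambda>w. cmod (?P w)) -` {..<t}) \<inter> (\<Inter>k\<in>{k0..m}. ball 0 1 \<inter> (\<lambda>w. cmod (blaschke_factor (a k) w)) -` {r<..}) = U"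
    using m(1) by (auto simp: U_def)
  ultimately have "open U" by simp
  have Qnz: "?Q w \<noteq> 0" if "w \<in> V" for w
    using that r by (auto simp: bprod_finite V_def)
  have "norm (inverse (?Q z)) \<le> inverse t"
  proof (rule maximum_modulus_frontier[where S = U and f = "\<lambda>w. inverse (?Q w)" and \<xi> = z])
    show "(\<lambda>w. inverse (?Q w)) holomorphic_on interior U"
      using Qnz \<open>U \<subseteq> V\<close> interior_subset[of U]
      by (intro holomorphic_on_inverse holomorphic_on_subset[OF holomorphic_bprod]) (auto simp: U_def)
    show "continuous_on (closure U) (\<lambda>w. inverse (?Q w))"
      using Qnz UV V1 by (intro continuous_on_inverse holomorphic_on_imp_continuous_on holomorphic_on_subset[OF holomorphic_bprod]) auto
    show "bounded U" by (rule bounded_subset[OF bounded_ball[of 0 1]]) (auto simp: U_def)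
    show "z \<in> U"
    proof -
      have "r < cmod (blaschke_factor (a k) z)" if "k0 \<le> k" for k
        using far[OF that] sph[OF that z(1)] z(2) st by force
      then show ?thesis using Pz z(1) st by (auto simp: U_def)
    qed
    fix w assume "w \<in> frontier U"
    then have w: "w \<in> V" "w \<notin> U" using UV \<open>open U\<close> by (auto simp: frontier_def interior_open)
    have w1: "cmod w < 1" by (rule V1[OF w(1)])
    \<comment> \<open>A frontier point with \<open>cmod (?P w) < t\<close> would lie on one of the
      hyperbolic circles of radius \<open>r\<close>. There the full product exceeds \<open>t\<close>
      by \<open>sph\<close>, and dropping factors only increases the modulus.\<close>
    have "cmod (?P w) = t"
    proof (rule ccontr)
      assume "cmod (?P w) \<noteq> t"
      then have lt: "cmod (?P w) < t" using w(1) by (auto simp: V_def)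
      then obtain k where k: "k \<in> {k0..m}" "cmod (blaschke_factor (a k) w) = r"
        using w w1 by (fastforce simp: U_def V_def)
      then have "t < cmod (bprod UNIV w)" using sph w1 by auto
      also have "\<dots> \<le> cmod (?P w)" by (rule norm_bprod_antimono) (use w1 in auto)
      finally show False using lt by simp
    qed
    moreover have "cmod (?P w) \<le> 1 * cmod (?Q w)"
      unfolding PRQ[OF w1] norm_mult using norm_bprod_le_1[OF w1] by (intro mult_right_mono) auto
    ultimately show "norm (inverse (?Q w)) \<le> inverse t"
      unfolding norm_inverse using t0 by (intro le_imp_inverse_le) auto
  qed
  then have "cmod (?P z) * norm (inverse (?Q z)) \<le> s * inverse t"
    using Pz s0 by (intro mult_mono) auto
  moreover have "z \<in> V"
  proof -
    show ?thesis using Pz z(1) st far by (auto simp: V_def)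
  qed
  ultimately show ?thesis
    using Qnz[of z] PRQ[OF z(1)] by (simp add: norm_mult norm_inverse divide_inverse mult.assoc)
qed

text \<open>
  In the coordinate of the disk centred at \<open>a k\<close>, \<open>B\<close> takes the form \<open>z * h z\<close> with \<open>h\<close> bounded by one
  and \<open>cmod (h 0)\<close> close to one.
\<close>

lemma local_section_near_zero:
  assumes c: "cmod c = 1" and B: "\<And>z. cmod z < 1 \<Longrightarrow> B z = c * bprod UNIV z"
    and r: "0 < t" "t < r" "r < 1"
    and rot: "almost_rotating t \<delta> r"
    and k: "\<delta> \<le> cmod (bprod (- {k}) (a k))"
  shows "cmod z < 1 \<Longrightarrow> cmod (blaschke_factor (a k) z) = r \<Longrightarrow> t < cmod (B z)"
    and "cmod z < 1 \<Longrightarrow> cmod (blaschke_factor (a k) z) < r \<Longrightarrow> B z \<in> ball 0 t \<Longrightarrow>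
          \<exists>s. local_section B (ball 0 t) s \<and> s (B z) = z"
    and "\<not> B constant_on unit_disk"
proof -
  define M where "M = Moebius_function 0 (a k)"
  define N where "N = Moebius_function 0 (- a k)"
  have ak: "cmod (a k) < 1" "cmod (- a k) < 1" using a_less_1 by auto
  have NM: "N (M z) = z" "M (N z) = z" if "cmod z < 1" for z
    unfolding M_def N_def using that ak by (auto intro!: Moebius_function_compose)
  have M1: "cmod (M z) < 1" and N1: "cmod (N z) < 1" if "cmod z < 1" for z
    unfolding M_def N_def using that ak by (auto intro!: Moebius_function_norm_lt_1)
  have N0: "N 0 = a k" by (simp add: N_def Moebius_function_of_zero)
  have holN: "N holomorphic_on ball 0 1" unfolding N_def by (rule Moebius_function_holomorphic[OF ak(2)])
  obtain u where u: "cmod u = 1" "\<And>z. blaschke_factor (a k) z = u * M z"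
  proof (cases "a k = 0")
    case True
    show ?thesis by (rule that[of 1]) (auto simp: True blaschke_factor_def M_def Moebius_function_simple)
  next
    case False
    have "(of_real (cmod (a k)) / a k) * ((a k - z) / q) = - (of_real (cmod (a k)) / a k) * ((z - a k) / q)" for z q
      by (metis minus_diff_eq minus_divide_left minus_mult_commute)
    then show ?thesis using False
      by (intro that[of "- (of_real (cmod (a k)) / a k)"]) (auto simp: norm_divide blaschke_factor_def M_def Moebius_function_simple)
  qed
  have normb: "cmod (blaschke_factor (a k) z) = cmod (M z)" for z using u by (simp add: norm_mult)
  define h where "h w = c * u * bprod (- {k}) (N w)" for w
  define g where "g w = w * h w" for w
  have gB: "g w = B (N w)" if "cmod w < 1" for w
  proof -
    have "bprod UNIV (N w) = blaschke_factor (a k) (N w) * bprod (- {k}) (N w)"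
      using bprod_mult[of "{k}" "- {k}" "N w"] N1[OF that] by (simp add: bprod_finite)
    then show ?thesis unfolding g_def h_def B[OF N1[OF that]] u NM(2)[OF that] by simp
  qed
  have BgM: "B z = g (M z)" if "cmod z < 1" for z using gB[OF M1[OF that]] NM(1)[OF that] by simp
  have "h holomorphic_on ball 0 1"
    unfolding h_def using holomorphic_on_compose_gen[OF holN holomorphic_bprod[of "- {k}"], unfolded o_def] N1
    by (intro holomorphic_intros) (auto simp: image_subset_iff)
  \<comment> \<open>Strict inequality needs one remaining factor; \<open>Suc k\<close> is an index
    different from \<open>k\<close>.\<close>
  moreover have "cmod (h w) < 1" if "cmod w < 1" for w
    using norm_bprod_less_1[of "Suc k" "- {k}" "N w"] N1[OF that] c u by (simp add: h_def norm_mult)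
  moreover have "\<delta> \<le> cmod (h 0)" using k c u by (simp add: h_def N0 norm_mult)
  ultimately have inj: "inj_on g (ball 0 r)" and sph: "\<And>z. cmod z = r \<Longrightarrow> t < cmod (g z)"
    using rot[unfolded almost_rotating_def, rule_format, of h] unfolding g_def by auto
  show "t < cmod (B z)" if "cmod z < 1" "cmod (blaschke_factor (a k) z) = r" for z
    using that sph[of "M z"] by (simp add: normb BgM)
  have holg: "g holomorphic_on ball 0 1" unfolding g_def by (intro holomorphic_intros \<open>h holomorphic_on ball 0 1\<close>)
  have r0: "0 < r" using r by simp
  have g0: "g 0 = 0" by (simp add: g_def)
  obtain v where v: "v holomorphic_on ball 0 t" "v ` ball 0 t \<subseteq> ball 0 r" "\<And>w. w \<in> ball 0 t \<Longrightarrow> g (v w) = w"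
    "\<And>z. z \<in> ball 0 r \<Longrightarrow> v (g z) = z"
    using inverse_on_ball[OF holg r0 r(3) inj g0 sph r(1)] by metis
  have v1: "v ` ball 0 t \<subseteq> ball 0 1" using v(2) r(3) by fastforce
  have sec: "local_section B (ball 0 t) (\<lambda>w. N (v w))"
    unfolding local_section_def
  proof (intro conjI ballI)
    show "(\<lambda>w. N (v w)) holomorphic_on ball 0 t"
      using holomorphic_on_compose_gen[OF v(1) holN v1] by (simp add: o_def)
    show "(\<lambda>w. N (v w)) ` ball 0 t \<subseteq> unit_disk" using v1 N1 by (auto simp: image_subset_iff)
    show "B (N (v x)) = x" if "x \<in> ball 0 t" for x
      using v(3)[OF that] gB[of "v x"] v1 that by (auto simp: image_subset_iff)
  qed
  show "\<exists>s. local_section B (ball 0 t) s \<and> s (B z) = z"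
    if z: "cmod z < 1" "cmod (blaschke_factor (a k) z) < r" "B z \<in> ball 0 t" for z
    using sec v(4)[of "M z"] z NM(1)[OF z(1)] by (intro exI[of _ "\<lambda>w. N (v w)"]) (simp add: normb BgM)
  show "\<not> B constant_on unit_disk"
  proof
    assume "B constant_on unit_disk"
    then obtain y where y: "\<And>z. z \<in> unit_disk \<Longrightarrow> B z = y" by (auto simp: constant_on_def)
    have "cmod (of_real (r/2)) < 1" using r by simp
    from N1[OF this] have "B (N (of_real (r/2))) = B (N 0)" using N1[of 0] y by simp
    then have "g (of_real (r/2)) = g 0" using gB[of 0] gB[of "of_real (r/2)"] r by simp
    then have "of_real (r/2) = (0::complex)" using inj r by (auto dest!: inj_onD)
    then show False using r by simp
  qed
qed

text \<open>One radius has to serve infinitely many preimages. Those near a zero of large index have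
  sections over all of \<open>ball 0 t\<close>; by \<open>norm_bprod_initial_le\<close> the others
  lie in the compact set \<open>K\<close>, where finitely many neighbourhoods with their own radii
  suffice.\<close>

lemma evenly_covered_near_regular_value:
  assumes c: "cmod c = 1" and B: "\<And>z. cmod z < 1 \<Longrightarrow> B z = c * bprod UNIV z"
    and lim: "(\<lambda>k. cmod (bprod (- {k}) (a k))) \<longlonglongrightarrow> 1"
    and l: "cmod l < 1" "l \<notin> critical_values B"
  shows "\<exists>\<rho>>0. ball l \<rho> \<subseteq> unit_disk \<and> evenly_covered B (ball l \<rho>)"
proof -
  \<comment> \<open>The levels \<open>s\<close> and \<open>t\<close> divide the interval from
    \<open>cmod l\<close> to 1 into thirds: \<open>t\<close> is the level up to which
    \<open>B\<close> is inverted near zeros, \<open>s\<close> bounds the values in the disk around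
    \<open>l\<close>, and \<open>s / t < 1\<close> keeps \<open>K\<close> off the unit
    circle.\<close>
  define s where "s = (2 * cmod l + 1) / 3"
  define t where "t = (cmod l + 2) / 3"
  have st: "cmod l < s" "s < t" "t < 1" "0 < t" using l(1) by (auto simp: s_def t_def intro: add_nonneg_pos)
  obtain \<delta> r where r: "\<delta> < 1" "t < r" "r < 1"
    and rot: "almost_rotating t \<delta> r"
    using almost_rotation[OF st(4,3)] by auto
  have "\<forall>\<^sub>F k in sequentially. \<delta> < cmod (bprod (- {k}) (a k))" by (rule order_tendstoD(1)[OF lim r(1)])
  then obtain k0 where "\<forall>k\<ge>k0. \<delta> < cmod (bprod (- {k}) (a k))"
    unfolding eventually_sequentially by blast
  then have k0: "\<And>k. k0 \<le> k \<Longrightarrow> \<delta> \<le> cmod (bprod (- {k}) (a k))" by (simp add: less_imp_le)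
  have near1: "t < cmod (B z)"
    if "k0 \<le> k" "cmod z < 1" "cmod (blaschke_factor (a k) z) = r" for k z
    by (rule local_section_near_zero(1)[where k = k, OF c B st(4) r(2,3) rot k0]) (use that in auto)
  have near2: "\<exists>s. local_section B (ball 0 t) s \<and> s (B z) = z"
    if "k0 \<le> k" "cmod z < 1" "cmod (blaschke_factor (a k) z) < r" "B z \<in> ball 0 t" for k z
    by (rule local_section_near_zero(2)[where k = k, OF c B st(4) r(2,3) rot k0]) (use that in auto)
  have normB: "cmod (B z) = cmod (bprod UNIV z)" if "cmod z < 1" for z using B[OF that] c by (simp add: norm_mult)
  have holB: "B holomorphic_on unit_disk"
    by (rule holomorphic_transform[of "\<lambda>z. c * bprod UNIV z"]) (auto intro!: holomorphic_intros holomorphic_bprod simp: B)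
  define K where "K = {z \<in> cball 0 1. cmod (bprod {..<k0} z) \<le> s / t}"
  have "K = cball 0 1 \<inter> (\<lambda>z. cmod (bprod {..<k0} z)) -` {..s/t}" by (auto simp: K_def)
  moreover have "closed (cball 0 1 \<inter> (\<lambda>z. cmod (bprod {..<k0} z)) -` {..s/t})"
    by (intro continuous_closed_preimage continuous_on_norm continuous_on_bprod_finite) auto
  ultimately have "closed K" by simp
  moreover have "bounded K" by (rule bounded_subset[OF bounded_cball[of 0 1]]) (auto simp: K_def)
  ultimately have compK: "compact K" by (simp add: compact_eq_bounded_closed)
  have K1: "cmod z < 1" if "z \<in> K" for z
  proof (rule ccontr)
    assume "\<not> cmod z < 1"
    then have "cmod z = 1" using that by (auto simp: K_def)
    then have "1 \<le> s / t" using that norm_bprod_finite_sphere[of "{..<k0}" z] by (auto simp: K_def)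
    then show False using st by simp
  qed
  have "\<exists>N \<rho>. open N \<and> w \<in> N \<and> 0 < \<rho> \<and>
      (\<forall>z\<in>N. cmod z < 1 \<and> B z \<in> ball l \<rho> \<longrightarrow> (\<exists>s. local_section B (ball l \<rho>) s \<and> s (B z) = z))" if w: "w \<in> K" for w
  proof (cases "B w = l")
    case True
    then have "deriv B w \<noteq> 0" using l(2) K1[OF w] by (auto simp: critical_values_def)
    then obtain N \<rho> where "open N" "w \<in> N" "0 < \<rho>"
      "\<And>z. z \<in> N \<Longrightarrow> B z \<in> ball (B w) \<rho> \<Longrightarrow> \<exists>s. local_section B (ball (B w) \<rho>) s \<and> s (B z) = z"
      using local_section_at_regular_point[OF holB, of w] K1[OF w] by auto
    then show ?thesis unfolding True by blast
  next
    case False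
    \<comment> \<open>Near \<open>w\<close> the values of \<open>B\<close> avoid
      \<open>cball l \<rho>\<close>, so the requirement on sections holds vacuously there.\<close>
    define \<rho> where "\<rho> = dist l (B w) / 2"
    have rho: "0 < \<rho>" using False by (simp add: \<rho>_def)
    have "open (unit_disk \<inter> B -` (- cball l \<rho>))"
      by (intro continuous_open_preimage holomorphic_on_imp_continuous_on holB) auto
    moreover have "w \<in> unit_disk \<inter> B -` (- cball l \<rho>)" using K1[OF w] rho by (auto simp: \<rho>_def)
    ultimately show ?thesis using rho
      by (intro exI[of _ "unit_disk \<inter> B -` (- cball l \<rho>)"] exI[of _ \<rho>]) auto
  qed
  then obtain N \<rho> where N: "\<And>w. w \<in> K \<Longrightarrow> open (N w)" "\<And>w. w \<in> K \<Longrightarrow> w \<in> N w" "\<And>w. w \<in> K \<Longrightarrow> 0 < \<rho> w"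
    "\<And>w z. w \<in> K \<Longrightarrow> z \<in> N w \<Longrightarrow> cmod z < 1 \<Longrightarrow> B z \<in> ball l (\<rho> w) \<Longrightarrow> \<exists>s. local_section B (ball l (\<rho> w)) s \<and> s (B z) = z"
    by metis
  obtain F where F: "F \<subseteq> K" "finite F" "K \<subseteq> (\<Union>w\<in>F. N w)"
    by (rule compactE_image[OF compK, of K N]) (use N in auto)
  define R where "R = Min (insert (s - cmod l) (\<rho> ` F))"
  have R: "0 < R" "R \<le> s - cmod l" "\<And>w. w \<in> F \<Longrightarrow> R \<le> \<rho> w"
    unfolding R_def using F N(3) st by (auto simp: subset_iff)
  have ls: "cmod x < s" if "x \<in> ball l R" for x
    using that R(2) norm_triangle_sub[of x l] by (simp add: dist_norm norm_minus_commute)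
  show ?thesis
  proof (intro exI conjI)
    show "0 < R" by (rule R(1))
    show "ball l R \<subseteq> unit_disk" using ls st by fastforce
    show "evenly_covered B (ball l R)"
      unfolding evenly_covered_def
    proof (intro ballI impI)
      fix z assume z: "z \<in> unit_disk" "B z \<in> ball l R"
      have z1: "cmod z < 1" using z by simp
      have Bz: "cmod (B z) < s" by (rule ls[OF z(2)])
      show "\<exists>s. local_section B (ball l R) s \<and> s (B z) = z"
      proof (cases "\<exists>k\<ge>k0. cmod (blaschke_factor (a k) z) < r")
        case True
        then obtain k where "k0 \<le> k" "cmod (blaschke_factor (a k) z) < r" by blast
        moreover have "ball l R \<subseteq> ball 0 t" using ls st by fastforce
        moreover have "B z \<in> ball 0 t" using Bz st by simp
        ultimately obtain s where "local_section B (ball 0 t) s" "s (B z) = z" using near2[of k z] z1 by blast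
        then show ?thesis using \<open>ball l R \<subseteq> ball 0 t\<close> local_section_subset by blast
      next
        case False
        have "cmod (bprod {..<k0} z) \<le> s / t"
        proof (rule norm_bprod_initial_le[OF z1 _ st(2,3)])
          show "cmod (bprod UNIV z) < s" using Bz normB[OF z1] by simp
          show "t < cmod (bprod UNIV w)" if "k0 \<le> k" "cmod w < 1" "cmod (blaschke_factor (a k) w) = r" for k w
            using near1[OF that] normB[OF that(2)] by simp
        qed (use False r st in auto)
        then have "z \<in> K" using z1 by (auto simp: K_def)
        then obtain w where w: "w \<in> F" "z \<in> N w" using F by blast
        have "ball l R \<subseteq> ball l (\<rho> w)" using R(3)[OF w(1)] by auto
        moreover obtain s where "local_section B (ball l (\<rho> w)) s" "s (B z) = z"
          using N(4)[of w z] w F z z1 R(3)[OF w(1)] by force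
        ultimately show ?thesis using local_section_subset by blast
      qed
    qed
  qed
qed

end

text \<open>The interface to the operator theory: every later argument uses thinness through these
  four properties alone.\<close>

theorem thin_blaschke_product_properties:
  assumes "thin_blaschke_product B"
  shows "B holomorphic_on unit_disk" "B ` unit_disk \<subseteq> unit_disk" "\<not> B constant_on unit_disk"
    "\<And>l. l \<in> unit_disk \<Longrightarrow> l \<notin> critical_values B \<Longrightarrow> \<exists>\<rho>>0. ball l \<rho> \<subseteq> unit_disk \<and> evenly_covered B (ball l \<rho>)"
proof -
  obtain a c where a: "\<And>n. a n \<in> unit_disk" "summable (\<lambda>n. 1 - cmod (a n))" and c: "cmod c = 1"
    and Bz: "\<And>z. z \<in> unit_disk \<Longrightarrow> B z = c * (\<Prod>n. blaschke_factor (a n) z)"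
    and lim: "(\<lambda>k. \<Prod>j. if j = k then 1 else hyp_dist (a j) (a k)) \<longlonglongrightarrow> 1"
    using assms unfolding thin_blaschke_product_def infinite_blaschke_product_def by blast
  interpret blaschke_sequence a by unfold_locales (use a in auto)
  have B: "B z = c * bprod UNIV z" if "cmod z < 1" for z
    using Bz[of z] that by (simp add: bprod_def bterm_def)
  have lim': "(\<lambda>k. cmod (bprod (- {k}) (a k))) \<longlonglongrightarrow> 1" using lim by (simp add: norm_bprod_at_zero)
  show "B holomorphic_on unit_disk"
    by (rule holomorphic_transform[of "\<lambda>z. c * bprod UNIV z"]) (auto intro!: holomorphic_intros holomorphic_bprod simp: B)
  show "B ` unit_disk \<subseteq> unit_disk" using norm_bprod_less_1[of 0 UNIV] c by (auto simp: B norm_mult)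
  show "\<exists>\<rho>>0. ball l \<rho> \<subseteq> unit_disk \<and> evenly_covered B (ball l \<rho>)" if "l \<in> unit_disk" "l \<notin> critical_values B" for l
    by (rule evenly_covered_near_regular_value[OF c B lim']) (use that in auto)
  obtain \<delta> r where r: "\<delta> < 1" "1/2 < r" "r < 1"
    and rot: "almost_rotating (1/2) \<delta> r"
    using almost_rotation[of "1/2"] by auto
  have "\<forall>\<^sub>F k in sequentially. \<delta> < cmod (bprod (- {k}) (a k))" by (rule order_tendstoD(1)[OF lim' r(1)])
  then obtain k where "\<delta> < cmod (bprod (- {k}) (a k))"
    unfolding eventually_sequentially by blast
  then have "\<delta> \<le> cmod (bprod (- {k}) (a k))" by simp
  then show "\<not> B constant_on unit_disk"
    by (intro local_section_near_zero(3)[OF c B _ r(2,3) rot]) auto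
qed

section \<open>The Bergman space as a Hilbert space\<close>

lemma sets_unit_disk [measurable]: "unit_disk \<in> sets borel"
  by simp

lemma borel_measurable_cnj [measurable]: "cnj \<in> borel_measurable borel"
  by (intro borel_measurable_continuous_onI continuous_intros)

lemma disk_measure_eq: "disk_measure = density lborel (\<lambda>z. ennreal (indicat_real unit_disk z / pi))"
proof -
  have "emeasure lborel unit_disk = ennreal pi"
    using emeasure_ball[of 1 "0::complex"] by (simp add: unit_ball_vol_2)
  then show ?thesis
    unfolding disk_measure_def uniform_measure_def
    by (intro arg_cong[where f = "density lborel"]) (auto simp: indicator_def divide_ennreal simp flip: ennreal_1)
qed

lemma integrable_disk_measure:
  fixes f :: "complex \<Rightarrow> 'a::{banach,second_countable_topology}"
  assumes [measurable]: "f \<in> borel_measurable borel"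
  shows "integrable disk_measure f \<longleftrightarrow> set_integrable lborel unit_disk f"
proof -
  have "integrable disk_measure f \<longleftrightarrow> integrable lborel (\<lambda>z. (indicat_real unit_disk z / pi) *\<^sub>R f z)"
    unfolding disk_measure_eq by (subst integrable_density) auto
  also have "(\<lambda>z. (indicat_real unit_disk z / pi) *\<^sub>R f z) = (\<lambda>z. (1 / pi) *\<^sub>R (indicat_real unit_disk z *\<^sub>R f z))" by auto
  also have "integrable lborel \<dots> \<longleftrightarrow> integrable lborel (\<lambda>z. indicat_real unit_disk z *\<^sub>R f z)"
    using integrable_scaleR_right[of "1 / pi" lborel "\<lambda>z. indicat_real unit_disk z *\<^sub>R f z"]
      integrable_scaleR_right[of pi lborel "\<lambda>z. (1 / pi) *\<^sub>R (indicat_real unit_disk z *\<^sub>R f z)"] by auto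
  finally show ?thesis unfolding set_integrable_def .
qed

lemma integral_disk_measure:
  fixes f :: "complex \<Rightarrow> 'a::{banach,second_countable_topology}"
  assumes [measurable]: "f \<in> borel_measurable borel"
  shows "(LINT z|disk_measure. f z) = (1 / pi) *\<^sub>R (LINT z:unit_disk|lborel. f z)"
proof -
  have "(LINT z|disk_measure. f z) = (LINT z|lborel. (indicat_real unit_disk z / pi) *\<^sub>R f z)"
    unfolding disk_measure_eq by (subst integral_density) auto
  also have "(\<lambda>z. (indicat_real unit_disk z / pi) *\<^sub>R f z) = (\<lambda>z. (1 / pi) *\<^sub>R (indicat_real unit_disk z *\<^sub>R f z))" by auto
  finally show ?thesis unfolding set_lebesgue_integral_def by (simp del: scaleR_scaleR)
qed

lemma borel_measurable_holomorphic_disk: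
  assumes "f holomorphic_on unit_disk" "\<And>z. z \<notin> unit_disk \<Longrightarrow> f z = 0"
  shows "f \<in> borel_measurable borel"
proof -
  have "(\<lambda>z. indicat_real unit_disk z *\<^sub>R f z) = f" using assms(2) by (auto simp: indicator_def)
  then show ?thesis using borel_measurable_holomorphic_indicator[OF assms(1)] by simp
qed

lemma bergman_space_iff:
  "f \<in> bergman_space \<longleftrightarrow> f holomorphic_on unit_disk \<and> (\<forall>z. z \<notin> unit_disk \<longrightarrow> f z = 0) \<and>
     set_integrable lborel unit_disk (\<lambda>z. (cmod (f z))\<^sup>2)"
proof -
  have "integrable disk_measure (\<lambda>z. (cmod (f z))\<^sup>2) \<longleftrightarrow> set_integrable lborel unit_disk (\<lambda>z. (cmod (f z))\<^sup>2)"
    if "f holomorphic_on unit_disk" "\<forall>z. z \<notin> unit_disk \<longrightarrow> f z = 0"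
    using borel_measurable_holomorphic_disk[of f] that by (intro integrable_disk_measure) auto
  then show ?thesis by (auto simp: bergman_space_def)
qed

lemma bergman_spaceD:
  assumes "f \<in> bergman_space"
  shows "f holomorphic_on unit_disk" "\<And>z. z \<notin> unit_disk \<Longrightarrow> f z = 0"
    "set_integrable lborel unit_disk (\<lambda>z. (cmod (f z))\<^sup>2)" "f \<in> borel_measurable borel"
  using assms borel_measurable_holomorphic_disk[of f] by (auto simp: bergman_space_iff)

lemma set_integrable_bergman_mult:
  assumes f: "f \<in> bergman_space" and g: "g \<in> bergman_space"
  shows "set_integrable lborel unit_disk (\<lambda>z. f z * cnj (g z))"
proof (rule set_integrable_bound)
  note [measurable] = bergman_spaceD(4)[OF f] bergman_spaceD(4)[OF g]
  show "set_integrable lborel unit_disk (\<lambda>z. (cmod (f z))\<^sup>2 + (cmod (g z))\<^sup>2)"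
    by (intro set_integral_add bergman_spaceD f g)
  show "set_borel_measurable lborel unit_disk (\<lambda>z. f z * cnj (g z))"
    unfolding set_borel_measurable_def by measurable
  have "cmod (f z) * cmod (g z) \<le> (cmod (f z))\<^sup>2 + (cmod (g z))\<^sup>2" for z
  proof -
    have "0 \<le> cmod (f z) * cmod (g z)" by simp
    then show ?thesis using sum_squares_bound[of "cmod (f z)" "cmod (g z)"] by linarith
  qed
  then show "AE z in lborel. z \<in> unit_disk \<longrightarrow> norm (f z * cnj (g z)) \<le> norm ((cmod (f z))\<^sup>2 + (cmod (g z))\<^sup>2)"
    by (auto simp: norm_mult)
qed

lemma bergman_inner_eq:
  assumes f: "f \<in> bergman_space" and g: "g \<in> bergman_space"
  shows "bergman_inner f g = (1 / pi) *\<^sub>R (LINT z:unit_disk|lborel. f z * cnj (g z))"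
proof -
  note [measurable] = bergman_spaceD(4)[OF f] bergman_spaceD(4)[OF g]
  show ?thesis unfolding bergman_inner_def by (rule integral_disk_measure) measurable
qed

lemma bergman_inner_self:
  assumes f: "f \<in> bergman_space"
  shows "bergman_inner f f = of_real ((1 / pi) * (LINT z:unit_disk|lborel. (cmod (f z))\<^sup>2))"
proof -
  have "(LINT z:unit_disk|lborel. f z * cnj (f z)) = (LINT z:unit_disk|lborel. of_real ((cmod (f z))\<^sup>2))"
    by (simp only: complex_norm_square)
  also have "\<dots> = of_real (LINT z:unit_disk|lborel. (cmod (f z))\<^sup>2)"
    by (rule set_integral_complex_of_real)
  finally show ?thesis unfolding bergman_inner_eq[OF f f] by (simp add: scaleR_conv_of_real)
qed

lemma bergman_norm_eq:
  assumes f: "f \<in> bergman_space"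
  shows "bergman_norm f = sqrt (Re (bergman_inner f f))"
proof -
  note [measurable] = bergman_spaceD(4)[OF f]
  show ?thesis unfolding bergman_norm_def bergman_inner_self[OF f] by (subst integral_disk_measure) auto
qed

lemma zero_bergman_space: "(\<lambda>z. 0) \<in> bergman_space"
  by (auto simp: bergman_space_iff set_integrable_def)

lemma bounded_mult_bergman_space:
  assumes h: "h holomorphic_on unit_disk" "\<And>z. z \<in> unit_disk \<Longrightarrow> cmod (h z) \<le> C" and f: "f \<in> bergman_space"
  shows "(\<lambda>z. h z * f z) \<in> bergman_space"
  unfolding bergman_space_iff
proof (intro conjI allI impI)
  show hol: "(\<lambda>z. h z * f z) holomorphic_on unit_disk" by (intro holomorphic_intros h bergman_spaceD f)
  show zero: "h z * f z = 0" if "z \<notin> unit_disk" for z using bergman_spaceD(2)[OF f that] by simp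
  have [measurable]: "(\<lambda>z. h z * f z) \<in> borel_measurable borel"
    by (rule borel_measurable_holomorphic_disk[OF hol zero])
  show "set_integrable lborel unit_disk (\<lambda>z. (cmod (h z * f z))\<^sup>2)"
  proof (rule set_integrable_bound)
    show "set_integrable lborel unit_disk (\<lambda>z. C\<^sup>2 * (cmod (f z))\<^sup>2)"
      using bergman_spaceD(3)[OF f] by simp
    show "set_borel_measurable lborel unit_disk (\<lambda>z. (cmod (h z * f z))\<^sup>2)"
      unfolding set_borel_measurable_def by measurable
    have "(cmod (h z))\<^sup>2 * (cmod (f z))\<^sup>2 \<le> C\<^sup>2 * (cmod (f z))\<^sup>2" if "z \<in> unit_disk" for z
      using h(2)[OF that] by (intro mult_right_mono power_mono) auto
    then show "AE z in lborel. z \<in> unit_disk \<longrightarrow> norm ((cmod (h z * f z))\<^sup>2) \<le> norm (C\<^sup>2 * (cmod (f z))\<^sup>2)"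
      by (auto simp: norm_mult power_mult_distrib)
  qed
qed

lemma scale_bergman_space: "f \<in> bergman_space \<Longrightarrow> (\<lambda>z. c * f z) \<in> bergman_space"
  by (rule bounded_mult_bergman_space[of "\<lambda>z. c" "cmod c"]) auto

lemma add_bergman_space:
  assumes f: "f \<in> bergman_space" and g: "g \<in> bergman_space"
  shows "(\<lambda>z. f z + g z) \<in> bergman_space"
  unfolding bergman_space_iff
proof (intro conjI allI impI)
  note [measurable] = bergman_spaceD(4)[OF f] bergman_spaceD(4)[OF g]
  show "(\<lambda>z. f z + g z) holomorphic_on unit_disk" by (intro holomorphic_intros bergman_spaceD f g)
  show "f z + g z = 0" if "z \<notin> unit_disk" for z using bergman_spaceD(2)[OF f that] bergman_spaceD(2)[OF g that] by simp
  show "set_integrable lborel unit_disk (\<lambda>z. (cmod (f z + g z))\<^sup>2)"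
  proof (rule set_integrable_bound)
    show "set_integrable lborel unit_disk (\<lambda>z. 2 * (cmod (f z))\<^sup>2 + 2 * (cmod (g z))\<^sup>2)"
      using bergman_spaceD(3)[OF f] bergman_spaceD(3)[OF g] by (intro set_integral_add) auto
    show "set_borel_measurable lborel unit_disk (\<lambda>z. (cmod (f z + g z))\<^sup>2)"
      unfolding set_borel_measurable_def by measurable
    have "(cmod (f z + g z))\<^sup>2 \<le> 2 * (cmod (f z))\<^sup>2 + 2 * (cmod (g z))\<^sup>2" for z
    proof -
      have "(cmod (f z + g z))\<^sup>2 \<le> (cmod (f z) + cmod (g z))\<^sup>2" by (intro power_mono norm_triangle_ineq) auto
      also have "\<dots> \<le> 2 * (cmod (f z))\<^sup>2 + 2 * (cmod (g z))\<^sup>2"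
        using sum_squares_bound[of "cmod (f z)" "cmod (g z)"] by (simp add: power2_sum)
      finally show ?thesis .
    qed
    then show "AE z in lborel. z \<in> unit_disk \<longrightarrow> norm ((cmod (f z + g z))\<^sup>2) \<le> norm (2 * (cmod (f z))\<^sup>2 + 2 * (cmod (g z))\<^sup>2)"
      by auto
  qed
qed

lemma diff_bergman_space: "f \<in> bergman_space \<Longrightarrow> g \<in> bergman_space \<Longrightarrow> (\<lambda>z. f z - g z) \<in> bergman_space"
  using add_bergman_space[of f "\<lambda>z. -1 * g z"] scale_bergman_space[of g "-1"] by simp

lemma bergman_inner_add_left:
  assumes "f \<in> bergman_space" "g \<in> bergman_space" "h \<in> bergman_space"
  shows "bergman_inner (\<lambda>z. f z + g z) h = bergman_inner f h + bergman_inner g h"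
  using set_integrable_bergman_mult[OF assms(1,3)] set_integrable_bergman_mult[OF assms(2,3)]
  by (simp add: bergman_inner_eq assms add_bergman_space distrib_right set_integral_add scaleR_right_distrib)

lemma bergman_inner_scale_left:
  assumes "f \<in> bergman_space" "h \<in> bergman_space"
  shows "bergman_inner (\<lambda>z. c * f z) h = c * bergman_inner f h"
  by (simp add: bergman_inner_eq assms scale_bergman_space mult.assoc)

lemma bergman_inner_commute: "bergman_inner g f = cnj (bergman_inner f g)"
proof -
  have "cnj (bergman_inner f g) = (LINT z|disk_measure. cnj (f z * cnj (g z)))"
    unfolding bergman_inner_def by (rule Bochner_Integration.integral_cnj[symmetric])
  then show ?thesis unfolding bergman_inner_def by (simp add: mult.commute)
qed

lemma bergman_inner_diff_left:
  assumes "f \<in> bergman_space" "g \<in> bergman_space" "h \<in> bergman_space"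
  shows "bergman_inner (\<lambda>z. f z - g z) h = bergman_inner f h - bergman_inner g h"
  using bergman_inner_add_left[OF assms(1) scale_bergman_space[OF assms(2), of "-1"] assms(3)]
    bergman_inner_scale_left[OF assms(2,3), of "-1"] by simp

lemma bergman_inner_scale_right:
  assumes "f \<in> bergman_space" "h \<in> bergman_space"
  shows "bergman_inner h (\<lambda>z. c * f z) = cnj c * bergman_inner h f"
  by (simp add: bergman_inner_commute[of h] bergman_inner_scale_left assms)

lemma bergman_inner_add_right:
  assumes "f \<in> bergman_space" "g \<in> bergman_space" "h \<in> bergman_space"
  shows "bergman_inner h (\<lambda>z. f z + g z) = bergman_inner h f + bergman_inner h g"
  by (simp add: bergman_inner_commute[of h] bergman_inner_add_left assms)

lemma bergman_inner_diff_right: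
  assumes "f \<in> bergman_space" "g \<in> bergman_space" "h \<in> bergman_space"
  shows "bergman_inner h (\<lambda>z. f z - g z) = bergman_inner h f - bergman_inner h g"
  by (simp add: bergman_inner_commute[of h] bergman_inner_diff_left assms)

text \<open>Continuity of point evaluations, from the mean value inequality on the largest disk
  around \<open>z\<close>; the factor \<open>pi\<close> cancels against the normalisation of
  area.\<close>

lemma bergman_eval_bound:
  assumes f: "f \<in> bergman_space" and z: "z \<in> unit_disk"
  shows "(cmod (f z))\<^sup>2 \<le> 4 / (1 - cmod z)\<^sup>2 * Re (bergman_inner f f)"
proof -
  define r where "r = 1 - cmod z"
  have r: "0 < r" using z by (simp add: r_def)
  have sub: "ball z r \<subseteq> unit_disk"
  proof
    fix w assume "w \<in> ball z r"
    then show "w \<in> unit_disk" using norm_triangle_sub[of w z] by (simp add: r_def dist_norm norm_minus_commute)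
  qed
  have int: "set_integrable lborel (ball z r) (\<lambda>w. (cmod (f w))\<^sup>2)"
    by (rule set_integrable_subset[OF bergman_spaceD(3)[OF f] _ sub]) auto
  have "(cmod (f z))\<^sup>2 \<le> 4 / (pi * r\<^sup>2) * (LINT w:ball z r|lborel. (cmod (f w))\<^sup>2)"
    by (rule holomorphic_norm_sq_le_integral[OF holomorphic_on_subset[OF bergman_spaceD(1)[OF f] sub] r int])
  also have "\<dots> \<le> 4 / (pi * r\<^sup>2) * (LINT w:unit_disk|lborel. (cmod (f w))\<^sup>2)"
  proof (intro mult_left_mono)
    show "(LINT w:ball z r|lborel. (cmod (f w))\<^sup>2) \<le> (LINT w:unit_disk|lborel. (cmod (f w))\<^sup>2)"
      unfolding set_lebesgue_integral_def
      by (intro integral_mono int[unfolded set_integrable_def] bergman_spaceD(3)[OF f, unfolded set_integrable_def])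
         (use sub in \<open>auto simp: indicator_def\<close>)
  qed auto
  also have "\<dots> = 4 / r\<^sup>2 * Re (bergman_inner f f)" by (simp add: bergman_inner_self[OF f])
  finally show ?thesis by (simp add: r_def)
qed

lemma Re_bergman_inner_self_nonneg: "f \<in> bergman_space \<Longrightarrow> 0 \<le> Re (bergman_inner f f)"
  unfolding bergman_inner_self by (auto simp: set_lebesgue_integral_def intro!: integral_nonneg_AE)

lemma Re_bergman_inner_self_eq_0:
  assumes f: "f \<in> bergman_space" and 0: "Re (bergman_inner f f) = 0"
  shows "f = (\<lambda>z. 0)"
proof
  fix z show "f z = 0"
    using bergman_eval_bound[OF f, of z] 0 bergman_spaceD(2)[OF f, of z] by (cases "z \<in> unit_disk") auto
qed

text \<open>
  The real part of the inner product makes the Bergman space a real Hilbert space; complex linear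
  statements are recovered by replacing \<open>f\<close> with its multiple by the imaginary unit.
\<close>

typedef bergman = bergman_space morphisms bfun Bfun
  using zero_bergman_space by blast

lemmas bfun_simps [simp] = bfun bfun_inverse

instantiation bergman :: real_vector
begin

definition "0 = Bfun (\<lambda>z. 0)"
definition "f + g = Bfun (\<lambda>z. bfun f z + bfun g z)"
definition "f - g = Bfun (\<lambda>z. bfun f z - bfun g z)"
definition "- f = Bfun (\<lambda>z. - bfun f z)"
definition "c *\<^sub>R f = Bfun (\<lambda>z. of_real c * bfun f z)"
lemma bfun_zero: "bfun 0 = (\<lambda>z. 0)"
  unfolding zero_bergman_def by (rule Bfun_inverse[OF zero_bergman_space])

lemma bfun_add: "bfun (f + g) = (\<lambda>z. bfun f z + bfun g z)"
  unfolding plus_bergman_def by (rule Bfun_inverse) (simp add: add_bergman_space)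

lemma bfun_diff: "bfun (f - g) = (\<lambda>z. bfun f z - bfun g z)"
  unfolding minus_bergman_def by (rule Bfun_inverse) (simp add: diff_bergman_space)

lemma bfun_uminus: "bfun (- f) = (\<lambda>z. - bfun f z)"
  unfolding uminus_bergman_def using scale_bergman_space[of "bfun f" "-1"] by (intro Bfun_inverse) simp

lemma bfun_scaleR: "bfun (c *\<^sub>R f) = (\<lambda>z. of_real c * bfun f z)"
  unfolding scaleR_bergman_def by (rule Bfun_inverse) (simp add: scale_bergman_space)

instance
proof
  fix x y z :: bergman and r s :: real
  note inj = bfun_inject[symmetric] fun_eq_iff
  show "x + y + z = x + (y + z)" "x + y = y + x" "0 + x = x" "- x + x = 0" "x - y = x + - y"
    by (simp_all add: inj bfun_zero bfun_add bfun_diff bfun_uminus algebra_simps)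
  show "r *\<^sub>R (x + y) = r *\<^sub>R x + r *\<^sub>R y" "(r + s) *\<^sub>R x = r *\<^sub>R x + s *\<^sub>R x"
    "r *\<^sub>R s *\<^sub>R x = (r * s) *\<^sub>R x" "1 *\<^sub>R x = x"
    by (simp_all add: inj bfun_add bfun_scaleR algebra_simps)
qed

end

instantiation bergman :: real_inner
begin

definition "inner f g = Re (bergman_inner (bfun f) (bfun g))"
definition norm_bergman :: "bergman \<Rightarrow> real" where "norm_bergman f = sqrt (inner f f)"
definition dist_bergman :: "bergman \<Rightarrow> bergman \<Rightarrow> real" where "dist_bergman f g = norm (f - g)"
definition sgn_bergman :: "bergman \<Rightarrow> bergman" where "sgn_bergman f = inverse (norm f) *\<^sub>R f"
definition uniformity_bergman :: "(bergman \<times> bergman) filter" where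
  "uniformity_bergman = (INF e\<in>{0 <..}. principal {(x, y). dist x y < e})"
definition open_bergman :: "bergman set \<Rightarrow> bool" where
  "open_bergman U \<longleftrightarrow> (\<forall>x\<in>U. eventually (\<lambda>(x', y). x' = x \<longrightarrow> y \<in> U) uniformity)"

instance
proof
  fix x y z :: bergman and r :: real
  show "dist x y = norm (x - y)" by (rule dist_bergman_def)
  show "sgn x = x /\<^sub>R norm x" by (rule sgn_bergman_def)
  show "uniformity = (INF e\<in>{0 <..}. principal {(x, y). dist (x::bergman) y < e})" by (rule uniformity_bergman_def)
  show "open U \<longleftrightarrow> (\<forall>x\<in>U. eventually (\<lambda>(x', y). x' = x \<longrightarrow> y \<in> U) uniformity)" for U :: "bergman set"
    by (rule open_bergman_def)
  show "inner x y = inner y x" unfolding inner_bergman_def by (subst bergman_inner_commute) simp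
  show "inner (x + y) z = inner x z + inner y z"
    unfolding inner_bergman_def bfun_add by (simp add: bergman_inner_add_left)
  show "inner (r *\<^sub>R x) y = r * inner x y"
    unfolding inner_bergman_def bfun_scaleR by (simp add: bergman_inner_scale_left)
  show "0 \<le> inner x x" unfolding inner_bergman_def by (simp add: Re_bergman_inner_self_nonneg)
  show "inner x x = 0 \<longleftrightarrow> x = 0"
    unfolding inner_bergman_def using Re_bergman_inner_self_eq_0[of "bfun x"]
    by (auto simp: bfun_zero bfun_inject[symmetric] bergman_inner_def)
  show "norm x = sqrt (inner x x)" by (rule norm_bergman_def)
qed

end

section \<open>Completeness of the Bergman space\<close>

lemma norm_bergman_eq: "norm f = bergman_norm (bfun f)"
  by (simp add: bergman_norm_eq norm_eq_sqrt_inner inner_bergman_def)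

lemma cmod_bfun_le:
  assumes "z \<in> unit_disk" shows "cmod (bfun f z) \<le> 2 / (1 - cmod z) * norm f"
proof -
  have "(cmod (bfun f z))\<^sup>2 \<le> 4 / (1 - cmod z)\<^sup>2 * (norm f)\<^sup>2"
    using bergman_eval_bound[OF bfun assms, of f] by (simp add: power2_norm_eq_inner inner_bergman_def)
  also have "\<dots> = (2 / (1 - cmod z) * norm f)\<^sup>2" by (simp add: power_mult_distrib power_divide)
  finally show ?thesis by (rule power2_le_imp_le) (use assms in auto)
qed

text \<open>Fatou's lemma. It gives both membership of a pointwise limit and the bound on its norm,
  hence also norm convergence when applied to differences.\<close>

lemma bergman_space_limit:
  assumes u: "\<And>m. u m \<in> bergman_space" and bd: "\<And>m. (LINT z:unit_disk|lborel. (cmod (u m z))\<^sup>2) \<le> C"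
    and lim: "\<And>z. z \<in> unit_disk \<Longrightarrow> (\<lambda>m. u m z) \<longlonglongrightarrow> g z"
    and g: "g holomorphic_on unit_disk" "\<And>z. z \<notin> unit_disk \<Longrightarrow> g z = 0"
  shows "g \<in> bergman_space" "(LINT z:unit_disk|lborel. (cmod (g z))\<^sup>2) \<le> C"
proof -
  note [measurable] = borel_measurable_holomorphic_disk[OF g] bergman_spaceD(4)[OF u]
  have C0: "0 \<le> C" using bd[of 0] by (rule order_trans[rotated]) (auto simp: set_lebesgue_integral_def intro!: integral_nonneg_AE)
  let ?U = "\<lambda>m z. ennreal (indicat_real unit_disk z * (cmod (u m z))\<^sup>2)"
  let ?G = "\<lambda>z. indicat_real unit_disk z * (cmod (g z))\<^sup>2"
  have "(\<integral>\<^sup>+z. ?U m z \<partial>lborel) \<le> ennreal C" for m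
  proof -
    have "(\<integral>\<^sup>+z. ?U m z \<partial>lborel) = ennreal (LINT z|lborel. indicat_real unit_disk z * (cmod (u m z))\<^sup>2)"
      using bergman_spaceD(3)[OF u[of m]] by (intro nn_integral_eq_integral) (auto simp: set_integrable_def)
    then show ?thesis using bd[of m] by (simp add: set_lebesgue_integral_def ennreal_leI)
  qed
  then have "liminf (\<lambda>m. \<integral>\<^sup>+z. ?U m z \<partial>lborel) \<le> ennreal C"
    by (intro Liminf_le) auto
  moreover have "(\<integral>\<^sup>+z. liminf (\<lambda>m. ?U m z) \<partial>lborel) \<le> liminf (\<lambda>m. \<integral>\<^sup>+z. ?U m z \<partial>lborel)"
    by (intro nn_integral_liminf) measurable
  moreover have "liminf (\<lambda>m. ?U m z) = ennreal (?G z)" for z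
  proof (rule lim_imp_Liminf)
    show "(\<lambda>m. ?U m z) \<longlonglongrightarrow> ennreal (?G z)"
    proof (cases "z \<in> unit_disk")
      case True
      then show ?thesis using lim[OF True] by (intro tendsto_ennrealI tendsto_intros)
    qed auto
  qed simp
  ultimately have le: "(\<integral>\<^sup>+z. ennreal (?G z) \<partial>lborel) \<le> ennreal C" by simp
  have int: "integrable lborel ?G"
    by (rule integrableI_nonneg) (use le in \<open>auto simp: top_unique less_top[symmetric]\<close>)
  then show "g \<in> bergman_space" using g by (simp add: bergman_space_iff set_integrable_def)
  have "ennreal (LINT z|lborel. ?G z) \<le> ennreal C"
    using le nn_integral_eq_integral[OF int] by simp
  then show "(LINT z:unit_disk|lborel. (cmod (g z))\<^sup>2) \<le> C" using C0 by (simp add: set_lebesgue_integral_def)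
qed

lemma norm_bergman_sq: "(norm f)\<^sup>2 = (1 / pi) * (LINT z:unit_disk|lborel. (cmod (bfun f z))\<^sup>2)"
  unfolding power2_norm_eq_inner inner_bergman_def bergman_inner_self[OF bfun] by simp

text \<open>By bounded point evaluations a Cauchy sequence in norm is uniformly Cauchy on smaller
  disks, so it has a holomorphic limit; \<open>bergman_space_limit\<close> then brings the limit
  back into the space.\<close>

instance bergman :: complete_space
proof
  fix X :: "nat \<Rightarrow> bergman" assume "Cauchy X"
  have unif: "\<exists>N. \<forall>m\<ge>N. \<forall>n\<ge>N. \<forall>w. cmod w \<le> r \<longrightarrow> dist (bfun (X m) w) (bfun (X n) w) < e"
    if "r < 1" "0 < e" for r e :: real
  proof -
    have "0 < e * (1 - r) / 2" using that by simp
    from metric_CauchyD[OF \<open>Cauchy X\<close> this]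
    obtain N where N: "\<And>m n. N \<le> m \<Longrightarrow> N \<le> n \<Longrightarrow> dist (X m) (X n) < e * (1 - r) / 2" by blast
    have "dist (bfun (X m) w) (bfun (X n) w) < e" if mn: "N \<le> m" "N \<le> n" and w: "cmod w \<le> r" for m n w
    proof -
      have "dist (bfun (X m) w) (bfun (X n) w) = cmod (bfun (X m - X n) w)" by (simp add: dist_norm bfun_diff)
      also have "\<dots> \<le> 2 / (1 - cmod w) * norm (X m - X n)" using w \<open>r < 1\<close> by (intro cmod_bfun_le) auto
      also have "\<dots> \<le> 2 / (1 - r) * norm (X m - X n)" using w \<open>r < 1\<close> by (intro mult_right_mono frac_le) auto
      also have "\<dots> < 2 / (1 - r) * (e * (1 - r) / 2)"
        using N[OF mn] \<open>r < 1\<close> by (intro mult_strict_left_mono) (auto simp: dist_norm)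
      also have "\<dots> = e" using \<open>r < 1\<close> by simp
      finally show ?thesis .
    qed
    then show ?thesis by blast
  qed
  have conv: "convergent (\<lambda>n. bfun (X n) w)" for w
  proof (cases "w \<in> unit_disk")
    case True
    have "Cauchy (\<lambda>n. bfun (X n) w)"
      by (rule metric_CauchyI) (use unif[of "cmod w"] True in fastforce)
    then show ?thesis by (simp add: Cauchy_convergent_iff)
  next
    case False
    then show ?thesis using bergman_spaceD(2)[OF bfun False] by (simp add: convergent_const)
  qed
  define g where "g w = lim (\<lambda>n. bfun (X n) w)" for w
  have lim: "(\<lambda>n. bfun (X n) w) \<longlonglongrightarrow> g w" for w
    using conv[of w] by (simp add: g_def convergent_LIMSEQ_iff)
  have g0: "g w = 0" if "w \<notin> unit_disk" for w
    using lim[of w] bergman_spaceD(2)[OF bfun that] by (simp add: LIMSEQ_const_iff)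
  have ul: "uniform_limit {w. cmod w \<le> r} (\<lambda>n. bfun (X n)) g sequentially" if r: "r < 1" for r
  proof -
    have "uniformly_Cauchy_on {w. cmod w \<le> r} (\<lambda>n. bfun (X n))"
      unfolding uniformly_Cauchy_on_def using unif[OF r] by blast
    then have "uniformly_convergent_on {w. cmod w \<le> r} (\<lambda>n. bfun (X n))"
      by (rule Cauchy_uniformly_convergent)
    then obtain l where l: "uniform_limit {w. cmod w \<le> r} (\<lambda>n. bfun (X n)) l sequentially"
      by (auto simp: uniformly_convergent_on_def)
    have "l w = g w" if "w \<in> {w. cmod w \<le> r}" for w
      by (rule LIMSEQ_unique[OF tendsto_uniform_limitI[OF l that] lim])
    then show ?thesis using l by (metis (no_types, lifting) uniform_limit_cong')
  qed
  have holg: "g holomorphic_on unit_disk"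
  proof (rule holomorphic_uniform_sequence[OF open_ball, of "\<lambda>n. bfun (X n)"])
    show "bfun (X n) holomorphic_on unit_disk" for n by (rule bergman_spaceD(1)[OF bfun])
    fix z :: complex assume "z \<in> unit_disk"
    define d where "d = (1 - cmod z) / 2"
    have d: "0 < d" "cmod z + d < 1" using \<open>z \<in> unit_disk\<close> by (auto simp: d_def field_simps)
    have le: "cmod w \<le> cmod z + d" if "w \<in> cball z d" for w
      using that norm_triangle_sub[of w z] by (simp add: dist_norm norm_minus_commute)
    have "cball z d \<subseteq> unit_disk" using le d by fastforce
    moreover have "uniform_limit (cball z d) (\<lambda>n. bfun (X n)) g sequentially"
      by (rule uniform_limit_on_subset[OF ul[OF d(2)]]) (use le in auto)
    ultimately show "\<exists>d>0. cball z d \<subseteq> unit_disk \<and> uniform_limit (cball z d) (\<lambda>n. bfun (X n)) g sequentially"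
      using d by blast
  qed
  have main: "(\<lambda>z. bfun (X n) z - g z) \<in> bergman_space \<and>
      (LINT z:unit_disk|lborel. (cmod (bfun (X n) z - g z))\<^sup>2) \<le> pi * e\<^sup>2"
    if N: "\<And>m n. N \<le> m \<Longrightarrow> N \<le> n \<Longrightarrow> dist (X m) (X n) < e" and n: "N \<le> n" and e: "0 < e" for N n e
  proof -
    \<comment> \<open>Here \<open>n\<close> is fixed and \<open>m\<close> tends to infinity, which
      turns the Cauchy estimate between \<open>X n\<close> and \<open>X (m + N)\<close> into one
      between \<open>X n\<close> and the limit.\<close>
    let ?u = "\<lambda>m z. bfun (X n) z - bfun (X (m + N)) z"
    have u: "?u m \<in> bergman_space" for m by (simp add: diff_bergman_space)
    have bd: "(LINT z:unit_disk|lborel. (cmod (?u m z))\<^sup>2) \<le> pi * e\<^sup>2" for m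
    proof -
      have "norm (X n - X (m + N)) < e" using N[OF n, of "m + N"] by (simp add: dist_norm)
      then have "(norm (X n - X (m + N)))\<^sup>2 \<le> e\<^sup>2" by (intro power_mono) auto
      then show ?thesis by (simp add: norm_bergman_sq bfun_diff field_simps)
    qed
    have l: "(\<lambda>m. ?u m z) \<longlonglongrightarrow> bfun (X n) z - g z" for z
      by (intro tendsto_intros LIMSEQ_ignore_initial_segment lim)
    have h: "(\<lambda>z. bfun (X n) z - g z) holomorphic_on unit_disk"
      by (intro holomorphic_intros holg bergman_spaceD(1)[OF bfun])
    show ?thesis
      using bergman_space_limit[of ?u "pi * e\<^sup>2" "\<lambda>z. bfun (X n) z - g z", OF u bd l h] g0 bergman_spaceD(2)[OF bfun]
      by auto
  qed
  have gH: "g \<in> bergman_space"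
  proof -
    obtain N where N: "\<And>m n. N \<le> m \<Longrightarrow> N \<le> n \<Longrightarrow> dist (X m) (X n) < 1"
      using metric_CauchyD[OF \<open>Cauchy X\<close> zero_less_one] by blast
    have "(\<lambda>z. bfun (X N) z - g z) \<in> bergman_space"
      using main[OF N order_refl zero_less_one] by blast
    from diff_bergman_space[OF bfun[of "X N"] this] show ?thesis by simp
  qed
  have "X \<longlonglongrightarrow> Bfun g"
  proof (rule metric_LIMSEQ_I)
    fix e :: real assume e: "0 < e"
    then have "0 < e / 2" by simp
    from metric_CauchyD[OF \<open>Cauchy X\<close> this]
    obtain N where N: "\<And>m n. N \<le> m \<Longrightarrow> N \<le> n \<Longrightarrow> dist (X m) (X n) < e / 2" by blast
    have "dist (X n) (Bfun g) < e" if "N \<le> n" for n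
    proof -
      have "(norm (X n - Bfun g))\<^sup>2 \<le> (e / 2)\<^sup>2"
        using main[OF N that] e by (simp add: norm_bergman_sq bfun_diff Bfun_inverse[OF gH] field_simps)
      then have "norm (X n - Bfun g) \<le> e / 2" by (rule power2_le_imp_le) (use e in auto)
      then show ?thesis using e by (simp add: dist_norm)
    qed
    then show "\<exists>N. \<forall>n\<ge>N. dist (X n) (Bfun g) < e" by blast
  qed
  then show "convergent X" by (auto simp: convergent_def)
qed

section \<open>Commuting pairs of operators\<close>

text \<open>Common ground for an element of \<open>vn_algebra B\<close> with its adjoint and for the
  projection onto a reducing subspace, paired with itself. The assumption \<open>comm'\<close> on
  \<open>T'\<close> stands for commutation of \<open>T\<close> with the adjoint of multiplication by
  \<open>B\<close>.\<close>

locale commuting_pair =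
  fixes B :: "complex \<Rightarrow> complex" and T T' :: "(complex \<Rightarrow> complex) \<Rightarrow> (complex \<Rightarrow> complex)"
  assumes holB: "B holomorphic_on unit_disk"
    and B_disk: "\<And>z. z \<in> unit_disk \<Longrightarrow> B z \<in> unit_disk"
    and T_space: "\<And>f. f \<in> bergman_space \<Longrightarrow> T f \<in> bergman_space"
    and T'_space: "\<And>f. f \<in> bergman_space \<Longrightarrow> T' f \<in> bergman_space"
    and adj: "\<And>f g. f \<in> bergman_space \<Longrightarrow> g \<in> bergman_space \<Longrightarrow> bergman_inner (T f) g = bergman_inner f (T' g)"
    and comm: "\<And>f. f \<in> bergman_space \<Longrightarrow> T (\<lambda>z. B z * f z) = (\<lambda>z. B z * T f z)"
    and comm': "\<And>f. f \<in> bergman_space \<Longrightarrow> T' (\<lambda>z. B z * f z) = (\<lambda>z. B z * T' f z)"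
begin

lemma mult_B_space: "f \<in> bergman_space \<Longrightarrow> (\<lambda>z. B z * f z) \<in> bergman_space"
  by (rule bounded_mult_bergman_space[of B 1]) (use holB B_disk in \<open>auto intro: less_imp_le\<close>)

text \<open>The difference of the two integrands in \<open>adj\<close>. The aim is that it
  integrates to zero against every function of \<open>B\<close>, not only against 1.\<close>

definition kern :: "(complex \<Rightarrow> complex) \<Rightarrow> (complex \<Rightarrow> complex) \<Rightarrow> complex \<Rightarrow> complex" where
  "kern f g z = T f z * cnj (g z) - f z * cnj (T' g z)"

lemma set_integrable_kern:
  assumes "f \<in> bergman_space" "g \<in> bergman_space"
  shows "set_integrable lborel unit_disk (kern f g)"
  unfolding kern_def by (intro set_integral_diff set_integrable_bergman_mult assms T_space T'_space)

lemma measurable_kern: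
  assumes "f \<in> bergman_space" "g \<in> bergman_space"
  shows "kern f g \<in> borel_measurable borel"
proof -
  note [measurable] = bergman_spaceD(4)[OF assms(1)] bergman_spaceD(4)[OF assms(2)]
    bergman_spaceD(4)[OF T_space[OF assms(1)]] bergman_spaceD(4)[OF T'_space[OF assms(2)]]
  show ?thesis unfolding kern_def by measurable
qed

lemma set_integrable_mult_kern:
  assumes f: "f \<in> bergman_space" and g: "g \<in> bergman_space" and u: "continuous_on (cball 0 1) u"
  shows "set_integrable lborel unit_disk (\<lambda>z. u (B z) * kern f g z)"
proof -
  note [measurable] = measurable_kern[OF f g]
  have "B z \<in> cball 0 1" if "z \<in> unit_disk" for z using B_disk[OF that] by simp
  then have "continuous_on unit_disk (\<lambda>z. u (B z))"
    by (intro continuous_on_compose2[OF u holomorphic_on_imp_continuous_on[OF holB]]) auto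
  then have [measurable]: "(\<lambda>z. indicat_real unit_disk z *\<^sub>R u (B z)) \<in> borel_measurable borel"
    by (intro borel_measurable_continuous_on_indicator) auto
  obtain C where C: "\<forall>y\<in>u ` cball 0 1. cmod y \<le> C"
    using compact_imp_bounded[OF compact_continuous_image[OF u compact_cball]] unfolding bounded_iff by blast
  show ?thesis
  proof (rule set_integrable_bound)
    show "set_integrable lborel unit_disk (\<lambda>z. C * cmod (kern f g z))"
      using set_integrable_norm[OF set_integrable_kern[OF f g]] by simp
    have "(\<lambda>z. indicat_real unit_disk z *\<^sub>R (u (B z) * kern f g z)) = (\<lambda>z. (indicat_real unit_disk z *\<^sub>R u (B z)) * kern f g z)"
      by simp
    then show "set_borel_measurable lborel unit_disk (\<lambda>z. u (B z) * kern f g z)"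
      unfolding set_borel_measurable_def by (simp only:) measurable
    have "cmod (u (B z)) * cmod (kern f g z) \<le> \<bar>C\<bar> * cmod (kern f g z)" if "z \<in> unit_disk" for z
    proof -
      have "cmod (u (B z)) \<le> C" using C B_disk[OF that] by simp
      then show ?thesis by (intro mult_right_mono) auto
    qed
    then show "AE z in lborel. z \<in> unit_disk \<longrightarrow> norm (u (B z) * kern f g z) \<le> norm (C * cmod (kern f g z))"
      by (auto simp: norm_mult abs_mult)
  qed
qed

text \<open>
  Multiplication of \<open>u\<close> by the variable moves into \<open>f\<close>, multiplication by its conjugate into \<open>g\<close>.
\<close>

definition annihilated :: "(complex \<Rightarrow> complex) \<Rightarrow> bool" where
  "annihilated u \<longleftrightarrow> continuous_on (cball 0 1) u \<and>
     (\<forall>f\<in>bergman_space. \<forall>g\<in>bergman_space. (LINT z:unit_disk|lborel. u (B z) * kern f g z) = 0)"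

lemma annihilated_1: "annihilated (\<lambda>_. 1)"
proof -
  have "(LINT z:unit_disk|lborel. kern f g z) = 0" if f: "f \<in> bergman_space" and g: "g \<in> bergman_space" for f g
  proof -
    have "(LINT z:unit_disk|lborel. kern f g z) =
      (LINT z:unit_disk|lborel. T f z * cnj (g z)) - (LINT z:unit_disk|lborel. f z * cnj (T' g z))"
      unfolding kern_def by (intro set_integral_diff set_integrable_bergman_mult f g T_space T'_space)
    then show ?thesis
      using adj[OF f g] by (simp add: bergman_inner_eq f g T_space T'_space)
  qed
  then show ?thesis by (simp add: annihilated_def)
qed

lemma annihilated_add: "annihilated u \<Longrightarrow> annihilated v \<Longrightarrow> annihilated (\<lambda>x. u x + v x)"
  unfolding annihilated_def using set_integrable_mult_kern
  by (auto simp: distrib_right set_integral_add intro!: continuous_intros)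

lemma annihilated_cmult: "annihilated u \<Longrightarrow> annihilated (\<lambda>x. c * u x)"
  unfolding annihilated_def by (auto simp: mult.assoc intro!: continuous_intros)

lemma annihilated_mult_id: assumes "annihilated u" shows "annihilated (\<lambda>x. x * u x)"
  unfolding annihilated_def
proof (intro conjI ballI)
  show "continuous_on (cball 0 1) (\<lambda>x. x * u x)" using assms by (auto simp: annihilated_def intro!: continuous_intros)
  fix f g assume f: "f \<in> bergman_space" and g: "g \<in> bergman_space"
  have eq: "B z * u (B z) * kern f g z = u (B z) * kern (\<lambda>z. B z * f z) g z" for z
    unfolding kern_def comm[OF f] by (simp add: algebra_simps)
  show "(LINT z:unit_disk|lborel. B z * u (B z) * kern f g z) = 0"
    unfolding eq using assms mult_B_space[OF f] g by (simp add: annihilated_def)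
qed

lemma annihilated_mult_cnj: assumes "annihilated u" shows "annihilated (\<lambda>x. cnj x * u x)"
  unfolding annihilated_def
proof (intro conjI ballI)
  show "continuous_on (cball 0 1) (\<lambda>x. cnj x * u x)" using assms by (auto simp: annihilated_def intro!: continuous_intros)
  fix f g assume f: "f \<in> bergman_space" and g: "g \<in> bergman_space"
  have eq: "cnj (B z) * u (B z) * kern f g z = u (B z) * kern f (\<lambda>z. B z * g z) z" for z
    unfolding kern_def comm'[OF g] by (simp add: algebra_simps)
  show "(LINT z:unit_disk|lborel. cnj (B z) * u (B z) * kern f g z) = 0"
    unfolding eq using assms mult_B_space[OF g] f by (simp add: annihilated_def)
qed

text \<open>A real linear form on the plane is a combination of \<open>x\<close> and
  \<open>cnj x\<close>, the two multipliers already available. Leaving \<open>u\<close> arbitrary in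
  the induction lets a product of polynomials act one factor at a time.\<close>

lemma annihilated_mult_polynomial:
  assumes "real_polynomial_function p" "annihilated u"
  shows "annihilated (\<lambda>x. of_real (p x) * u x)"
  using assms
proof (induction arbitrary: u rule: real_polynomial_function.induct)
  case (linear f)
  interpret bounded_linear f by fact
  have "f x = Re x * f 1 + Im x * f \<i>" for x
  proof -
    have "x = Re x *\<^sub>R 1 + Im x *\<^sub>R \<i>" by (simp add: complex_eq_iff)
    then have "f x = f (Re x *\<^sub>R 1 + Im x *\<^sub>R \<i>)" by simp
    then show ?thesis by (simp only: add scale) simp
  qed
  then have fx: "complex_of_real (f x) = of_real (Re x) * of_real (f 1) + of_real (Im x) * of_real (f \<i>)" for x
    by (metis of_real_add of_real_mult)
  have R: "complex_of_real (Re x) = (x + cnj x) / 2" for x by (simp add: complex_eq_iff)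
  have I: "complex_of_real (Im x) = - \<i> * (x - cnj x) / 2" for x by (simp add: complex_eq_iff)
  have eq: "of_real (f x) * u x = ((of_real (f 1) - \<i> * of_real (f \<i>)) / 2) * (x * u x) +
      ((of_real (f 1) + \<i> * of_real (f \<i>)) / 2) * (cnj x * u x)" for x
    unfolding fx[of x] R I by (simp add: field_simps)
  show ?case unfolding eq
    by (intro annihilated_add annihilated_cmult annihilated_mult_id annihilated_mult_cnj linear.prems)
next
  case (const c)
  then show ?case by (rule annihilated_cmult)
next
  case (add f g)
  have eq: "of_real (f x + g x) * u x = of_real (f x) * u x + of_real (g x) * u x" for x by (simp add: algebra_simps)
  show ?case unfolding eq by (intro annihilated_add add)
next
  case (mult f g)
  have eq: "of_real (f x * g x) * u x = of_real (f x) * (of_real (g x) * u x)" for x by simp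
  show ?case unfolding eq by (intro mult)
qed

lemma integral_continuous_kern:
  assumes f: "f \<in> bergman_space" and g: "g \<in> bergman_space" and u: "continuous_on (cball 0 1) (u :: complex \<Rightarrow> real)"
  shows "(LINT z:unit_disk|lborel. of_real (u (B z)) * kern f g z) = 0"
proof -
  define N where "N = (LINT z:unit_disk|lborel. cmod (kern f g z))"
  have N0: "0 \<le> N" unfolding N_def set_lebesgue_integral_def by (intro integral_nonneg_AE) auto
  have bound: "cmod (LINT z:unit_disk|lborel. of_real (u (B z)) * kern f g z) \<le> e * N" if e: "0 < e" for e
  proof -
    obtain p where p: "real_polynomial_function p" "\<And>x. x \<in> cball 0 1 \<Longrightarrow> \<bar>u x - p x\<bar> < e"
      using Stone_Weierstrass_real_polynomial_function[OF compact_cball u e] by blast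
    have gp: "annihilated (\<lambda>x. of_real (p x))" using annihilated_mult_polynomial[OF p(1) annihilated_1] by simp
    have cu: "continuous_on (cball 0 1) (\<lambda>x. complex_of_real (u x))" by (intro continuous_intros u)
    have cp: "continuous_on (cball 0 1) (\<lambda>x. complex_of_real (p x))" using gp by (simp add: annihilated_def)
    have "(LINT z:unit_disk|lborel. of_real (u (B z)) * kern f g z) =
       (LINT z:unit_disk|lborel. of_real (u (B z)) * kern f g z) - (LINT z:unit_disk|lborel. of_real (p (B z)) * kern f g z)"
      using gp f g by (simp add: annihilated_def)
    also have "\<dots> = (LINT z:unit_disk|lborel. of_real (u (B z)) * kern f g z - of_real (p (B z)) * kern f g z)"
      by (intro set_integral_diff(2)[symmetric] set_integrable_mult_kern[OF f g cu] set_integrable_mult_kern[OF f g cp])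
    finally have eq: "(LINT z:unit_disk|lborel. of_real (u (B z)) * kern f g z) =
       (LINT z:unit_disk|lborel. of_real (u (B z)) * kern f g z - of_real (p (B z)) * kern f g z)" .
    have int: "set_integrable lborel unit_disk (\<lambda>z. of_real (u (B z)) * kern f g z - of_real (p (B z)) * kern f g z)"
      by (intro set_integral_diff(1) set_integrable_mult_kern[OF f g cu] set_integrable_mult_kern[OF f g cp])
    have "cmod (LINT z:unit_disk|lborel. of_real (u (B z)) * kern f g z) \<le>
       (LINT z:unit_disk|lborel. cmod (of_real (u (B z)) * kern f g z - of_real (p (B z)) * kern f g z))"
      unfolding eq using int by (rule set_integral_norm_bound)
    also have "\<dots> \<le> (LINT z:unit_disk|lborel. e * cmod (kern f g z))"
    proof (rule set_integral_mono)
      show "set_integrable lborel unit_disk (\<lambda>z. cmod (of_real (u (B z)) * kern f g z - of_real (p (B z)) * kern f g z))"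
        using int by (rule set_integrable_norm)
      show "set_integrable lborel unit_disk (\<lambda>z. e * cmod (kern f g z))"
        using set_integrable_norm[OF set_integrable_kern[OF f g]] by simp
      fix z assume "z \<in> unit_disk"
      then have "\<bar>u (B z) - p (B z)\<bar> \<le> e" using p(2)[of "B z"] B_disk[of z] by simp
      moreover have "of_real (u (B z)) * kern f g z - of_real (p (B z)) * kern f g z = of_real (u (B z) - p (B z)) * kern f g z"
        by (simp add: algebra_simps)
      ultimately show "cmod (of_real (u (B z)) * kern f g z - of_real (p (B z)) * kern f g z) \<le> e * cmod (kern f g z)"
        by (simp only: norm_mult norm_of_real) (intro mult_right_mono, auto)
    qed
    also have "\<dots> = e * N" by (simp add: N_def)
    finally show ?thesis .
  qed
  show ?thesis
  proof (rule ccontr)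
    assume "\<not> ?thesis"
    then have pos: "0 < cmod (LINT z:unit_disk|lborel. of_real (u (B z)) * kern f g z)" (is "0 < ?c") by simp
    have "?c \<le> ?c / (2 * (N + 1)) * N" using bound[of "?c / (2 * (N + 1))"] pos N0 by simp
    then have "?c * (2 * (N + 1)) \<le> ?c * N" using N0 by (simp add: field_simps)
    then have "2 * (N + 1) \<le> N" using pos mult_le_cancel_left_pos by blast
    then show False using N0 by simp
  qed
qed

lemma integral_ball_kern:
  assumes f: "f \<in> bergman_space" and g: "g \<in> bergman_space"
  shows "(LINT z:unit_disk|lborel. indicat_real (ball x e) (B z) *\<^sub>R kern f g z) = 0"
proof -
  \<comment> \<open>For positive \<open>n\<close>, a continuous function rising from 0 at the
    boundary of the ball to 1 at depth \<open>1 / n\<close>; these converge pointwise to the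
    indicator of the open ball, and dominated convergence applies.\<close>
  define u where "u n y = max 0 (min 1 (real n * (e - dist x y)))" for n :: nat and y :: complex
  have cu: "continuous_on (cball 0 1) (u n)" for n unfolding u_def by (intro continuous_intros)
  have cu': "continuous_on (cball 0 1) (\<lambda>y. complex_of_real (u n y))" for n by (intro continuous_intros cu)
  have ulim: "(\<lambda>n. u n y) \<longlonglongrightarrow> indicat_real (ball x e) y" for y
  proof (cases "y \<in> ball x e")
    case True
    then have pos: "0 < e - dist x y" by simp
    obtain m where m: "1 < real m * (e - dist x y)" using reals_Archimedean3[OF pos] by auto
    have "u n y = 1" if "m \<le> n" for n
    proof -
      have "real m * (e - dist x y) \<le> real n * (e - dist x y)" using that pos by (intro mult_right_mono) auto
      then show ?thesis using m by (simp add: u_def)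
    qed
    then have "\<forall>\<^sub>F n in sequentially. u n y = 1" by (auto simp: eventually_sequentially)
    then show ?thesis using True by (simp add: tendsto_eventually)
  next
    case False
    then have "real n * (e - dist x y) \<le> 0" for n by (simp add: mult_le_0_iff)
    then have "u n y = 0" for n by (simp add: u_def max_absorb1 min.coboundedI2)
    then show ?thesis using False by simp
  qed
  have u1: "\<bar>u n y\<bar> \<le> 1" for n y by (simp add: u_def)
  note [measurable] = measurable_kern[OF f g]
  have meas: "(\<lambda>z. indicat_real unit_disk z *\<^sub>R (of_real (u n (B z)) * kern f g z)) \<in> borel_measurable lborel" for n
    using set_integrable_mult_kern[OF f g cu'[of n]] unfolding set_integrable_def by (rule borel_measurable_integrable)
  have lim: "(\<lambda>n. indicat_real unit_disk z *\<^sub>R (of_real (u n (B z)) * kern f g z)) \<longlonglongrightarrow>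
      indicat_real unit_disk z *\<^sub>R (indicat_real (ball x e) (B z) *\<^sub>R kern f g z)" for z
    unfolding scaleR_conv_of_real[of "indicat_real (ball x e) (B z)"] by (intro tendsto_intros ulim)
  have "(\<lambda>n. LINT z|lborel. indicat_real unit_disk z *\<^sub>R (of_real (u n (B z)) * kern f g z)) \<longlonglongrightarrow>
     (LINT z|lborel. indicat_real unit_disk z *\<^sub>R (indicat_real (ball x e) (B z) *\<^sub>R kern f g z))"
  proof (rule integral_dominated_convergence[where w = "\<lambda>z. indicat_real unit_disk z *\<^sub>R cmod (kern f g z)"])
    show "(\<lambda>z. indicat_real unit_disk z *\<^sub>R (indicat_real (ball x e) (B z) *\<^sub>R kern f g z)) \<in> borel_measurable lborel"
      by (rule borel_measurable_LIMSEQ_metric[OF meas lim])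
    show "integrable lborel (\<lambda>z. indicat_real unit_disk z *\<^sub>R cmod (kern f g z))"
      using set_integrable_norm[OF set_integrable_kern[OF f g]] unfolding set_integrable_def .
    have "cmod (of_real (u n (B z)) * kern f g z) \<le> 1 * cmod (kern f g z)" for n z
      unfolding norm_mult norm_of_real using u1 by (intro mult_right_mono) auto
    then show "AE z in lborel. norm (indicat_real unit_disk z *\<^sub>R (of_real (u n (B z)) * kern f g z)) \<le> indicat_real unit_disk z *\<^sub>R cmod (kern f g z)" for n
      by (intro AE_I2) (auto simp: indicator_def)
  qed (use meas lim in auto)
  moreover have "(LINT z|lborel. indicat_real unit_disk z *\<^sub>R (of_real (u n (B z)) * kern f g z)) = 0" for n
    using integral_continuous_kern[OF f g cu[of n]] unfolding set_lebesgue_integral_def .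
  ultimately have "(\<lambda>n. 0) \<longlonglongrightarrow> (LINT z:unit_disk|lborel. indicat_real (ball x e) (B z) *\<^sub>R kern f g z)"
    unfolding set_lebesgue_integral_def by (simp only:)
  then show ?thesis by (simp only: LIMSEQ_const_iff)
qed

end

section \<open>Evenly covered disks\<close>

lemma local_section_deriv:
  assumes "local_section B D s" "open D" "x \<in> D" "B holomorphic_on unit_disk"
  shows "deriv B (s x) * deriv s x = 1"
proof -
  have s: "s holomorphic_on D" "s ` D \<subseteq> unit_disk" "\<And>y. y \<in> D \<Longrightarrow> B (s y) = y"
    using assms(1) by (auto simp: local_section_def)
  have "s x \<in> unit_disk" using s(2) assms(3) by blast
  then have "((\<lambda>y. B (s y)) has_field_derivative deriv B (s x) * deriv s x) (at x)"
    by (intro DERIV_chain2 holomorphic_derivI[OF assms(4) open_ball] holomorphic_derivI[OF s(1) assms(2,3)])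
  moreover have "((\<lambda>y. B (s y)) has_field_derivative 1) (at x)"
    by (rule has_field_derivative_transform_within_open[OF DERIV_ident assms(2,3)]) (use s(3) in auto)
  ultimately show ?thesis by (rule DERIV_unique)
qed

text \<open>The chain rule makes \<open>deriv B\<close> nonzero along a section, so \<open>B\<close>
  is injective near the common value and the sections agree in a neighbourhood; the identity theorem
  extends this to the connected set \<open>D\<close>.\<close>

lemma local_section_unique:
  assumes s: "local_section B D s" and u: "local_section B D u" and D: "open D" "connected D"
    and x: "x \<in> D" "s x = u x" and hol: "B holomorphic_on unit_disk" and y: "y \<in> D"
  shows "s y = u y"
proof -
  have sD: "s holomorphic_on D" "s ` D \<subseteq> unit_disk" "\<And>y. y \<in> D \<Longrightarrow> B (s y) = y"
    and uD: "u holomorphic_on D" "\<And>y. y \<in> D \<Longrightarrow> B (u y) = y"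
    using s u by (auto simp: local_section_def)
  have sx: "s x \<in> unit_disk" using sD(2) x by blast
  have "deriv B (s x) \<noteq> 0" using local_section_deriv[OF s D(1) x(1) hol] by auto
  then obtain r where r: "0 < r" "ball (s x) r \<subseteq> unit_disk" "inj_on B (ball (s x) r)"
    using has_complex_derivative_locally_injective[OF hol sx open_ball] by metis
  define V where "V = (D \<inter> s -` ball (s x) r) \<inter> (D \<inter> u -` ball (s x) r)"
  have "open V" unfolding V_def
    by (intro open_Int continuous_open_preimage holomorphic_on_imp_continuous_on sD(1) uD(1) D open_ball)
  moreover have "x \<in> V" using x r(1) by (auto simp: V_def)
  moreover have "s z = u z" if "z \<in> V" for z
    by (rule inj_onD[OF r(3)]) (use that sD(3) uD(2) in \<open>auto simp: V_def\<close>)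
  moreover have "V \<subseteq> D" by (auto simp: V_def)
  ultimately show ?thesis
    using analytic_continuation_open[OF _ D(1) _ D(2) _ sD(1) uD(1) _ y, of V] by blast
qed

lemma fsigma_unit_disk: "fsigma unit_disk"
proof -
  have "unit_disk = (\<Union>n. cball 0 (1 - inverse (real (Suc n))))"
  proof (intro equalityI subsetI)
    fix z :: complex assume "z \<in> unit_disk"
    then obtain n where "inverse (real (Suc n)) < 1 - cmod z" using reals_Archimedean[of "1 - cmod z"] by auto
    then show "z \<in> (\<Union>n. cball 0 (1 - inverse (real (Suc n))))" by (intro UN_I[of n]) auto
  next
    fix z :: complex assume "z \<in> (\<Union>n. cball 0 (1 - inverse (real (Suc n))))"
    then obtain n where "cmod z \<le> 1 - inverse (real (Suc n))" by auto
    moreover have "0 < inverse (real (Suc n))" by simp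
    ultimately have "cmod z < 1" by linarith
    then show "z \<in> unit_disk" by simp
  qed
  then show ?thesis using fsigma.intros[of "\<lambda>n. cball 0 (1 - inverse (real (Suc n)))"] by simp
qed

lemma countable_zeros_unit_disk:
  assumes "f holomorphic_on unit_disk" "\<not> f constant_on unit_disk"
  shows "countable {z \<in> unit_disk. f z = 0}"
  by (rule holomorphic_countable_zeros[OF assms(1) open_ball connected_ball fsigma_unit_disk assms(2)])

locale covered_disk =
  fixes B :: "complex \<Rightarrow> complex" and l :: complex and \<rho> :: real
  assumes hol: "B holomorphic_on unit_disk" and nonconst: "\<not> B constant_on unit_disk"
    and rho: "0 < \<rho>" and covered: "evenly_covered B (ball l \<rho>)"
begin

abbreviation "D \<equiv> ball l \<rho>"

definition fibre :: "complex set" where "fibre = {w \<in> unit_disk. B w = l}"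

text \<open>Sheets are labelled by their points over the centre \<open>l\<close>, so the fibre
  itself is the index set. The choice is harmless: on \<open>D\<close> the section is determined by
  its value at \<open>l\<close>.\<close>

definition sec :: "complex \<Rightarrow> complex \<Rightarrow> complex" where
  "sec w = (SOME s. local_section B D s \<and> s l = w)"

lemma sec: assumes "w \<in> fibre" shows "local_section B D (sec w)" "sec w l = w"
proof -
  have "\<exists>s. local_section B D s \<and> s l = w"
    using covered assms rho unfolding evenly_covered_def fibre_def by fastforce
  then have "local_section B D (sec w) \<and> sec w l = w" unfolding sec_def by (rule someI_ex)
  then show "local_section B D (sec w)" "sec w l = w" by auto
qed

lemma sec_simps:
  assumes "w \<in> fibre"
  shows "sec w holomorphic_on D" "\<And>x. x \<in> D \<Longrightarrow> sec w x \<in> unit_disk" "\<And>x. x \<in> D \<Longrightarrow> B (sec w x) = x"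
  using sec(1)[OF assms] by (auto simp: local_section_def image_subset_iff)

lemma inj_on_sec: "w \<in> fibre \<Longrightarrow> X \<subseteq> D \<Longrightarrow> inj_on (sec w) X"
  by (rule inj_on_inverseI[where g = B]) (auto simp: sec_simps(3))

text \<open>Applying \<open>B\<close> recovers the base point from either side; uniqueness of
  sections then identifies the labels. This is the disjointness of the sheets.\<close>

lemma sec_eqD:
  assumes "w \<in> fibre" "v \<in> fibre" "x \<in> D" "y \<in> D" "sec w x = sec v y"
  shows "w = v" "x = y"
proof -
  show "x = y" using assms sec_simps(3) by metis
  with assms show "w = v"
    using local_section_unique[OF sec(1)[OF assms(1)] sec(1)[OF assms(2)] open_ball connected_ball assms(3) _ hol, of l]
      sec(2) rho by simp
qed

lemma sec_deriv: "w \<in> fibre \<Longrightarrow> x \<in> D \<Longrightarrow> deriv B (sec w x) * deriv (sec w) x = 1"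
  using local_section_deriv[OF sec(1) open_ball _ hol] by blast

lemma sec_ex:
  assumes z: "z \<in> unit_disk" "B z \<in> D"
  obtains w where "w \<in> fibre" "sec w (B z) = z"
proof -
  obtain s where s: "local_section B D s" "s (B z) = z"
    using covered z unfolding evenly_covered_def by blast
  have lD: "l \<in> D" using rho by simp
  have w: "s l \<in> fibre" using s(1) lD by (auto simp: local_section_def fibre_def image_subset_iff)
  have "sec (s l) (B z) = s (B z)"
    by (rule local_section_unique[OF sec(1)[OF w] s(1) open_ball connected_ball lD sec(2)[OF w] hol z(2)])
  then show ?thesis using that[OF w] s(2) by simp
qed

lemma countable_fibre: "countable fibre"
proof -
  have "(\<lambda>z. B z - l) holomorphic_on unit_disk" by (intro holomorphic_intros hol)
  moreover have "\<not> (\<lambda>z. B z - l) constant_on unit_disk"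
    using nonconst unfolding constant_on_def by (metis diff_add_cancel)
  ultimately have "countable {z \<in> unit_disk. B z - l = 0}"
    by (rule countable_zeros_unit_disk)
  then show ?thesis by (simp add: fibre_def)
qed

end

section \<open>Tools for fibre sums: averages, the identity theorem, series of holomorphic
  functions\<close>

lemma continuous_averages_zero:
  fixes S :: "complex \<Rightarrow> complex"
  assumes cont: "continuous_on U S" and U: "open U" "x \<in> U"
    and zero: "\<And>e. 0 < e \<Longrightarrow> ball x e \<subseteq> U \<Longrightarrow> (LINT y:ball x e|lborel. S y) = 0"
  shows "S x = 0"
proof (rule ccontr)
  assume nz: "S x \<noteq> 0"
  define \<epsilon> where "\<epsilon> = cmod (S x) / 2"
  have eps: "0 < \<epsilon>" using nz by (simp add: \<epsilon>_def)
  obtain d where d: "0 < d" "\<And>y. y \<in> U \<Longrightarrow> dist y x < d \<Longrightarrow> dist (S y) (S x) < \<epsilon>"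
    using cont U(2) eps unfolding continuous_on_iff by metis
  obtain r where r: "0 < r" "cball x r \<subseteq> U" using U open_contains_cball by blast
  define e where "e = min (d/2) r"
  have e: "0 < e" "e < d" "cball x e \<subseteq> U" using d r by (auto simp: e_def)
  have eU: "ball x e \<subseteq> U" using e(3) ball_subset_cball by blast
  define m where "m = measure lborel (ball x e)"
  have m: "0 < m" using e by (simp add: m_def measure_ball_complex)
  have intS: "set_integrable lborel (ball x e) S"
    by (rule set_integrable_ball_continuous[OF continuous_on_subset[OF cont e(3)]])
  have intc: "set_integrable lborel (ball x e) (\<lambda>y. c)" for c :: "'a::{banach,second_countable_topology}"
    by (rule set_integrable_ball_continuous) simp
  have constc: "(LINT y:ball x e|lborel. c) = m *\<^sub>R c" for c :: "'a::{banach,second_countable_topology}"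
    unfolding set_lebesgue_integral_def m_def
    by (subst integral_scaleR_left) (use emeasure_bounded_finite[OF bounded_ball, of x e] in auto)
  have "(LINT y:ball x e|lborel. S y - S x) = (LINT y:ball x e|lborel. S y) - (LINT y:ball x e|lborel. S x)"
    by (intro set_integral_diff intS intc)
  also have "\<dots> = - (m *\<^sub>R S x)" using zero[OF e(1) eU] constc by simp
  finally have "m * cmod (S x) = cmod (LINT y:ball x e|lborel. S y - S x)" using m by simp
  also have "\<dots> \<le> (LINT y:ball x e|lborel. cmod (S y - S x))"
    by (intro set_integral_norm_bound set_integral_diff intS intc)
  also have "\<dots> \<le> (LINT y:ball x e|lborel. \<epsilon>)"
  proof (rule set_integral_mono)
    show "set_integrable lborel (ball x e) (\<lambda>y. cmod (S y - S x))"
      by (intro set_integrable_norm set_integral_diff intS intc)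
    show "cmod (S y - S x) \<le> \<epsilon>" if "y \<in> ball x e" for y
      using d(2)[of y] that eU e(2) by (fastforce simp: dist_norm norm_minus_commute)
  qed (rule intc)
  also have "\<dots> = m * (cmod (S x) / 2)" using constc[of \<epsilon>] by (simp add: \<epsilon>_def)
  finally show False using m nz by simp
qed

lemma vanishes_on_ball_if_real:
  assumes hol: "f holomorphic_on ball 0 R" and zero: "\<And>t::real. \<bar>t\<bar> < R \<Longrightarrow> f (of_real t) = 0" and w: "w \<in> ball 0 R"
  shows "f w = 0"
proof (rule analytic_continuation[OF hol open_ball connected_ball, of "of_real ` {-R<..<R}" 0])
  have R: "0 < R" using w by (auto simp: le_less_trans[OF norm_ge_zero])
  show "complex_of_real ` {- R<..<R} \<subseteq> ball 0 R" "0 \<in> ball (0::complex) R" using R by auto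
  show "0 islimpt complex_of_real ` {- R<..<R}"
    unfolding islimpt_approachable
  proof (intro allI impI)
    fix e :: real assume "0 < e"
    define q where "q = min e R / 2"
    have "0 < q" "q < e" "q < R" using \<open>0 < e\<close> R by (auto simp: q_def)
    then show "\<exists>x'\<in>complex_of_real ` {- R<..<R}. x' \<noteq> 0 \<and> dist x' 0 < e"
      by (intro bexI[of _ "of_real q"] imageI) auto
  qed
qed (use zero w in auto)

lemma infsum_holomorphic:
  fixes t :: "'i \<Rightarrow> complex \<Rightarrow> complex"
  assumes hol: "\<And>i. i \<in> I \<Longrightarrow> t i holomorphic_on ball c R"
    and bd: "\<And>i x. i \<in> I \<Longrightarrow> x \<in> ball c R \<Longrightarrow> cmod (t i x) \<le> M i" and M: "M summable_on I"
  shows "(\<lambda>x. \<Sum>\<^sub>\<infinity>i\<in>I. t i x) holomorphic_on ball c R"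
proof -
  have ul: "uniform_limit (ball c R) (\<lambda>J x. \<Sum>i\<in>J. t i x) (\<lambda>x. \<Sum>\<^sub>\<infinity>i\<in>I. t i x) (finite_subsets_at_top I)"
    by (rule Weierstrass_m_test_general[OF bd M])
  have "\<exists>d>0. (\<lambda>x. \<Sum>\<^sub>\<infinity>i\<in>I. t i x) holomorphic_on ball z d" if z: "z \<in> ball c R" for z
  proof -
    obtain d where d: "0 < d" "cball z d \<subseteq> ball c R" using z open_contains_cball[of "ball c R"] by blast
    have ev: "\<forall>\<^sub>F J in finite_subsets_at_top I. continuous_on (cball z d) (\<lambda>x. \<Sum>i\<in>J. t i x) \<and> (\<lambda>x. \<Sum>i\<in>J. t i x) holomorphic_on ball z d"
    proof (rule eventually_finite_subsets_at_top_weakI)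
      fix J assume "finite J" "J \<subseteq> I"
      then have "(\<lambda>x. \<Sum>i\<in>J. t i x) holomorphic_on cball z d"
        using d(2) by (intro holomorphic_on_sum holomorphic_on_subset[OF hol]) auto
      then show "continuous_on (cball z d) (\<lambda>x. \<Sum>i\<in>J. t i x) \<and> (\<lambda>x. \<Sum>i\<in>J. t i x) holomorphic_on ball z d"
        using holomorphic_on_imp_continuous_on holomorphic_on_subset[OF _ ball_subset_cball] by blast
    qed
    show ?thesis
      using holomorphic_uniform_limit[OF ev uniform_limit_on_subset[OF ul d(2)]] d(1) by auto
  qed
  then show ?thesis
    using holomorphic_on_open[OF open_ball] holomorphic_on_imp_differentiable_at[OF _ open_ball]
    by (metis centre_in_ball field_differentiable_def)
qed

section \<open>Operators on the branches over an evenly covered disk\<close>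

lemma const_disk_bergman_space: "(\<lambda>z. if z \<in> unit_disk then 1 else 0) \<in> bergman_space"
  unfolding bergman_space_iff
proof (intro conjI)
  show "(\<lambda>z. if z \<in> unit_disk then 1 else 0 :: complex) holomorphic_on unit_disk"
    by (rule holomorphic_transform[of "\<lambda>_. 1"]) auto
  have "set_integrable lborel unit_disk (\<lambda>z::complex. 1 :: real)"
    by (rule set_integrable_ball_continuous) simp
  then show "set_integrable lborel unit_disk (\<lambda>z. (cmod (if z \<in> unit_disk then 1 else 0))\<^sup>2)"
    by (rule set_integrable_cong[THEN iffD1, rotated -1]) auto
qed auto

text \<open>
  Among the points of the fibre of \<open>B w\<close>, this function is nonzero only at \<open>w\<close>, where
  it equals \<open>deriv B w\<close>.
\<close>

definition quotient_fun :: "(complex \<Rightarrow> complex) \<Rightarrow> complex \<Rightarrow> complex \<Rightarrow> complex" where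
  "quotient_fun B w z =
     (if z \<in> unit_disk then if z = w then deriv B w else (B z - B w) / (z - w) else 0)"

text \<open>The singularity at \<open>w\<close> is removable. The function is bounded near
  \<open>w\<close> by compactness and elsewhere by \<open>2 / e\<close>, since \<open>B\<close> maps
  into the unit disk, and bounded holomorphic functions are square integrable here.\<close>

lemma quotient_fun_bergman_space:
  assumes hol: "B holomorphic_on unit_disk" and B: "\<And>z. z \<in> unit_disk \<Longrightarrow> B z \<in> unit_disk" and w: "w \<in> unit_disk"
  shows "quotient_fun B w \<in> bergman_space"
proof -
  have dB: "deriv (\<lambda>z. B z - B w) w = deriv B w"
    using DERIV_diff[OF holomorphic_derivI[OF hol open_ball w] DERIV_const[of "B w"]] by (auto intro: DERIV_imp_deriv)
  have holq: "quotient_fun B w holomorphic_on unit_disk"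
    by (rule pole_theorem_open_0[of "\<lambda>z. B z - B w" _ w])
       (use w hol dB in \<open>auto simp: quotient_fun_def intro!: holomorphic_intros\<close>)
  obtain e where e: "0 < e" "cball w e \<subseteq> unit_disk" using w open_contains_cball[of unit_disk] by blast
  have "compact (quotient_fun B w ` cball w e)"
    by (intro compact_continuous_image holomorphic_on_imp_continuous_on holomorphic_on_subset[OF holq e(2)]) auto
  then obtain C where C: "\<forall>y\<in>quotient_fun B w ` cball w e. cmod y \<le> C"
    using compact_imp_bounded bounded_iff by metis
  have bd: "cmod (quotient_fun B w z) \<le> max C (2 / e)" if z: "z \<in> unit_disk" for z
  proof (cases "z \<in> cball w e")
    case True
    then show ?thesis using C by (auto simp: le_max_iff_disj)
  next
    case False
    have "cmod (B z - B w) \<le> cmod (B z) + cmod (B w)" by (rule norm_triangle_ineq4)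
    also have "\<dots> \<le> 2" using B[OF z] B[OF w] by simp
    finally have "cmod (B z - B w) / cmod (z - w) \<le> 2 / e"
      using False e by (intro frac_le) (auto simp: dist_norm norm_minus_commute)
    then show ?thesis using False z e by (auto simp: quotient_fun_def norm_divide le_max_iff_disj)
  qed
  have "(\<lambda>z. quotient_fun B w z * (if z \<in> unit_disk then 1 else 0)) = quotient_fun B w"
    by (auto simp: quotient_fun_def)
  then show ?thesis using bounded_mult_bergman_space[OF holq bd const_disk_bergman_space] by simp
qed

lemma holomorphic_cnj_cnj:
  assumes "h holomorphic_on ball 0 R" shows "(\<lambda>b. cnj (h (cnj b))) holomorphic_on ball 0 R"
proof -
  have "cnj ` ball 0 R = ball 0 R"
  proof (intro equalityI subsetI)
    fix z assume "z \<in> ball (0::complex) R"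
    then show "z \<in> cnj ` ball 0 R" by (intro image_eqI[of _ _ "cnj z"]) auto
  qed auto
  then show ?thesis using holomorphic_on_compose_cnj_cnj[of h "ball 0 R"] assms by (simp add: o_def)
qed

context commuting_pair
begin

text \<open>The matrix entry of \<open>T\<close> in the coordinates \<open>f / deriv B\<close>: the
  image of the function that is a unit vector at \<open>w\<close>, read off at \<open>z\<close>. No
  disk or section enters, so one function on pairs of points can be studied across overlapping
  disks.\<close>

definition coef :: "complex \<Rightarrow> complex \<Rightarrow> complex" where
  "coef z w = T (quotient_fun B w) z / deriv B z"

lemma quotient_space: "w \<in> unit_disk \<Longrightarrow> quotient_fun B w \<in> bergman_space"
  by (rule quotient_fun_bergman_space[OF holB B_disk])

end

locale covered_pair = commuting_pair B T T' + covered_disk B l \<rho> for B T T' l \<rho>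
begin

text \<open>The coefficient of the pullback of the form \<open>f dz\<close> along a section. The
  area Jacobian is the derivative times its conjugate, so it splits evenly between the two factors
  of an inner product and keeps one holomorphic and the other antiholomorphic.\<close>

definition branch :: "(complex \<Rightarrow> complex) \<Rightarrow> complex \<Rightarrow> complex \<Rightarrow> complex" where
  "branch f w x = f (sec w x) * deriv (sec w) x"

definition mass :: "(complex \<Rightarrow> complex) \<Rightarrow> complex \<Rightarrow> real" where
  "mass f w = (LINT z:sec w ` D|lborel. (cmod (f z))\<^sup>2)"

text \<open>The constant is \<open>4 / (pi * (\<rho>/2)\<^sup>2)\<close>, from the mean value
  inequality on disks of radius \<rho>/2 around points of the half-size disk.\<close>

definition branch_majorant :: "(complex \<Rightarrow> complex) \<Rightarrow> complex \<Rightarrow> real" where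
  "branch_majorant f w = 16 / (pi * \<rho>\<^sup>2) * mass f w"

lemma half_ball: "ball l (\<rho>/2) \<subseteq> D" "x \<in> ball l (\<rho>/2) \<Longrightarrow> ball x (\<rho>/2) \<subseteq> D"
proof -
  show "ball l (\<rho>/2) \<subseteq> D" using rho by auto
  assume x: "x \<in> ball l (\<rho>/2)"
  show "ball x (\<rho>/2) \<subseteq> D"
  proof
    fix y assume "y \<in> ball x (\<rho>/2)"
    then show "y \<in> D" using x dist_triangle[of l y x] by simp
  qed
qed

lemma branch_holomorphic: "f \<in> bergman_space \<Longrightarrow> w \<in> fibre \<Longrightarrow> branch f w holomorphic_on D"
  unfolding branch_def
  using holomorphic_on_compose_gen[OF sec_simps(1) bergman_spaceD(1), of w f] sec_simps(2)[of w]
  by (intro holomorphic_intros holomorphic_deriv sec_simps(1)) (auto simp: o_def image_subset_iff)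

lemma sec_open_image: "w \<in> fibre \<Longrightarrow> open X \<Longrightarrow> X \<subseteq> D \<Longrightarrow> open (sec w ` X)"
  by (rule open_mapping_thm3[OF holomorphic_on_subset[OF sec_simps(1)] _ inj_on_sec])

lemma sec_image_disk: "w \<in> fibre \<Longrightarrow> X \<subseteq> D \<Longrightarrow> sec w ` X \<subseteq> unit_disk"
  using sec_simps(2) by auto

lemma set_integral_sec:
  fixes h :: "complex \<Rightarrow> 'a::{banach,second_countable_topology}"
  assumes "w \<in> fibre" "open X" "X \<subseteq> D" "h \<in> borel_measurable borel"
  shows "set_integrable lborel (sec w ` X) h \<longleftrightarrow> set_integrable lborel X (\<lambda>z. (cmod (deriv (sec w) z))\<^sup>2 *\<^sub>R h (sec w z))"
    and "(LINT z:sec w ` X|lborel. h z) = (LINT z:X|lborel. (cmod (deriv (sec w) z))\<^sup>2 *\<^sub>R h (sec w z))"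
  using set_integral_holomorphic_image[OF holomorphic_on_subset[OF sec_simps(1)[OF assms(1)] assms(3)] assms(2)
      inj_on_sec[OF assms(1,3)] bounded_subset[OF bounded_ball sec_image_disk[OF assms(1,3)]] assms(4)]
  by auto

lemma branch_norm_sq: "(cmod (deriv (sec w) x))\<^sup>2 *\<^sub>R (cmod (f (sec w x)))\<^sup>2 = (cmod (branch f w x))\<^sup>2"
  by (simp add: branch_def norm_mult power_mult_distrib mult.commute)

lemma
  assumes f: "f \<in> bergman_space" and w: "w \<in> fibre"
  shows branch_integrable: "set_integrable lborel D (\<lambda>x. (cmod (branch f w x))\<^sup>2)"
    and mass_eq: "mass f w = (LINT x:D|lborel. (cmod (branch f w x))\<^sup>2)"
    and mass_integrable: "set_integrable lborel (sec w ` D) (\<lambda>z. (cmod (f z))\<^sup>2)"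
proof -
  note [measurable] = bergman_spaceD(4)[OF f]
  have m: "(\<lambda>z. (cmod (f z))\<^sup>2) \<in> borel_measurable borel" by measurable
  show i: "set_integrable lborel (sec w ` D) (\<lambda>z. (cmod (f z))\<^sup>2)"
    by (rule set_integrable_subset[OF bergman_spaceD(3)[OF f]])
       (use sec_open_image[OF w open_ball order_refl] sec_image_disk[OF w order_refl] in auto)
  then show "set_integrable lborel D (\<lambda>x. (cmod (branch f w x))\<^sup>2)"
    using set_integral_sec(1)[OF w open_ball order_refl m] by (simp only: branch_norm_sq)
  show "mass f w = (LINT x:D|lborel. (cmod (branch f w x))\<^sup>2)"
    unfolding mass_def using set_integral_sec(2)[OF w open_ball order_refl m] by (simp only: branch_norm_sq)
qed

lemma branch_bound:
  assumes f: "f \<in> bergman_space" and w: "w \<in> fibre" and x: "x \<in> ball l (\<rho>/2)"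
  shows "(cmod (branch f w x))\<^sup>2 \<le> branch_majorant f w"
proof -
  have int: "set_integrable lborel (ball x (\<rho>/2)) (\<lambda>y. (cmod (branch f w y))\<^sup>2)"
    by (rule set_integrable_subset[OF branch_integrable[OF f w] _ half_ball(2)[OF x]]) simp
  have "(cmod (branch f w x))\<^sup>2 \<le> 4 / (pi * (\<rho>/2)\<^sup>2) * (LINT y:ball x (\<rho>/2)|lborel. (cmod (branch f w y))\<^sup>2)"
    by (rule holomorphic_norm_sq_le_integral[OF holomorphic_on_subset[OF branch_holomorphic[OF f w] half_ball(2)[OF x]] _ int])
       (use rho in simp)
  also have "\<dots> \<le> 4 / (pi * (\<rho>/2)\<^sup>2) * mass f w"
  proof (rule mult_left_mono)
    show "(LINT y:ball x (\<rho>/2)|lborel. (cmod (branch f w y))\<^sup>2) \<le> mass f w"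
      unfolding mass_eq[OF f w] set_lebesgue_integral_def
      by (intro integral_mono int[unfolded set_integrable_def] branch_integrable[OF f w, unfolded set_integrable_def])
         (use half_ball(2)[OF x] in \<open>auto simp: indicator_def\<close>)
  qed simp
  finally show ?thesis by (simp add: branch_majorant_def power_divide field_simps)
qed

lemma mass_nonneg: "0 \<le> mass f w"
  unfolding mass_def set_lebesgue_integral_def by (intro integral_nonneg_AE) auto

lemma branch_majorant_nonneg: "0 \<le> branch_majorant f w"
  unfolding branch_majorant_def using mass_nonneg by (intro mult_nonneg_nonneg) auto

lemma sum_indicator_sec:
  assumes J: "finite J" "J \<subseteq> fibre" and X: "X \<subseteq> D"
  shows "(\<Sum>w\<in>J. indicat_real (sec w ` X) z) = indicat_real (\<Union>w\<in>J. sec w ` X) z"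
proof (rule indicator_UN_disjoint[symmetric, OF J(1)])
  show "disjoint_family_on (\<lambda>w. sec w ` X) J"
    unfolding disjoint_family_on_def
  proof (intro ballI impI equals0I)
    fix w v z assume wv: "w \<in> J" "v \<in> J" "w \<noteq> v" "z \<in> sec w ` X \<inter> sec v ` X"
    then obtain x y where "x \<in> X" "y \<in> X" "sec w x = sec v y" by auto
    then show False using sec_eqD(1)[of w v x y] wv J X by blast
  qed
qed

text \<open>The sheets are disjoint subsets of the disk, so finitely many masses never add up to
  more than the integral over the whole disk.\<close>

lemma branch_majorant_summable:
  assumes f: "f \<in> bergman_space" shows "branch_majorant f summable_on fibre"
proof -
  have "mass f summable_on fibre"
  proof (rule nonneg_bdd_above_summable_on)
    show "bdd_above (sum (mass f) ` {J. J \<subseteq> fibre \<and> finite J})"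
    proof (rule bdd_aboveI2)
      fix J assume "J \<in> {J. J \<subseteq> fibre \<and> finite J}"
      then have J: "finite J" "J \<subseteq> fibre" by auto
      have int: "integrable lborel (\<lambda>z. indicat_real (sec w ` D) z *\<^sub>R (cmod (f z))\<^sup>2)" if "w \<in> J" for w
        using mass_integrable[OF f, of w] J that unfolding set_integrable_def by auto
      have "sum (mass f) J = (LINT z|lborel. (\<Sum>w\<in>J. indicat_real (sec w ` D) z *\<^sub>R (cmod (f z))\<^sup>2))"
        unfolding mass_def set_lebesgue_integral_def by (rule Bochner_Integration.integral_sum[symmetric]) (rule int)
      also have "\<dots> \<le> (LINT z|lborel. indicat_real unit_disk z *\<^sub>R (cmod (f z))\<^sup>2)"
      proof (rule integral_mono)
        show "integrable lborel (\<lambda>z. \<Sum>w\<in>J. indicat_real (sec w ` D) z *\<^sub>R (cmod (f z))\<^sup>2)"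
          by (intro Bochner_Integration.integrable_sum int)
        show "integrable lborel (\<lambda>z. indicat_real unit_disk z *\<^sub>R (cmod (f z))\<^sup>2)"
          using bergman_spaceD(3)[OF f] unfolding set_integrable_def .
        fix z
        have "(\<Sum>w\<in>J. indicat_real (sec w ` D) z *\<^sub>R (cmod (f z))\<^sup>2) = indicat_real (\<Union>w\<in>J. sec w ` D) z *\<^sub>R (cmod (f z))\<^sup>2"
          unfolding scaleR_sum_left[symmetric] sum_indicator_sec[OF J order_refl] ..
        also have "\<dots> \<le> indicat_real unit_disk z *\<^sub>R (cmod (f z))\<^sup>2"
          using sec_image_disk[OF _ order_refl] J(2) by (fastforce simp: indicator_def)
        finally show "(\<Sum>w\<in>J. indicat_real (sec w ` D) z *\<^sub>R (cmod (f z))\<^sup>2) \<le> indicat_real unit_disk z *\<^sub>R (cmod (f z))\<^sup>2" .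
      qed
      finally show "sum (mass f) J \<le> (LINT z|lborel. indicat_real unit_disk z *\<^sub>R (cmod (f z))\<^sup>2)" .
    qed
  qed (rule mass_nonneg)
  then show ?thesis unfolding branch_majorant_def by (rule summable_on_cmult_right)
qed

lemma branch_mult_bound:
  assumes "f \<in> bergman_space" "g \<in> bergman_space" "w \<in> fibre" "x \<in> ball l (\<rho>/2)" "y \<in> ball l (\<rho>/2)"
  shows "cmod (branch f w x * cnj (branch g w y)) \<le> branch_majorant f w + branch_majorant g w"
proof -
  have "0 \<le> cmod (branch f w x) * cmod (branch g w y)" by simp
  then have "cmod (branch f w x) * cmod (branch g w y) \<le> (cmod (branch f w x))\<^sup>2 + (cmod (branch g w y))\<^sup>2"
    using sum_squares_bound[of "cmod (branch f w x)" "cmod (branch g w y)"] by linarith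
  then show ?thesis using branch_bound[OF assms(1,3,4)] branch_bound[OF assms(2,3,5)] by (simp add: norm_mult)
qed

lemma branch_mult_summable:
  assumes "f \<in> bergman_space" "g \<in> bergman_space" "x \<in> ball l (\<rho>/2)" "y \<in> ball l (\<rho>/2)"
  shows "(\<lambda>w. branch f w x * cnj (branch g w y)) summable_on fibre"
  by (rule abs_summable_summable, rule Infinite_Sum.abs_summable_on_comparison_test'[OF summable_on_add[OF branch_majorant_summable[OF assms(1)] branch_majorant_summable[OF assms(2)]]])
     (rule branch_mult_bound[OF assms(1,2) _ assms(3,4)])

text \<open>Two independent base points separate the holomorphic dependence on \<open>x\<close> from
  the antiholomorphic dependence on \<open>y\<close>; on the diagonal this is \<open>kern\<close>
  transported along the section.\<close>

definition branch_term :: "(complex \<Rightarrow> complex) \<Rightarrow> (complex \<Rightarrow> complex) \<Rightarrow> complex \<Rightarrow> complex \<Rightarrow> complex \<Rightarrow> complex" where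
  "branch_term f g w x y = branch (T f) w x * cnj (branch g w y) - branch f w x * cnj (branch (T' g) w y)"

definition term_majorant :: "(complex \<Rightarrow> complex) \<Rightarrow> (complex \<Rightarrow> complex) \<Rightarrow> complex \<Rightarrow> real" where
  "term_majorant f g w = (branch_majorant (T f) w + branch_majorant g w) + (branch_majorant f w + branch_majorant (T' g) w)"

lemma branch_term_bound:
  assumes "f \<in> bergman_space" "g \<in> bergman_space" "w \<in> fibre" "x \<in> ball l (\<rho>/2)" "y \<in> ball l (\<rho>/2)"
  shows "cmod (branch_term f g w x y) \<le> term_majorant f g w"
  unfolding branch_term_def term_majorant_def
  by (intro order_trans[OF norm_triangle_ineq4] add_mono branch_mult_bound assms T_space T'_space)

lemma term_majorant_summable:
  "f \<in> bergman_space \<Longrightarrow> g \<in> bergman_space \<Longrightarrow> term_majorant f g summable_on fibre"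
  unfolding term_majorant_def by (intro summable_on_add branch_majorant_summable T_space T'_space)

lemma term_majorant_nonneg: "0 \<le> term_majorant f g w"
  unfolding term_majorant_def using branch_majorant_nonneg by (intro add_nonneg_nonneg) auto

lemma branch_term_continuous:
  assumes "f \<in> bergman_space" "g \<in> bergman_space" "w \<in> fibre"
  shows "continuous_on D (\<lambda>y. branch_term f g w y y)"
  unfolding branch_term_def
  by (intro continuous_intros holomorphic_on_imp_continuous_on branch_holomorphic assms T_space T'_space)

lemma kern_sec: "(cmod (deriv (sec w) x))\<^sup>2 *\<^sub>R kern f g (sec w x) = branch_term f g w x x"
proof -
  have "complex_of_real ((cmod (deriv (sec w) x))\<^sup>2) = deriv (sec w) x * cnj (deriv (sec w) x)"
    by (rule complex_norm_square)
  then show ?thesis unfolding scaleR_conv_of_real kern_def branch_term_def branch_def by (simp add: algebra_simps)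
qed

text \<open>Sums over the fibre converge along finite subsets, whereas dominated convergence wants a
  sequence; these sets exhaust the countable fibre and connect the two.\<close>

definition initial :: "nat \<Rightarrow> complex set" where
  "initial n = {w \<in> fibre. to_nat_on fibre w < n}"

lemma initial: "finite (initial n)" "initial n \<subseteq> fibre"
proof -
  show "initial n \<subseteq> fibre" by (auto simp: initial_def)
  then have "inj_on (to_nat_on fibre) (initial n)"
    using inj_on_to_nat_on[OF countable_fibre] inj_on_subset by blast
  moreover have "to_nat_on fibre ` initial n \<subseteq> {..<n}" by (auto simp: initial_def)
  ultimately show "finite (initial n)" using finite_subset finite_lessThan inj_on_finite by metis
qed

lemma filterlim_initial: "filterlim initial (finite_subsets_at_top fibre) sequentially"
  unfolding filterlim_def le_filter_def eventually_filtermap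
proof (intro allI impI)
  fix P assume "eventually P (finite_subsets_at_top fibre)"
  then have "\<exists>X. finite X \<and> X \<subseteq> fibre \<and> (\<forall>Y. finite Y \<and> X \<subseteq> Y \<and> Y \<subseteq> fibre \<longrightarrow> P Y)"
    by (simp only: eventually_finite_subsets_at_top)
  then obtain X where X: "finite X" "X \<subseteq> fibre" "\<And>Y. finite Y \<Longrightarrow> X \<subseteq> Y \<Longrightarrow> Y \<subseteq> fibre \<Longrightarrow> P Y"
    by (elim exE conjE) simp
  obtain m where m: "\<And>w. w \<in> X \<Longrightarrow> to_nat_on fibre w < m"
    using finite_nat_bounded[OF finite_imageI[OF X(1)], of "to_nat_on fibre"] by blast
  have "P (initial n)" if "m \<le> n" for n
  proof (rule X(3)[OF initial(1) _ initial(2)], rule subsetI)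
    fix w assume "w \<in> X"
    then show "w \<in> initial n" using m[of w] that X(2) by (auto simp: initial_def)
  qed
  then show "\<forall>\<^sub>F n in sequentially. P (initial n)" by (auto simp: eventually_sequentially)
qed

text \<open>The preimage of \<open>ball x e\<close> is the disjoint union of its sheets, and each
  sheet integral of \<open>kern\<close> becomes an integral over the ball by
  \<open>kern_sec\<close>. Dominated convergence is used twice: on the ball with the summed
  \<open>term_majorant\<close>, on the disk with \<open>cmod (kern f g z)\<close>; the total
  vanishes by \<open>integral_ball_kern\<close>.\<close>

lemma integral_trm:
  assumes f: "f \<in> bergman_space" and g: "g \<in> bergman_space" and e: "ball x e \<subseteq> ball l (\<rho>/2)"
  shows "(LINT y:ball x e|lborel. (\<Sum>\<^sub>\<infinity>w\<in>fibre. branch_term f g w y y)) = 0"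
proof -
  have eD: "ball x e \<subseteq> D" using e half_ball(1) by blast
  note [measurable] = measurable_kern[OF f g]
  let ?t = "\<lambda>w y. indicat_real (ball x e) y *\<^sub>R branch_term f g w y y"
  have tmeas: "?t w \<in> borel_measurable lborel" if "w \<in> fibre" for w
  proof -
    have "?t w \<in> borel_measurable borel"
      by (intro borel_measurable_continuous_on_indicator continuous_on_subset[OF branch_term_continuous[OF f g that] eD]) simp
    then show ?thesis by simp
  qed
  have tlim: "(\<lambda>n. \<Sum>w\<in>initial n. ?t w y) \<longlonglongrightarrow> indicat_real (ball x e) y *\<^sub>R (\<Sum>\<^sub>\<infinity>w\<in>fibre. branch_term f g w y y)" for y
  proof (cases "y \<in> ball x e")
    case True
    then have y: "y \<in> ball l (\<rho>/2)" using e by blast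
    have "(\<lambda>w. branch_term f g w y y) summable_on fibre"
      by (rule abs_summable_summable, rule Infinite_Sum.abs_summable_on_comparison_test'[OF term_majorant_summable[OF f g]])
         (rule branch_term_bound[OF f g _ y y])
    then have "((\<lambda>J. \<Sum>w\<in>J. branch_term f g w y y) \<longlongrightarrow> (\<Sum>\<^sub>\<infinity>w\<in>fibre. branch_term f g w y y)) (finite_subsets_at_top fibre)"
      using has_sum_infsum unfolding has_sum_def by blast
    from filterlim_compose[OF this filterlim_initial] show ?thesis using True by simp
  qed simp
  have sum_le: "(\<Sum>w\<in>initial n. term_majorant f g w) \<le> (\<Sum>\<^sub>\<infinity>w\<in>fibre. term_majorant f g w)" for n
    by (intro finite_sum_le_infsum term_majorant_summable f g initial term_majorant_nonneg)
  have lim1: "(\<lambda>n. LINT y|lborel. (\<Sum>w\<in>initial n. ?t w y)) \<longlonglongrightarrow>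
      (LINT y|lborel. indicat_real (ball x e) y *\<^sub>R (\<Sum>\<^sub>\<infinity>w\<in>fibre. branch_term f g w y y))"
  proof (rule integral_dominated_convergence[where w = "\<lambda>y. indicat_real (ball x e) y *\<^sub>R (\<Sum>\<^sub>\<infinity>w\<in>fibre. term_majorant f g w)"])
    show m: "(\<lambda>y. \<Sum>w\<in>initial n. ?t w y) \<in> borel_measurable lborel" for n
      using initial by (intro borel_measurable_sum tmeas) auto
    show "(\<lambda>y. indicat_real (ball x e) y *\<^sub>R (\<Sum>\<^sub>\<infinity>w\<in>fibre. branch_term f g w y y)) \<in> borel_measurable lborel"
      by (rule borel_measurable_LIMSEQ_metric[OF m tlim])
    show "integrable lborel (\<lambda>y. indicat_real (ball x e) y *\<^sub>R (\<Sum>\<^sub>\<infinity>w\<in>fibre. term_majorant f g w))"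
      using set_integrable_ball_continuous[of x e "\<lambda>_. \<Sum>\<^sub>\<infinity>w\<in>fibre. term_majorant f g w"] unfolding set_integrable_def by simp
    show "AE y in lborel. norm (\<Sum>w\<in>initial n. ?t w y) \<le> indicat_real (ball x e) y *\<^sub>R (\<Sum>\<^sub>\<infinity>w\<in>fibre. term_majorant f g w)" for n
    proof (rule AE_I2)
      fix y
      show "norm (\<Sum>w\<in>initial n. ?t w y) \<le> indicat_real (ball x e) y *\<^sub>R (\<Sum>\<^sub>\<infinity>w\<in>fibre. term_majorant f g w)"
      proof (cases "y \<in> ball x e")
        case True
        then have y: "y \<in> ball l (\<rho>/2)" using e by blast
        have "norm (\<Sum>w\<in>initial n. branch_term f g w y y) \<le> (\<Sum>w\<in>initial n. term_majorant f g w)"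
          using initial by (intro order_trans[OF norm_sum] sum_mono branch_term_bound f g y) auto
        then show ?thesis using True sum_le[of n] by simp
      qed simp
    qed
  qed (use tlim in auto)
  let ?k = "\<lambda>w z. indicat_real (sec w ` ball x e) z *\<^sub>R kern f g z"
  have kint: "integrable lborel (?k w)" if "w \<in> fibre" for w
  proof -
    have "set_integrable lborel (sec w ` ball x e) (kern f g)"
      by (rule set_integrable_subset[OF set_integrable_kern[OF f g]])
         (use sec_open_image[OF that open_ball eD] sec_image_disk[OF that eD] in auto)
    then show ?thesis unfolding set_integrable_def .
  qed
  have k_eq: "(\<Sum>w\<in>initial n. ?k w z) = indicat_real (\<Union>w\<in>initial n. sec w ` ball x e) z *\<^sub>R kern f g z" for n z
    unfolding scaleR_sum_left[symmetric] sum_indicator_sec[OF initial eD] ..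
  \<comment> \<open>A point over the ball lies on exactly one sheet, so the partial sums are
    constant as soon as \<open>initial n\<close> contains its label.\<close>
  have klim: "(\<lambda>n. \<Sum>w\<in>initial n. ?k w z) \<longlonglongrightarrow> indicat_real unit_disk z *\<^sub>R (indicat_real (ball x e) (B z) *\<^sub>R kern f g z)" for z
  proof (cases "z \<in> unit_disk \<and> B z \<in> ball x e")
    case True
    then obtain w where w: "w \<in> fibre" "sec w (B z) = z" using sec_ex[of z] eD by blast
    have "(\<Sum>v\<in>initial n. ?k v z) = kern f g z" if "to_nat_on fibre w < n" for n
    proof -
      have "w \<in> initial n" using w that by (simp add: initial_def)
      then have "z \<in> (\<Union>w\<in>initial n. sec w ` ball x e)" using w(2) True by force
      then show ?thesis unfolding k_eq by simp
    qed
    then have "\<forall>\<^sub>F n in sequentially. (\<Sum>v\<in>initial n. ?k v z) = kern f g z"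
      unfolding eventually_sequentially by (intro exI[of _ "Suc (to_nat_on fibre w)"]) auto
    then show ?thesis using True by (simp add: tendsto_eventually)
  next
    case False
    have "z \<notin> (\<Union>w\<in>initial n. sec w ` ball x e)" for n
    proof
      assume "z \<in> (\<Union>w\<in>initial n. sec w ` ball x e)"
      then obtain w y where "w \<in> fibre" "y \<in> ball x e" "z = sec w y" using initial(2) by blast
      then show False using False sec_simps(2,3)[of w y] eD by (metis subsetD)
    qed
    then have "(\<Sum>w\<in>initial n. ?k w z) = 0" for n unfolding k_eq by simp
    moreover have "indicat_real unit_disk z *\<^sub>R (indicat_real (ball x e) (B z) *\<^sub>R kern f g z) = 0"
      using False by (auto simp: indicator_def)
    ultimately show ?thesis by (simp only: tendsto_const)
  qed
  have lim2: "(\<lambda>n. LINT z|lborel. (\<Sum>w\<in>initial n. ?k w z)) \<longlonglongrightarrow>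
      (LINT z|lborel. indicat_real unit_disk z *\<^sub>R (indicat_real (ball x e) (B z) *\<^sub>R kern f g z))"
  proof (rule integral_dominated_convergence[where w = "\<lambda>z. indicat_real unit_disk z *\<^sub>R cmod (kern f g z)"])
    show m: "(\<lambda>z. \<Sum>w\<in>initial n. ?k w z) \<in> borel_measurable lborel" for n
      using initial kint by (intro borel_measurable_sum borel_measurable_integrable) auto
    show "(\<lambda>z. indicat_real unit_disk z *\<^sub>R (indicat_real (ball x e) (B z) *\<^sub>R kern f g z)) \<in> borel_measurable lborel"
      by (rule borel_measurable_LIMSEQ_metric[OF m klim])
    show "integrable lborel (\<lambda>z. indicat_real unit_disk z *\<^sub>R cmod (kern f g z))"
      using set_integrable_norm[OF set_integrable_kern[OF f g]] unfolding set_integrable_def .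
    show "AE z in lborel. norm (\<Sum>w\<in>initial n. ?k w z) \<le> indicat_real unit_disk z *\<^sub>R cmod (kern f g z)" for n
    proof (rule AE_I2)
      fix z
      have "(\<Union>w\<in>initial n. sec w ` ball x e) \<subseteq> unit_disk"
        using initial(2)[of n] sec_image_disk[OF _ eD] by blast
      then have "indicat_real (\<Union>w\<in>initial n. sec w ` ball x e) z \<le> indicat_real unit_disk z"
        unfolding indicator_def by (simp only: subset_iff) simp
      then show "norm (\<Sum>w\<in>initial n. ?k w z) \<le> indicat_real unit_disk z *\<^sub>R cmod (kern f g z)"
        unfolding k_eq by (simp add: mult_right_mono)
    qed
  qed (use klim in auto)
  have kt: "(LINT z|lborel. ?k w z) = (LINT y|lborel. ?t w y)" if "w \<in> fibre" for w
    using set_integral_sec(2)[OF that open_ball eD measurable_kern[OF f g]]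
    unfolding set_lebesgue_integral_def kern_sec .
  have tint: "integrable lborel (?t w)" if "w \<in> fibre" for w
    using set_integral_sec(1)[OF that open_ball eD measurable_kern[OF f g]] kint[OF that]
    unfolding set_integrable_def kern_sec by simp
  have "(LINT z|lborel. (\<Sum>w\<in>initial n. ?k w z)) = (LINT y|lborel. (\<Sum>w\<in>initial n. ?t w y))" for n
  proof -
    have "(LINT z|lborel. (\<Sum>w\<in>initial n. ?k w z)) = (\<Sum>w\<in>initial n. LINT z|lborel. ?k w z)"
      using initial(2)[of n] kint by (intro Bochner_Integration.integral_sum) auto
    also have "\<dots> = (\<Sum>w\<in>initial n. LINT y|lborel. ?t w y)"
      using initial(2)[of n] kt by (intro sum.cong) auto
    also have "\<dots> = (LINT y|lborel. (\<Sum>w\<in>initial n. ?t w y))"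
      using initial(2)[of n] tint by (intro Bochner_Integration.integral_sum[symmetric]) auto
    finally show ?thesis .
  qed
  then have "(LINT y|lborel. indicat_real (ball x e) y *\<^sub>R (\<Sum>\<^sub>\<infinity>w\<in>fibre. branch_term f g w y y)) =
    (LINT z|lborel. indicat_real unit_disk z *\<^sub>R (indicat_real (ball x e) (B z) *\<^sub>R kern f g z))"
    using LIMSEQ_unique[OF lim1] lim2 by simp
  then show ?thesis using integral_ball_kern[OF f g, of x e] unfolding set_lebesgue_integral_def by simp
qed

text \<open>The fibre sum is continuous by uniform convergence, and by \<open>integral_trm\<close>
  its averages over all small balls vanish.\<close>

lemma diag_zero:
  assumes f: "f \<in> bergman_space" and g: "g \<in> bergman_space" and x: "x \<in> ball l (\<rho>/2)"
  shows "(\<Sum>\<^sub>\<infinity>w\<in>fibre. branch_term f g w x x) = 0"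
proof (rule continuous_averages_zero[of "ball l (\<rho>/2)" "\<lambda>y. \<Sum>\<^sub>\<infinity>w\<in>fibre. branch_term f g w y y"])
  have "uniform_limit (ball l (\<rho>/2)) (\<lambda>J y. \<Sum>w\<in>J. branch_term f g w y y) (\<lambda>y. \<Sum>\<^sub>\<infinity>w\<in>fibre. branch_term f g w y y) (finite_subsets_at_top fibre)"
    by (rule Weierstrass_m_test_general[OF _ term_majorant_summable[OF f g]]) (rule branch_term_bound[OF f g])
  moreover have "\<forall>\<^sub>F J in finite_subsets_at_top fibre. continuous_on (ball l (\<rho>/2)) (\<lambda>y. \<Sum>w\<in>J. branch_term f g w y y)"
    by (rule eventually_finite_subsets_at_top_weakI)
       (intro continuous_on_sum continuous_on_subset[OF branch_term_continuous[OF f g] half_ball(1)], auto)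
  ultimately show "continuous_on (ball l (\<rho>/2)) (\<lambda>y. \<Sum>\<^sub>\<infinity>w\<in>fibre. branch_term f g w y y)"
    by (intro uniform_limit_theorem) auto
qed (use x integral_trm[OF f g] in auto)

text \<open>
  Polarisation: write \<open>x - l = a + \<i> * b\<close> and \<open>cnj (y - l) = a - \<i> * b\<close>.  The sum is holomorphic in \<open>a\<close>
  and in \<open>b\<close>, and real \<open>a\<close>, \<open>b\<close> correspond to the diagonal.
\<close>

lemma off_diag_zero:
  assumes f: "f \<in> bergman_space" and g: "g \<in> bergman_space" and x: "x \<in> ball l (\<rho>/4)" and y: "y \<in> ball l (\<rho>/4)"
  shows "(\<Sum>\<^sub>\<infinity>w\<in>fibre. branch_term f g w x y) = 0"
proof -
  define X where "X a b = l + a + \<i> * b" for a b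
  define Y where "Y a b = l + cnj a + \<i> * cnj b" for a b
  define G where "G a b = (\<Sum>\<^sub>\<infinity>w\<in>fibre. branch_term f g w (X a b) (Y a b))" for a b
  let ?R = "ball (0::complex) (\<rho>/4)"
  have XY: "X a b \<in> ball l (\<rho>/2)" "Y a b \<in> ball l (\<rho>/2)" if "a \<in> ?R" "b \<in> ?R" for a b
  proof -
    have "cmod (a + \<i> * b) \<le> cmod a + cmod b" "cmod (cnj a + \<i> * cnj b) \<le> cmod a + cmod b"
      using norm_triangle_ineq[of a "\<i> * b"] norm_triangle_ineq[of "cnj a" "\<i> * cnj b"] by (simp_all add: norm_mult)
    moreover have "dist l (X a b) = cmod (a + \<i> * b)" "dist l (Y a b) = cmod (cnj a + \<i> * cnj b)"
      unfolding dist_commute[of l "X a b"] dist_commute[of l "Y a b"]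
      by (simp_all add: X_def Y_def dist_norm add.assoc)
    ultimately show "X a b \<in> ball l (\<rho>/2)" "Y a b \<in> ball l (\<rho>/2)" using that by auto
  qed
  have XD: "X a b \<in> D" "Y a b \<in> D" if "a \<in> ?R" "b \<in> ?R" for a b using XY[OF that] half_ball(1) by blast+
  have cnjR: "cnj a \<in> ?R" if "a \<in> ?R" for a using that by simp
  have comp: "(\<lambda>b. h (p b)) holomorphic_on ?R"
    if "h holomorphic_on D" "p holomorphic_on ?R" "\<And>b. b \<in> ?R \<Longrightarrow> p b \<in> D" for h p
    using holomorphic_on_compose_gen[OF that(2,1)] that(3) by (auto simp: o_def image_subset_iff)
  have holb: "(\<lambda>b. branch_term f g w (X a b) (Y a b)) holomorphic_on ?R" if w: "w \<in> fibre" and a: "a \<in> ?R" for w a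
  proof -
    have 1: "(\<lambda>b. branch h w (X a b)) holomorphic_on ?R" if "h \<in> bergman_space" for h
      by (rule comp[OF branch_holomorphic[OF that w]]) (use XD(1)[OF a] in \<open>auto simp: X_def intro!: holomorphic_intros\<close>)
    have 2: "(\<lambda>b. cnj (branch h w (Y a b))) holomorphic_on ?R" if "h \<in> bergman_space" for h
    proof -
      \<comment> \<open>\<open>Y\<close> depends on the conjugate of its argument; conjugating both
        the variable and the value restores holomorphy.\<close>
      have "(\<lambda>v. branch h w (Y a (cnj v))) holomorphic_on ?R"
        by (rule comp[OF branch_holomorphic[OF that w]])
           (use XD(2)[OF a cnjR] in \<open>auto simp: Y_def intro!: holomorphic_intros\<close>)
      from holomorphic_cnj_cnj[OF this] show ?thesis by simp
    qed
    show ?thesis unfolding branch_term_def by (intro holomorphic_intros 1 2 f g T_space T'_space)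
  qed
  have hola: "(\<lambda>a. branch_term f g w (X a b) (Y a b)) holomorphic_on ?R" if w: "w \<in> fibre" and b: "b \<in> ?R" for w b
  proof -
    have 1: "(\<lambda>a. branch h w (X a b)) holomorphic_on ?R" if "h \<in> bergman_space" for h
      by (rule comp[OF branch_holomorphic[OF that w]]) (use XD(1)[OF _ b] in \<open>auto simp: X_def intro!: holomorphic_intros\<close>)
    have 2: "(\<lambda>a. cnj (branch h w (Y a b))) holomorphic_on ?R" if "h \<in> bergman_space" for h
    proof -
      have "(\<lambda>v. branch h w (Y (cnj v) b)) holomorphic_on ?R"
        by (rule comp[OF branch_holomorphic[OF that w]])
           (use XD(2)[OF cnjR b] in \<open>auto simp: Y_def intro!: holomorphic_intros\<close>)
      from holomorphic_cnj_cnj[OF this] show ?thesis by simp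
    qed
    show ?thesis unfolding branch_term_def by (intro holomorphic_intros 1 2 f g T_space T'_space)
  qed
  have Gb: "G a holomorphic_on ?R" if "a \<in> ?R" for a
    unfolding G_def
    by (rule infsum_holomorphic[OF holb _ term_majorant_summable[OF f g]]) (use that XY in \<open>auto intro!: branch_term_bound f g\<close>)
  have Ga: "(\<lambda>a. G a b) holomorphic_on ?R" if "b \<in> ?R" for b
    unfolding G_def
    by (rule infsum_holomorphic[OF hola _ term_majorant_summable[OF f g]]) (use that XY in \<open>auto intro!: branch_term_bound f g\<close>)
  have "G (of_real a) (of_real b) = 0" if "\<bar>a\<bar> < \<rho>/4" "\<bar>b\<bar> < \<rho>/4" for a b :: real
  proof -
    have "X (of_real a) (of_real b) = Y (of_real a) (of_real b)" by (simp add: X_def Y_def)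
    then show ?thesis using diag_zero[OF f g XY(1)[of "of_real a" "of_real b"]] that by (simp add: G_def)
  qed
  \<comment> \<open>The identity theorem is applied to one variable at a time: to \<open>b\<close>
    while \<open>a\<close> is real, then to \<open>a\<close> for each complex
    \<open>b\<close>.\<close>
  then have "G (of_real a) b = 0" if "\<bar>a\<bar> < \<rho>/4" "b \<in> ?R" for a :: real and b
    using vanishes_on_ball_if_real[OF Gb[of "of_real a"] _ that(2)] that(1) by simp
  then have G0: "G a b = 0" if "a \<in> ?R" "b \<in> ?R" for a b
    using vanishes_on_ball_if_real[OF Ga[OF that(2)] _ that(1)] that(2) by simp
  \<comment> \<open>With \<open>b\<close> below, the solution of \<open>X a b = x\<close> and
    \<open>Y a b = y\<close>. Base points within \<rho>/4 of the centre give \<open>a\<close> and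
    \<open>b\<close> of modulus less than \<rho>/4, which keeps \<open>X\<close> and
    \<open>Y\<close> within \<rho>/2, where the majorants hold.\<close>
  define a where "a = ((x - l) + cnj (y - l)) / 2"
  define b where "b = ((x - l) - cnj (y - l)) / (2 * \<i>)"
  have "cmod (x - l) < \<rho>/4" "cmod (cnj (y - l)) < \<rho>/4"
    using x y unfolding complex_mod_cnj by (simp_all add: dist_norm norm_minus_commute)
  then have ab: "a \<in> ?R" "b \<in> ?R"
    using norm_triangle_ineq[of "x - l" "cnj (y - l)"] norm_triangle_ineq4[of "x - l" "cnj (y - l)"]
    unfolding a_def b_def by (simp_all add: norm_divide norm_mult del: complex_cnj_diff complex_mod_cnj)
  have "X a b = x" unfolding X_def a_def b_def by (simp add: field_simps)
  moreover have "Y a b = y"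
  proof -
    define p q where "p = cnj (x - l)" and "q = y - l"
    have a2: "cnj a = (p + q) / 2" unfolding a_def p_def q_def by simp
    have b1: "cnj b = (p - q) / (2 * - \<i>)" unfolding b_def p_def q_def by simp
    have b2: "\<i> * cnj b = - ((p - q) / 2)" unfolding b1 by (simp add: field_simps)
    have "cnj a + \<i> * cnj b = q" unfolding a2 b2 by (simp add: field_simps)
    then show ?thesis unfolding Y_def q_def by (simp add: add.assoc)
  qed
  ultimately show ?thesis using G0[OF ab] by (simp add: G_def)
qed

section \<open>The matrix of an operator on a fibre\<close>

lemma intertwining:
  assumes f: "f \<in> bergman_space" and g: "g \<in> bergman_space" and x: "x \<in> ball l (\<rho>/4)" and y: "y \<in> ball l (\<rho>/4)"
  shows "(\<Sum>\<^sub>\<infinity>w\<in>fibre. branch (T f) w x * cnj (branch g w y)) = (\<Sum>\<^sub>\<infinity>w\<in>fibre. branch f w x * cnj (branch (T' g) w y))"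
proof -
  have xy: "x \<in> ball l (\<rho>/2)" "y \<in> ball l (\<rho>/2)" using x y rho by auto
  note s1 = branch_mult_summable[OF T_space[OF f] g xy] and s2 = branch_mult_summable[OF f T'_space[OF g] xy]
  have "((\<lambda>w. branch (T f) w x * cnj (branch g w y) + (-1) * (branch f w x * cnj (branch (T' g) w y))) has_sum
      ((\<Sum>\<^sub>\<infinity>w\<in>fibre. branch (T f) w x * cnj (branch g w y)) + (-1) * (\<Sum>\<^sub>\<infinity>w\<in>fibre. branch f w x * cnj (branch (T' g) w y)))) fibre"
    by (intro has_sum_add has_sum_cmult_right has_sum_infsum s1 s2)
  then have "(\<Sum>\<^sub>\<infinity>w\<in>fibre. branch_term f g w x y) =
      (\<Sum>\<^sub>\<infinity>w\<in>fibre. branch (T f) w x * cnj (branch g w y)) - (\<Sum>\<^sub>\<infinity>w\<in>fibre. branch f w x * cnj (branch (T' g) w y))"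
    unfolding branch_term_def by (simp add: infsumI)
  then show ?thesis using off_diag_zero[OF assms] by simp
qed

text \<open>The derivative of the section cancels \<open>deriv B\<close>, so on the fibre over
  \<open>x\<close> these functions realise the unit vectors.\<close>

lemma branch_quotient:
  assumes "w \<in> fibre" "j \<in> fibre" "x \<in> D"
  shows "branch (quotient_fun B (sec j x)) w x = (if w = j then 1 else 0)"
  using sec_deriv[OF assms(1,3)] sec_simps(2,3)[OF assms(1,3)] sec_simps(3)[OF assms(2,3)] sec_eqD(1)[OF assms(1,2,3,3)]
  by (auto simp: branch_def quotient_fun_def)

lemma infsum_delta_right:
  fixes h :: "complex \<Rightarrow> complex"
  assumes "i \<in> fibre" and "\<And>w. w \<in> fibre \<Longrightarrow> e w = (if w = i then 1 else 0)"
  shows "(\<Sum>\<^sub>\<infinity>w\<in>fibre. h w * e w) = h i"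
proof -
  have "(\<Sum>\<^sub>\<infinity>w\<in>fibre. h w * e w) = (\<Sum>\<^sub>\<infinity>w\<in>{i}. h w)"
    using assms by (intro infsum_cong_neutral) auto
  then show ?thesis by simp
qed

lemma quarter_ball: "x \<in> ball l (\<rho>/4) \<Longrightarrow> x \<in> D"
  using rho by auto

text \<open>Testing \<open>intertwining\<close> against a unit vector over \<open>y\<close> isolates
  one branch of \<open>T f\<close> over \<open>x\<close>, while the two base points remain
  independent.\<close>

lemma branch_T_eq:
  assumes f: "f \<in> bergman_space" and i: "i \<in> fibre" and x: "x \<in> ball l (\<rho>/4)" and y: "y \<in> ball l (\<rho>/4)"
  shows "branch (T f) i x = (\<Sum>\<^sub>\<infinity>w\<in>fibre. branch f w x * cnj (branch (T' (quotient_fun B (sec i y))) w y))"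
proof -
  have q: "quotient_fun B (sec i y) \<in> bergman_space"
    by (rule quotient_space[OF sec_simps(2)[OF i quarter_ball[OF y]]])
  have "(\<Sum>\<^sub>\<infinity>w\<in>fibre. branch (T f) w x * cnj (branch (quotient_fun B (sec i y)) w y)) = branch (T f) i x"
    by (rule infsum_delta_right[OF i]) (simp add: branch_quotient[OF _ i quarter_ball[OF y]])
  then show ?thesis using intertwining[OF f q x y] by simp
qed

lemma branch_T_quotient:
  assumes i: "i \<in> fibre" and j: "j \<in> fibre" and x: "x \<in> ball l (\<rho>/4)" and y: "y \<in> ball l (\<rho>/4)"
  shows "branch (T (quotient_fun B (sec j x))) i x = cnj (branch (T' (quotient_fun B (sec i y))) j y)"
proof -
  have q: "quotient_fun B (sec j x) \<in> bergman_space"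
    by (rule quotient_space[OF sec_simps(2)[OF j quarter_ball[OF x]]])
  have "(\<Sum>\<^sub>\<infinity>w\<in>fibre. branch (quotient_fun B (sec j x)) w x * cnj (branch (T' (quotient_fun B (sec i y))) w y)) =
      cnj (branch (T' (quotient_fun B (sec i y))) j y)"
    unfolding mult.commute[of "branch (quotient_fun B (sec j x)) _ _"]
    by (rule infsum_delta_right[OF j]) (simp add: branch_quotient[OF _ j quarter_ball[OF x]])
  then show ?thesis using branch_T_eq[OF q i x y] by simp
qed

lemma coef_eq_branch:
  assumes "i \<in> fibre" "x \<in> D"
  shows "coef (sec i x) w = branch (T (quotient_fun B w)) i x"
proof -
  have "deriv (sec i) x = 1 / deriv B (sec i x)"
    using sec_deriv[OF assms] by (metis mult_eq_0_iff nonzero_eq_divide_eq one_neq_zero mult.commute)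
  then show ?thesis by (simp add: coef_def branch_def)
qed

text \<open>
  By \<open>branch_T_quotient\<close> the coefficient at \<open>x\<close> equals an expression in \<open>y\<close> alone.
\<close>

lemma coef_locally_constant:
  assumes i: "i \<in> fibre" and j: "j \<in> fibre" and x: "x \<in> ball l (\<rho>/4)"
  shows "coef (sec i x) (sec j x) = coef i j"
proof -
  have l: "l \<in> ball l (\<rho>/4)" using rho by simp
  have "coef (sec i x) (sec j x) = coef (sec i l) (sec j l)"
    unfolding coef_eq_branch[OF i quarter_ball[OF x]] coef_eq_branch[OF i quarter_ball[OF l]]
    using branch_T_quotient[OF i j x l] branch_T_quotient[OF i j l l] by simp
  then show ?thesis by (simp add: sec(2) i j)
qed

lemma coef_eq_adjoint:
  assumes i: "i \<in> fibre" and j: "j \<in> fibre"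
  shows "coef i j = cnj (branch (T' (quotient_fun B i)) j l)"
proof -
  have l: "l \<in> ball l (\<rho>/4)" using rho by simp
  show ?thesis
    using branch_T_quotient[OF i j l l] coef_eq_branch[OF i quarter_ball[OF l], of "sec j l"] by (simp add: sec(2) i j)
qed

lemma fibre_disk: "i \<in> fibre \<Longrightarrow> i \<in> unit_disk"
  by (simp add: fibre_def)

text \<open>By \<open>coef_eq_adjoint\<close> a row of the matrix consists, up to conjugation, of
  the branches of the single Bergman function \<open>T' (quotient_fun B i)\<close>, whose squares
  are summable over the sheets.\<close>

lemma coef_summable:
  assumes i: "i \<in> fibre" shows "(\<lambda>w. (cmod (coef i w))\<^sup>2) summable_on fibre"
proof (rule summable_on_comparison_test[OF branch_majorant_summable])
  show q: "T' (quotient_fun B i) \<in> bergman_space" by (intro T'_space quotient_space fibre_disk i)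
  show "(cmod (coef i w))\<^sup>2 \<le> branch_majorant (T' (quotient_fun B i)) w" if "w \<in> fibre" for w
    using branch_bound[OF q that, of l] rho by (simp add: coef_eq_adjoint[OF i that])
qed auto

lemma T_representation:
  assumes f: "f \<in> bergman_space" and i: "i \<in> fibre"
  shows "T f i / deriv B i = (\<Sum>\<^sub>\<infinity>w\<in>fibre. f w / deriv B w * coef i w)"
proof -
  have l: "l \<in> ball l (\<rho>/4)" using rho by simp
  have branch: "branch h w l = h w / deriv B w" if w: "w \<in> fibre" for h w
  proof -
    have "deriv B w * deriv (sec w) l = 1" using sec_deriv[OF w quarter_ball[OF l]] by (simp add: sec(2)[OF w])
    then have "deriv (sec w) l = 1 / deriv B w" by (metis mult_eq_0_iff nonzero_eq_divide_eq one_neq_zero mult.commute)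
    then show ?thesis by (simp add: branch_def sec(2)[OF w])
  qed
  have "branch (T f) i l = (\<Sum>\<^sub>\<infinity>w\<in>fibre. branch f w l * cnj (branch (T' (quotient_fun B i)) w l))"
    using branch_T_eq[OF f i l l] by (simp add: sec(2)[OF i])
  also have "\<dots> = (\<Sum>\<^sub>\<infinity>w\<in>fibre. f w / deriv B w * coef i w)"
    by (intro infsum_cong) (simp add: branch coef_eq_adjoint[OF i])
  finally show ?thesis by (simp add: branch[OF i])
qed

end

section \<open>Components of the Riemann surface\<close>

context covered_pair
begin

lemma regular_value: "x \<in> D \<Longrightarrow> x \<notin> critical_values B"
proof
  assume x: "x \<in> D" "x \<in> critical_values B"
  then obtain z where z: "z \<in> unit_disk" "B z = x" "deriv B z = 0" by (auto simp: critical_values_def)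
  then obtain w where "w \<in> fibre" "sec w x = z" using sec_ex[of z] x by auto
  then show False using sec_deriv[of w x] x z by simp
qed

lemma sec_regular_domain: "i \<in> fibre \<Longrightarrow> x \<in> D \<Longrightarrow> sec i x \<in> regular_domain B"
  using sec_simps(2,3)[of i x] regular_value[of x] by (auto simp: regular_domain_def)

lemma regular_neighbourhood:
  assumes i: "i \<in> fibre"
  shows "openin (top_of_set (regular_domain B)) (sec i ` ball l (\<rho>/4))" "i \<in> sec i ` ball l (\<rho>/4)"
proof -
  have sub: "ball l (\<rho>/4) \<subseteq> D" using quarter_ball by blast
  have "sec i ` ball l (\<rho>/4) \<subseteq> regular_domain B" using sec_regular_domain[OF i] sub by blast
  then show "openin (top_of_set (regular_domain B)) (sec i ` ball l (\<rho>/4))"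
    using sec_open_image[OF i open_ball sub] by (simp add: open_subset)
  show "i \<in> sec i ` ball l (\<rho>/4)"
    using rho sec(2)[OF i] by (intro image_eqI[of _ _ l]) auto
qed

text \<open>A basic connected neighbourhood of \<open>(i, j)\<close> in the surface, parametrised by
  the common value of \<open>B\<close>; the radius \<rho>/4 is the one on which \<open>coef\<close>
  is known to be constant.\<close>

definition sheet :: "complex \<Rightarrow> complex \<Rightarrow> (complex \<times> complex) set" where
  "sheet i j = (\<lambda>x. (sec i x, sec j x)) ` ball l (\<rho>/4)"

lemma centre_quarter: "l \<in> ball l (\<rho>/4)"
  using rho by simp

lemma sheet_subset: "i \<in> fibre \<Longrightarrow> j \<in> fibre \<Longrightarrow> sheet i j \<subseteq> riemann_surface B"
  using sec_regular_domain sec_simps(2,3) quarter_ball by (auto simp: sheet_def riemann_surface_def)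

lemma centre_in_sheet: "i \<in> fibre \<Longrightarrow> j \<in> fibre \<Longrightarrow> (i, j) \<in> sheet i j"
  unfolding sheet_def using centre_quarter by (intro image_eqI[of _ _ l]) (auto simp: sec(2))

lemma connected_sheet:
  assumes "i \<in> fibre" "j \<in> fibre" shows "connected (sheet i j)"
  unfolding sheet_def
proof (rule connected_continuous_image)
  have "ball l (\<rho>/4) \<subseteq> D" using quarter_ball by blast
  then show "continuous_on (ball l (\<rho>/4)) (\<lambda>x. (sec i x, sec j x))"
    by (intro continuous_on_Pair holomorphic_on_imp_continuous_on holomorphic_on_subset[OF sec_simps(1)] assms)
qed simp

text \<open>On the surface both coordinates have the same image under \<open>B\<close>, which forces
  equal parameters; hence a sheet is the trace of a product of two open sets.\<close>

lemma openin_sheet: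
  assumes i: "i \<in> fibre" and j: "j \<in> fibre"
  shows "openin (top_of_set (riemann_surface B)) (sheet i j)"
proof -
  have sub: "ball l (\<rho>/4) \<subseteq> D" using quarter_ball by blast
  have "sheet i j = riemann_surface B \<inter> (sec i ` ball l (\<rho>/4) \<times> sec j ` ball l (\<rho>/4))"
  proof
    show "sheet i j \<subseteq> riemann_surface B \<inter> (sec i ` ball l (\<rho>/4) \<times> sec j ` ball l (\<rho>/4))"
      using sheet_subset[OF i j] by (auto simp: sheet_def)
    show "riemann_surface B \<inter> (sec i ` ball l (\<rho>/4) \<times> sec j ` ball l (\<rho>/4)) \<subseteq> sheet i j"
    proof
      fix p assume p: "p \<in> riemann_surface B \<inter> (sec i ` ball l (\<rho>/4) \<times> sec j ` ball l (\<rho>/4))"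
      then obtain x y where xy: "p = (sec i x, sec j y)" "x \<in> ball l (\<rho>/4)" "y \<in> ball l (\<rho>/4)" by auto
      then have "B (sec i x) = B (sec j y)" using p by (auto simp: riemann_surface_def)
      then have "x = y" using sec_simps(3)[OF i, of x] sec_simps(3)[OF j, of y] xy quarter_ball by simp
      then show "p \<in> sheet i j" using xy by (auto simp: sheet_def)
    qed
  qed
  moreover have "open (sec i ` ball l (\<rho>/4) \<times> sec j ` ball l (\<rho>/4))"
    by (intro open_Times sec_open_image i j sub open_ball)
  ultimately show ?thesis by (simp add: openin_open_Int)
qed

lemma coef_sheet: "i \<in> fibre \<Longrightarrow> j \<in> fibre \<Longrightarrow> p \<in> sheet i j \<Longrightarrow> coef (fst p) (snd p) = coef i j"
  unfolding sheet_def using coef_locally_constant by auto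

text \<open>A connected sheet that meets the component \<open>G\<close> lies in \<open>G\<close>.
  Moving along the sheets is therefore a bijection between the points of \<open>G\<close> over
  \<open>i\<close> and those over \<open>sec i x\<close>.\<close>

lemma card_fibre_locally_constant:
  assumes G: "G \<in> components (riemann_surface B)" and i: "i \<in> fibre" and x: "x \<in> ball l (\<rho>/4)"
  shows "card {w. (sec i x, w) \<in> G} = card {w. (i, w) \<in> G}"
proof -
  have GS: "G \<subseteq> riemann_surface B" using G by (rule in_components_subset)
  have xD: "x \<in> D" by (rule quarter_ball[OF x])
  have iff: "(i, j) \<in> G \<longleftrightarrow> (sec i x, sec j x) \<in> G" if j: "j \<in> fibre" for j
  proof -
    have mem: "(sec i x, sec j x) \<in> sheet i j" using x by (auto simp: sheet_def)
    have "sheet i j \<subseteq> G" if "p \<in> sheet i j" "p \<in> G" for p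
      using components_maximal[OF G connected_sheet[OF i j] sheet_subset[OF i j]] that by blast
    then show ?thesis using mem centre_in_sheet[OF i j] by blast
  qed
  have fibre1: "j \<in> fibre" if "(i, j) \<in> G" for j
    using that GS i by (auto simp: riemann_surface_def fibre_def)
  have "{w. (sec i x, w) \<in> G} = (\<lambda>j. sec j x) ` {w. (i, w) \<in> G}"
  proof
    show "{w. (sec i x, w) \<in> G} \<subseteq> (\<lambda>j. sec j x) ` {w. (i, w) \<in> G}"
    proof
      fix w assume "w \<in> {w. (sec i x, w) \<in> G}"
      then have w: "(sec i x, w) \<in> G" by simp
      then have "w \<in> unit_disk" "B w = x" using GS sec_simps(3)[OF i xD] by (auto simp: riemann_surface_def)
      then obtain j where "j \<in> fibre" "sec j x = w" using sec_ex[of w] xD by auto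
      then show "w \<in> (\<lambda>j. sec j x) ` {w. (i, w) \<in> G}" using w iff by auto
    qed
    show "(\<lambda>j. sec j x) ` {w. (i, w) \<in> G} \<subseteq> {w. (sec i x, w) \<in> G}" using fibre1 iff by auto
  qed
  moreover have "inj_on (\<lambda>j. sec j x) {w. (i, w) \<in> G}"
    using sec_eqD(1)[OF _ _ xD xD] fibre1 by (auto intro!: inj_onI)
  ultimately show ?thesis by (simp add: card_image)
qed

text \<open>Infinitely many points of \<open>G\<close> over \<open>i\<close> would put arbitrarily
  many copies of \<open>(cmod c)\<^sup>2\<close> into the convergent sum of
  \<open>coef_summable\<close>.\<close>

lemma finite_fibre:
  assumes G: "G \<subseteq> riemann_surface B" and i: "i \<in> fibre" and c: "c \<noteq> 0" "\<And>w. (i, w) \<in> G \<Longrightarrow> coef i w = c"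
  shows "finite {w. (i, w) \<in> G}"
proof (rule ccontr)
  assume inf: "infinite {w. (i, w) \<in> G}"
  let ?S = "\<Sum>\<^sub>\<infinity>w\<in>fibre. (cmod (coef i w))\<^sup>2"
  obtain n where n: "?S < real n * (cmod c)\<^sup>2" using c(1) reals_Archimedean3[of "(cmod c)\<^sup>2"] by auto
  obtain A where A: "finite A" "card A = n" "A \<subseteq> {w. (i, w) \<in> G}"
    using infinite_arbitrarily_large[OF inf] by blast
  have Af: "A \<subseteq> fibre" using A(3) G i by (auto simp: riemann_surface_def fibre_def)
  have "real n * (cmod c)\<^sup>2 = (\<Sum>w\<in>A. (cmod (coef i w))\<^sup>2)"
  proof -
    have "(\<Sum>w\<in>A. (cmod (coef i w))\<^sup>2) = (\<Sum>w\<in>A. (cmod c)\<^sup>2)"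
      using A(3) c(2) by (intro sum.cong) auto
    then show ?thesis using A(2) by simp
  qed
  also have "\<dots> \<le> ?S" by (rule finite_sum_le_infsum[OF coef_summable[OF i] A(1) Af]) simp
  finally show False using n by simp
qed

end

text \<open>A nonconstant \<open>B\<close> has countably many critical points, hence countably many
  critical values, each with a countable preimage. A disk minus a countable set is nonempty and
  connected.\<close>

lemma
  assumes thin: "thin_blaschke_product B"
  shows connected_regular_domain: "connected (regular_domain B)"
    and regular_domain_nonempty: "regular_domain B \<noteq> {}"
proof -
  note hol = thin_blaschke_product_properties(1)[OF thin] and nc = thin_blaschke_product_properties(3)[OF thin]
  have "countable {z \<in> unit_disk. deriv B z = 0}"
  proof (cases "deriv B constant_on unit_disk")
    case True
    then obtain k where k: "\<And>z. z \<in> unit_disk \<Longrightarrow> deriv B z = k" by (auto simp: constant_on_def)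
    \<comment> \<open>The countability of zeros is available for nonconstant functions only. A
      constant derivative cannot vanish, as \<open>B\<close> is not constant, so there are no
      critical points at all.\<close>
    have "k \<noteq> 0"
    proof
      assume "k = 0"
      then have "(B has_field_derivative 0) (at z)" if "z \<in> unit_disk" for z
        using holomorphic_derivI[OF hol open_ball that] k[OF that] by simp
      then have "\<exists>c. \<forall>z\<in>unit_disk. B z = c"
        using DERIV_zero_connected_constant[OF connected_ball open_ball finite.emptyI holomorphic_on_imp_continuous_on[OF hol]]
        by (metis Diff_empty)
      then show False using nc by (auto simp: constant_on_def)
    qed
    then have "{z \<in> unit_disk. deriv B z = 0} = {}" using k by auto
    then show ?thesis by (simp only: countable_empty)
  next
    case False
    then show ?thesis by (intro countable_zeros_unit_disk holomorphic_deriv hol) auto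
  qed
  moreover have "critical_values B = B ` {z \<in> unit_disk. deriv B z = 0}" by (auto simp: critical_values_def)
  ultimately have ccv: "countable (critical_values B)" by simp
  have "countable {z \<in> unit_disk. B z - v = 0}" for v
  proof (rule countable_zeros_unit_disk)
    show "(\<lambda>z. B z - v) holomorphic_on unit_disk" by (intro holomorphic_intros hol)
    show "\<not> (\<lambda>z. B z - v) constant_on unit_disk" using nc unfolding constant_on_def by (metis diff_add_cancel)
  qed
  then have "countable (\<Union>v\<in>critical_values B. {z \<in> unit_disk. B z - v = 0})" by (intro countable_UN ccv)
  moreover have "unit_disk - regular_domain B = (\<Union>v\<in>critical_values B. {z \<in> unit_disk. B z - v = 0})"
    by (auto simp: regular_domain_def)
  ultimately have c: "countable (unit_disk - regular_domain B)" by simp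
  have E: "regular_domain B = unit_disk - (unit_disk - regular_domain B)" by (auto simp: regular_domain_def)
  show "connected (regular_domain B)"
    by (subst E) (intro connected_open_diff_countable c, auto)
  show "regular_domain B \<noteq> {}"
    using c uncountable_ball[of 1 "0::complex"] by auto
qed

text \<open>A nonzero entry off the diagonal would give its whole component finite fibres, of
  constant size over the connected regular domain, against \<open>no_finite\<close>. The matrix is
  thus diagonal with a locally constant diagonal.\<close>

theorem commuting_pair_scalar:
  assumes thin: "thin_blaschke_product B"
    and no_finite: "\<not> (\<exists>G \<in> components (riemann_surface B). G \<noteq> trivial_component B \<and>
                         (\<exists>n. has_finite_multiplicity B G n))"
    and pair: "commuting_pair B T T'"
  shows "\<exists>c. \<forall>f\<in>bergman_space. T f = (\<lambda>z. c * f z)"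
proof -
  interpret commuting_pair B T T' by (rule pair)
  note nc = thin_blaschke_product_properties(3)[OF thin] and cov = thin_blaschke_product_properties(4)[OF thin]
  let ?E = "regular_domain B" and ?S = "riemann_surface B"
  have connE: "connected ?E" by (rule connected_regular_domain[OF thin])
  have local: "\<exists>\<rho>. covered_pair B T T' (B z) \<rho>" if "z \<in> ?E" for z
  proof -
    have z: "z \<in> unit_disk" "B z \<notin> critical_values B" using that by (auto simp: regular_domain_def)
    obtain \<rho> where "0 < \<rho>" "evenly_covered B (ball (B z) \<rho>)" using cov[OF B_disk[OF z(1)] z(2)] by blast
    then have "covered_disk B (B z) \<rho>" using holB nc by unfold_locales
    then show ?thesis using pair by (blast intro: covered_pair.intro)
  qed
  have fibreI: "w \<in> covered_disk.fibre B (B z)" if "covered_pair B T T' (B z) \<rho>" "(z, w) \<in> ?S" for z w \<rho>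
    using that by (auto simp: covered_disk.fibre_def[OF covered_pair.axioms(2)] riemann_surface_def)
  have fibreI': "z \<in> covered_disk.fibre B (B z)" if "covered_pair B T T' (B z) \<rho>" "z \<in> ?E" for z \<rho>
    using that by (auto simp: covered_disk.fibre_def[OF covered_pair.axioms(2)] regular_domain_def)
  have coef_const: "(\<lambda>p. coef (fst p) (snd p)) constant_on G" if G: "G \<in> components ?S" for G
  proof (rule locally_constant_imp_constant)
    show "connected G" by (rule in_components_connected[OF G])
    fix p assume p: "p \<in> G"
    have GS: "G \<subseteq> ?S" by (rule in_components_subset[OF G])
    obtain z w where zw: "p = (z, w)" by (cases p)
    have zS: "(z, w) \<in> ?S" using p GS zw by blast
    then have "z \<in> ?E" by (auto simp: riemann_surface_def)
    then obtain \<rho> where cp: "covered_pair B T T' (B z) \<rho>" using local by blast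
    interpret covered_pair B T T' "B z" \<rho> by (rule cp)
    have i: "z \<in> fibre" and j: "w \<in> fibre" using fibreI'[OF cp \<open>z \<in> ?E\<close>] fibreI[OF cp zS] by auto
    obtain U where U: "open U" "sheet z w = ?S \<inter> U"
      using openin_sheet[OF i j] by (auto simp: openin_open)
    have "G \<inter> sheet z w = G \<inter> U" using U(2) GS by blast
    then have "openin (top_of_set G) (G \<inter> sheet z w)" using U(1) by (simp add: openin_open_Int)
    then show "\<exists>N. openin (top_of_set G) N \<and> p \<in> N \<and> (\<forall>q\<in>N. coef (fst q) (snd q) = coef (fst p) (snd p))"
      using centre_in_sheet[OF i j] coef_sheet[OF i j] p zw by (intro exI[of _ "G \<inter> sheet z w"]) auto
  qed
  have off_diag: "coef z w = 0" if zw: "(z, w) \<in> ?S" "z \<noteq> w" for z w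
  proof (rule ccontr)
    assume nz: "coef z w \<noteq> 0"
    define G where "G = connected_component_set ?S (z, w)"
    have G: "G \<in> components ?S" unfolding G_def by (rule componentsI[OF zw(1)])
    have GS: "G \<subseteq> ?S" by (rule in_components_subset[OF G])
    have zG: "(z, w) \<in> G" unfolding G_def using zw(1) by simp
    obtain k where k: "\<forall>p\<in>G. coef (fst p) (snd p) = k"
      using coef_const[OF G] by (auto simp: constant_on_def)
    have cG: "coef z' w' = coef z w" if "(z', w') \<in> G" for z' w'
      using bspec[OF k that] bspec[OF k zG] by simp
    \<comment> \<open>Finite multiplicity asks for one number valid at all base points, so the
      cardinality has to be carried across the regular domain.\<close>
    have "(\<lambda>z. card {w. (z, w) \<in> G}) constant_on ?E"
    proof (rule locally_constant_imp_constant[OF connE])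
      fix z assume z: "z \<in> ?E"
      then obtain \<rho> where cp: "covered_pair B T T' (B z) \<rho>" using local by blast
      interpret covered_pair B T T' "B z" \<rho> by (rule cp)
      have i: "z \<in> fibre" by (rule fibreI'[OF cp z])
      show "\<exists>N. openin (top_of_set ?E) N \<and> z \<in> N \<and> (\<forall>x\<in>N. card {w. (x, w) \<in> G} = card {w. (z, w) \<in> G})"
        using regular_neighbourhood[OF i] card_fibre_locally_constant[OF G i] by (intro exI[of _ "sec z ` ball (B z) (\<rho>/4)"]) auto
    qed
    then obtain n where n: "\<And>z. z \<in> ?E \<Longrightarrow> card {w. (z, w) \<in> G} = n" by (auto simp: constant_on_def)
    \<comment> \<open>\<open>card\<close> is 0 on infinite sets, so finiteness of the fibres has to
      be shown apart from constancy of \<open>card\<close>.\<close>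
    have "finite {w. (z', w) \<in> G}" if z': "z' \<in> ?E" for z'
    proof -
      obtain \<rho> where cp: "covered_pair B T T' (B z') \<rho>" using local[OF z'] by blast
      show ?thesis
        by (rule covered_pair.finite_fibre[OF cp GS fibreI'[OF cp z'] nz]) (rule cG)
    qed
    then have "has_finite_multiplicity B G n" using n by (simp add: has_finite_multiplicity_def)
    moreover have "G \<noteq> trivial_component B" using zG zw(2) by (auto simp: trivial_component_def)
    ultimately show False using no_finite G by blast
  qed
  \<comment> \<open>Along the diagonal the entry is a function on the connected set
    \<open>?E\<close>, so local constancy there is enough and the diagonal need not be identified as
    a component.\<close>
  have "(\<lambda>z. coef z z) constant_on ?E"
  proof (rule locally_constant_imp_constant[OF connE])
    fix z assume z: "z \<in> ?E"
    then obtain \<rho> where cp: "covered_pair B T T' (B z) \<rho>" using local by blast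
    interpret covered_pair B T T' "B z" \<rho> by (rule cp)
    have i: "z \<in> fibre" by (rule fibreI'[OF cp z])
    show "\<exists>N. openin (top_of_set ?E) N \<and> z \<in> N \<and> (\<forall>x\<in>N. coef x x = coef z z)"
      using regular_neighbourhood[OF i] coef_locally_constant[OF i i] by (intro exI[of _ "sec z ` ball (B z) (\<rho>/4)"]) auto
  qed
  then obtain c where c: "\<And>z. z \<in> ?E \<Longrightarrow> coef z z = c" by (auto simp: constant_on_def)
  have onE: "T f z = c * f z" if f: "f \<in> bergman_space" and z: "z \<in> ?E" for f z
  proof -
    obtain \<rho> where cp: "covered_pair B T T' (B z) \<rho>" using local[OF z] by blast
    interpret covered_pair B T T' "B z" \<rho> by (rule cp)
    have i: "z \<in> fibre" by (rule fibreI'[OF cp z])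
    have zero: "coef z w = 0" if "w \<in> fibre" "w \<noteq> z" for w
      by (rule off_diag) (use that z in \<open>auto simp: riemann_surface_def regular_domain_def fibre_def\<close>)
    have "T f z / deriv B z = (\<Sum>\<^sub>\<infinity>w\<in>{z}. f w / deriv B w * coef z w)"
      unfolding T_representation[OF f i] by (rule infsum_cong_neutral) (use zero i in auto)
    moreover have "deriv B z \<noteq> 0" using z by (auto simp: regular_domain_def critical_values_def)
    ultimately show ?thesis using c[OF z] by (simp add: field_simps)
  qed
  have openE: "open ?E"
    unfolding open_contains_ball
  proof
    fix z assume z: "z \<in> ?E"
    then obtain \<rho> where cp: "covered_pair B T T' (B z) \<rho>" using local by blast
    interpret covered_pair B T T' "B z" \<rho> by (rule cp)
    have i: "z \<in> fibre" by (rule fibreI'[OF cp z])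
    have "open (sec z ` D)" "sec z ` D \<subseteq> ?E" "z \<in> sec z ` D"
      using sec_open_image[OF i open_ball order_refl] sec_regular_domain[OF i] rho sec(2)[OF i]
      by (auto intro!: image_eqI[of _ _ "B z"])
    then show "\<exists>e>0. ball z e \<subseteq> ?E" by (meson open_contains_ball order_trans)
  qed
  have "T f = (\<lambda>z. c * f z)" if f: "f \<in> bergman_space" for f
  proof
    fix z
    show "T f z = c * f z"
    proof (cases "z \<in> unit_disk")
      case True
      show ?thesis
      proof (rule analytic_continuation_open[where f = "T f" and g = "\<lambda>z. c * f z",
            OF openE open_ball regular_domain_nonempty[OF thin] connected_ball])
        show "?E \<subseteq> unit_disk" by (auto simp: regular_domain_def)
        show "T f holomorphic_on unit_disk" by (rule bergman_spaceD(1)[OF T_space[OF f]])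
        show "(\<lambda>z. c * f z) holomorphic_on unit_disk" by (intro holomorphic_intros bergman_spaceD(1)[OF f])
      qed (use onE[OF f] True in auto)
    next
      case False
      then show ?thesis using bergman_spaceD(2)[OF f False] bergman_spaceD(2)[OF T_space[OF f] False] by simp
    qed
  qed
  then show ?thesis by blast
qed

section \<open>Adjoints and reducing subspaces\<close>

lemma bergman_operatorsD:
  assumes "T \<in> bergman_operators"
  shows "f \<in> bergman_space \<Longrightarrow> T f \<in> bergman_space"
    and "f \<in> bergman_space \<Longrightarrow> g \<in> bergman_space \<Longrightarrow> T (\<lambda>z. f z + g z) = (\<lambda>z. T f z + T g z)"
    and "f \<in> bergman_space \<Longrightarrow> T (\<lambda>z. c * f z) = (\<lambda>z. c * T f z)"
    and "\<exists>C. \<forall>f\<in>bergman_space. bergman_norm (T f) \<le> C * bergman_norm f"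
  using assms by (auto simp: bergman_operators_def)

lemma bergman_operators_ext:
  assumes "S \<in> bergman_operators" "T \<in> bergman_operators" "\<And>f. f \<in> bergman_space \<Longrightarrow> S f = T f"
  shows "S = T"
  using assms by (intro extensionalityI[of S bergman_space]) (auto simp: bergman_operators_def PiE_def)

lemma bergman_norm_nonneg: "f \<in> bergman_space \<Longrightarrow> 0 \<le> bergman_norm f"
  by (simp add: bergman_norm_eq Re_bergman_inner_self_nonneg)

lemma bergman_norm_sq: "f \<in> bergman_space \<Longrightarrow> (bergman_norm f)\<^sup>2 = Re (bergman_inner f f)"
  by (simp add: bergman_norm_eq Re_bergman_inner_self_nonneg)

lemma Re_bergman_inner_le:
  assumes "f \<in> bergman_space" "g \<in> bergman_space"
  shows "\<bar>Re (bergman_inner f g)\<bar> \<le> bergman_norm f * bergman_norm g"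
  using Cauchy_Schwarz_ineq2[of "Bfun f" "Bfun g"] assms
  by (simp add: inner_bergman_def norm_bergman_eq Bfun_inverse)

text \<open>The difference is itself an admissible test vector. Stated for a set \<open>M\<close> so
  as to cover both the whole space and a reducing subspace.\<close>

lemma bergman_eqI:
  assumes M: "y \<in> M" "y' \<in> M" "M \<subseteq> bergman_space" "(\<lambda>z. y z - y' z) \<in> M"
    and eq: "\<And>x. x \<in> M \<Longrightarrow> bergman_inner x y = bergman_inner x y'"
  shows "y = y'"
proof -
  have H: "y \<in> bergman_space" "y' \<in> bergman_space" "(\<lambda>z. y z - y' z) \<in> bergman_space" using M by auto
  have "bergman_inner (\<lambda>z. y z - y' z) (\<lambda>z. y z - y' z) = 0"
    using bergman_inner_diff_right[OF H(1,2,3)] eq[OF M(4)] by simp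
  then have "(\<lambda>z. y z - y' z) = (\<lambda>z. 0)" by (intro Re_bergman_inner_self_eq_0 H) simp
  then show ?thesis by (auto simp: fun_eq_iff)
qed

text \<open>The real Riesz theorem represents the real part of \<psi>; complex linearity supplies
  the imaginary part as the real part at \<open>- \<i>\<close> times the argument.\<close>

lemma bergman_riesz:
  assumes M: "closed_bergman_subspace M"
    and in_C: "\<And>x. x \<in> M \<Longrightarrow> \<bar>Re (\<psi> x)\<bar> \<le> C * bergman_norm x"
    and add: "\<And>x y. x \<in> M \<Longrightarrow> y \<in> M \<Longrightarrow> \<psi> (\<lambda>z. x z + y z) = \<psi> x + \<psi> y"
    and scale: "\<And>c x. x \<in> M \<Longrightarrow> \<psi> (\<lambda>z. c * x z) = c * \<psi> x"
  shows "\<exists>y\<in>M. \<forall>x\<in>M. \<psi> x = bergman_inner x y"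
proof -
  have MH: "M \<subseteq> bergman_space" and M0: "(\<lambda>z. 0) \<in> M"
    and Madd: "\<And>f g. f \<in> M \<Longrightarrow> g \<in> M \<Longrightarrow> (\<lambda>z. f z + g z) \<in> M"
    and Mscale: "\<And>c f. f \<in> M \<Longrightarrow> (\<lambda>z. c * f z) \<in> M"
    and Mclosed: "\<And>F g. (\<And>n::nat. F n \<in> M) \<Longrightarrow> g \<in> bergman_space \<Longrightarrow>
            (\<lambda>n. bergman_norm (\<lambda>z. F n z - g z)) \<longlonglongrightarrow> 0 \<Longrightarrow> g \<in> M"
    using M unfolding closed_bergman_subspace_def by blast+
  define M' where "M' = {x. bfun x \<in> M}"
  have sub: "subspace M'"
    unfolding subspace_def M'_def by (auto simp: bfun_zero bfun_add bfun_scaleR M0 Madd Mscale)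
  have cl: "closed M'"
    unfolding closed_sequential_limits
  proof (intro allI impI, elim conjE)
    fix X L assume X: "\<forall>n. X n \<in> M'" "X \<longlonglongrightarrow> L"
    have "bfun L \<in> M"
    proof (rule Mclosed[of "\<lambda>n. bfun (X n)"])
      show "bfun (X n) \<in> M" for n using X(1) by (simp add: M'_def)
      show "(\<lambda>n. bergman_norm (\<lambda>z. bfun (X n) z - bfun L z)) \<longlonglongrightarrow> 0"
        using tendsto_norm_zero[OF LIM_zero[OF X(2)]] by (simp add: norm_bergman_eq bfun_diff)
    qed simp
    then show "L \<in> M'" by (simp add: M'_def)
  qed
  obtain y where y: "y \<in> M'" "\<And>x. x \<in> M' \<Longrightarrow> Re (\<psi> (bfun x)) = inner x y"
  proof (rule riesz_closed_subspace[OF sub cl, of "\<lambda>x. Re (\<psi> (bfun x))" C])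
    show "Re (\<psi> (bfun (u + v))) = Re (\<psi> (bfun u)) + Re (\<psi> (bfun v))" if "u \<in> M'" "v \<in> M'" for u v
      using that add by (simp add: bfun_add M'_def)
    show "Re (\<psi> (bfun (c *\<^sub>R u))) = c * Re (\<psi> (bfun u))" if "u \<in> M'" for c u
      using that scale by (simp add: bfun_scaleR M'_def)
    show "\<bar>Re (\<psi> (bfun u))\<bar> \<le> C * norm u" if "u \<in> M'" for u
      using that in_C by (simp add: norm_bergman_eq M'_def)
  qed (use that in blast)
  have Re: "Re (\<psi> x) = Re (bergman_inner x (bfun y))" if "x \<in> M" for x
    using y(2)[of "Bfun x"] that MH by (auto simp: M'_def inner_bergman_def Bfun_inverse subset_iff)
  have "\<psi> x = bergman_inner x (bfun y)" if x: "x \<in> M" for x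
  proof (rule complex_eqI)
    show "Re (\<psi> x) = Re (bergman_inner x (bfun y))" by (rule Re[OF x])
    have "Re (- \<i> * \<psi> x) = Re (- \<i> * bergman_inner x (bfun y))"
      using Re[OF Mscale[OF x, of "- \<i>"]] scale[OF x, of "- \<i>"] bergman_inner_scale_left[of x "bfun y" "- \<i>"] x MH by auto
    then show "Im (\<psi> x) = Im (bergman_inner x (bfun y))" by simp
  qed
  then show ?thesis using y(1) by (auto simp: M'_def)
qed

lemma closed_bergman_space: "closed_bergman_subspace bergman_space"
  unfolding closed_bergman_subspace_def
  using zero_bergman_space add_bergman_space scale_bergman_space by auto

text \<open>Unique existence gives the definite description \<open>bergman_adjoint\<close> its
  meaning.\<close>

lemma bergman_adjoint_exists:
  assumes T: "T \<in> bergman_operators"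
  shows "\<exists>!S. S \<in> bergman_operators \<and>
        (\<forall>f\<in>bergman_space. \<forall>g\<in>bergman_space. bergman_inner (T f) g = bergman_inner f (S g))"
proof -
  note TD = bergman_operatorsD[OF T]
  obtain C0 where C0: "\<And>f. f \<in> bergman_space \<Longrightarrow> bergman_norm (T f) \<le> C0 * bergman_norm f" using TD(4) by blast
  define C where "C = max C0 0"
  have C: "bergman_norm (T f) \<le> C * bergman_norm f" if f: "f \<in> bergman_space" for f
    using C0[OF f] mult_right_mono[OF max.cobounded1[of C0 0] bergman_norm_nonneg[OF f]] by (simp add: C_def)
  have "\<exists>y\<in>bergman_space. \<forall>x\<in>bergman_space. bergman_inner (T x) g = bergman_inner x y" if g: "g \<in> bergman_space" for g
  proof (rule bergman_riesz[OF closed_bergman_space, where C = "C * bergman_norm g"])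
    fix x assume x: "x \<in> bergman_space"
    have "\<bar>Re (bergman_inner (T x) g)\<bar> \<le> bergman_norm (T x) * bergman_norm g"
      by (rule Re_bergman_inner_le[OF TD(1)[OF x] g])
    also have "\<dots> \<le> C * bergman_norm x * bergman_norm g"
      by (intro mult_right_mono C x bergman_norm_nonneg g)
    finally show "\<bar>Re (bergman_inner (T x) g)\<bar> \<le> C * bergman_norm g * bergman_norm x" by (simp add: mult_ac)
  qed (simp_all add: TD g bergman_inner_add_left bergman_inner_scale_left)
  then obtain S0 where S0: "\<And>g. g \<in> bergman_space \<Longrightarrow> S0 g \<in> bergman_space"
    "\<And>f g. g \<in> bergman_space \<Longrightarrow> f \<in> bergman_space \<Longrightarrow> bergman_inner (T f) g = bergman_inner f (S0 g)"
    by metis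
  have eqI: "y = y'" if "y \<in> bergman_space" "y' \<in> bergman_space"
    "\<And>x. x \<in> bergman_space \<Longrightarrow> bergman_inner x y = bergman_inner x y'" for y y'
    using bergman_eqI[OF that(1,2) order_refl diff_bergman_space[OF that(1,2)] that(3)] by blast
  define S where "S = restrict S0 bergman_space"
  have SH: "S g \<in> bergman_space" if "g \<in> bergman_space" for g using that S0 by (simp add: S_def)
  have adj: "bergman_inner (T f) g = bergman_inner f (S g)" if "f \<in> bergman_space" "g \<in> bergman_space" for f g
    using that S0 by (simp add: S_def)
  have "S \<in> bergman_operators"
    unfolding bergman_operators_def
  proof (intro CollectI conjI ballI allI)
    show "S \<in> bergman_space \<rightarrow>\<^sub>E bergman_space" using S0(1) by (auto simp: S_def)
    show "S (\<lambda>z. f z + g z) = (\<lambda>z. S f z + S g z)" if "f \<in> bergman_space" "g \<in> bergman_space" for f g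
      by (rule eqI) (simp_all add: that SH TD(1) add_bergman_space bergman_inner_add_right flip: adj)
    show "S (\<lambda>z. c * f z) = (\<lambda>z. c * S f z)" if "f \<in> bergman_space" for c f
      by (rule eqI) (simp_all add: that SH scale_bergman_space bergman_inner_scale_right TD flip: adj)
    show "\<exists>C. \<forall>f\<in>bergman_space. bergman_norm (S f) \<le> C * bergman_norm f"
    proof (intro exI ballI)
      fix g assume g: "g \<in> bergman_space"
      \<comment> \<open>The adjoint relation is tested on \<open>S g\<close> itself, after which one
        factor \<open>bergman_norm (S g)\<close> cancels.\<close>
      have "(bergman_norm (S g))\<^sup>2 = Re (bergman_inner (T (S g)) g)"
        using bergman_norm_sq[OF SH[OF g]] adj[OF SH[OF g] g] by simp
      also have "\<dots> \<le> bergman_norm (T (S g)) * bergman_norm g"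
        using Re_bergman_inner_le[OF TD(1)[OF SH[OF g]] g] by simp
      also have "\<dots> \<le> C * bergman_norm (S g) * bergman_norm g"
        by (intro mult_right_mono C SH g bergman_norm_nonneg)
      finally have "bergman_norm (S g) * bergman_norm (S g) \<le> bergman_norm (S g) * (C * bergman_norm g)"
        by (simp add: power2_eq_square mult_ac)
      moreover have "0 \<le> C * bergman_norm g" using bergman_norm_nonneg[OF g] by (simp add: C_def)
      ultimately show "bergman_norm (S g) \<le> C * bergman_norm g"
        using bergman_norm_nonneg[OF SH[OF g]] by (cases "bergman_norm (S g) = 0") (auto simp: mult_le_cancel_left)
    qed
  qed
  then show ?thesis
  proof (intro ex1I[of _ S] conjI)
    fix S' assume S': "S' \<in> bergman_operators \<and>
        (\<forall>f\<in>bergman_space. \<forall>g\<in>bergman_space. bergman_inner (T f) g = bergman_inner f (S' g))"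
    show "S' = S"
    proof (rule bergman_operators_ext)
      fix g assume g: "g \<in> bergman_space"
      show "S' g = S g"
        by (rule eqI) (use S' g SH adj bergman_operatorsD(1)[of S'] in auto)
    qed (use S' \<open>S \<in> bergman_operators\<close> in auto)
  qed (use adj in auto)
qed

lemma
  assumes T: "T \<in> bergman_operators"
  shows bergman_adjoint_operator: "bergman_adjoint T \<in> bergman_operators"
    and bergman_inner_adjoint: "\<And>f g. f \<in> bergman_space \<Longrightarrow> g \<in> bergman_space \<Longrightarrow>
          bergman_inner (T f) g = bergman_inner f (bergman_adjoint T g)"
  using theI'[OF bergman_adjoint_exists[OF T]] unfolding bergman_adjoint_def by auto

lemma mult_operator_in:
  assumes hol: "B holomorphic_on unit_disk" and B: "B ` unit_disk \<subseteq> unit_disk"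
  shows "mult_operator B \<in> bergman_operators"
proof -
  have BH: "(\<lambda>z. B z * f z) \<in> bergman_space" if "f \<in> bergman_space" for f
    by (rule bounded_mult_bergman_space[OF hol _ that, of 1]) (use B in \<open>auto simp: image_subset_iff less_imp_le\<close>)
  show ?thesis
    unfolding bergman_operators_def mult_operator_def
  proof (intro CollectI conjI ballI allI)
    show "\<exists>C. \<forall>f\<in>bergman_space. bergman_norm (restrict (\<lambda>f z. B z * f z) bergman_space f) \<le> C * bergman_norm f"
    proof (intro exI[of _ 1] ballI)
      fix f assume f: "f \<in> bergman_space"
      have "(LINT z:unit_disk|lborel. (cmod (B z * f z))\<^sup>2) \<le> (LINT z:unit_disk|lborel. (cmod (f z))\<^sup>2)"
      proof (rule set_integral_mono)
        fix z assume "z \<in> unit_disk"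
        then have "cmod (B z) * cmod (f z) \<le> 1 * cmod (f z)" using B by (intro mult_right_mono) (auto simp: image_subset_iff less_imp_le)
        then show "(cmod (B z * f z))\<^sup>2 \<le> (cmod (f z))\<^sup>2" unfolding norm_mult by (intro power_mono) auto
      qed (use bergman_spaceD(3)[OF BH[OF f]] bergman_spaceD(3)[OF f] in auto)
      then show "bergman_norm (restrict (\<lambda>f z. B z * f z) bergman_space f) \<le> 1 * bergman_norm f"
        using f BH[OF f] by (simp add: bergman_norm_eq bergman_inner_self divide_right_mono)
    qed
  qed (auto simp: BH add_bergman_space scale_bergman_space distrib_left mult.left_commute)
qed

lemma scalar_operator_in: "scalar_operator c \<in> bergman_operators"
  unfolding bergman_operators_def scalar_operator_def
proof (intro CollectI conjI ballI allI)
  show "\<exists>C. \<forall>f\<in>bergman_space. bergman_norm (restrict (\<lambda>f z. c * f z) bergman_space f) \<le> C * bergman_norm f"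
  proof (intro exI[of _ "cmod c"] ballI)
    fix f assume f: "f \<in> bergman_space"
    have "(bergman_norm (\<lambda>z. c * f z))\<^sup>2 = (cmod c * bergman_norm f)\<^sup>2"
      using bergman_inner_scale_left[OF f scale_bergman_space[OF f, of c], of c] bergman_inner_scale_right[OF f f, of c]
      by (simp add: bergman_norm_sq f scale_bergman_space power_mult_distrib bergman_inner_self
          complex_norm_square[symmetric] flip: mult.assoc of_real_power of_real_mult)
    then have "bergman_norm (\<lambda>z. c * f z) = cmod c * bergman_norm f"
      using bergman_norm_nonneg[OF f] bergman_norm_nonneg[OF scale_bergman_space[OF f, of c]]
      by (metis mult_nonneg_nonneg norm_ge_zero power2_eq_imp_eq)
    then show "bergman_norm (restrict (\<lambda>f z. c * f z) bergman_space f) \<le> cmod c * bergman_norm f"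
      using f by simp
  qed
qed (auto simp: add_bergman_space scale_bergman_space algebra_simps)

lemma bergman_inner_adjoint_left:
  assumes T: "T \<in> bergman_operators" and f: "f \<in> bergman_space" and g: "g \<in> bergman_space"
  shows "bergman_inner (bergman_adjoint T f) g = bergman_inner f (T g)"
  using bergman_inner_adjoint[OF T g f] by (metis bergman_inner_commute)

text \<open>Taking adjoints in the commutation of \<open>T\<close> with the adjoint of
  \<open>mult_operator B\<close> yields commutation of the adjoint of \<open>T\<close> with
  \<open>mult_operator B\<close>.\<close>

lemma vn_algebra_commuting_pair:
  assumes hol: "B holomorphic_on unit_disk" and B: "B ` unit_disk \<subseteq> unit_disk"
    and T: "T \<in> vn_algebra B"
  shows "commuting_pair B T (bergman_adjoint T)"
proof
  have Top: "T \<in> bergman_operators" using T by (simp add: vn_algebra_def)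
  note MB = mult_operator_in[OF hol B]
  note TH = bergman_operatorsD(1)[OF Top] and T'H = bergman_operatorsD(1)[OF bergman_adjoint_operator[OF Top]]
    and MBH = bergman_operatorsD(1)[OF MB] and AH = bergman_operatorsD(1)[OF bergman_adjoint_operator[OF MB]]
  have mB: "mult_operator B f = (\<lambda>z. B z * f z)" if "f \<in> bergman_space" for f
    using that by (simp add: mult_operator_def)
  fix f assume f: "f \<in> bergman_space"
  show "T f \<in> bergman_space" "bergman_adjoint T f \<in> bergman_space" by (fact TH[OF f] T'H[OF f])+
  show "bergman_inner (T f) g = bergman_inner f (bergman_adjoint T g)" if "g \<in> bergman_space" for g
    by (rule bergman_inner_adjoint[OF Top f that])
  show "T (\<lambda>z. B z * f z) = (\<lambda>z. B z * T f z)"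
    using T f TH[OF f] by (simp add: vn_algebra_def flip: mB)
  have "bergman_adjoint T (mult_operator B f) = mult_operator B (bergman_adjoint T f)"
  proof (rule bergman_eqI[of _ bergman_space])
    fix x assume x: "x \<in> bergman_space"
    have "bergman_inner x (bergman_adjoint T (mult_operator B f)) = bergman_inner (T x) (mult_operator B f)"
      by (rule bergman_inner_adjoint[OF Top x MBH[OF f], symmetric])
    also have "\<dots> = bergman_inner (bergman_adjoint (mult_operator B) (T x)) f"
      by (rule bergman_inner_adjoint_left[OF MB TH[OF x] f, symmetric])
    also have "\<dots> = bergman_inner (T (bergman_adjoint (mult_operator B) x)) f"
      using T x by (simp add: vn_algebra_def)
    also have "\<dots> = bergman_inner (bergman_adjoint (mult_operator B) x) (bergman_adjoint T f)"
      by (rule bergman_inner_adjoint[OF Top AH[OF x] f])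
    also have "\<dots> = bergman_inner x (mult_operator B (bergman_adjoint T f))"
      by (rule bergman_inner_adjoint_left[OF MB x T'H[OF f]])
    finally show "bergman_inner x (bergman_adjoint T (mult_operator B f)) = bergman_inner x (mult_operator B (bergman_adjoint T f))" .
  qed (simp_all add: T'H MBH f diff_bergman_space)
  then show "bergman_adjoint T (\<lambda>z. B z * f z) = (\<lambda>z. B z * bergman_adjoint T f z)"
    by (simp add: mB f T'H)
qed (use hol B in \<open>auto simp: image_subset_iff\<close>)

section \<open>Projections onto reducing subspaces\<close>

lemma closed_bergman_subspace_diff:
  assumes M: "closed_bergman_subspace M" and fg: "f \<in> M" "g \<in> M"
  shows "(\<lambda>z. f z - g z) \<in> M"
proof -
  have add: "\<And>f g. f \<in> M \<Longrightarrow> g \<in> M \<Longrightarrow> (\<lambda>z. f z + g z) \<in> M"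
    and scale: "\<And>c f. f \<in> M \<Longrightarrow> (\<lambda>z. c * f z) \<in> M"
    using M unfolding closed_bergman_subspace_def by blast+
  show ?thesis using add[OF fg(1) scale[OF fg(2), of "-1"]] by simp
qed

text \<open>\<open>P f\<close> is the Riesz representative in \<open>M\<close> of the inner product
  with \<open>f\<close>, that is, the orthogonal projection. Invariance of \<open>M\<close> under
  the adjoint allows \<open>f\<close> to be replaced by \<open>P f\<close> in the commutation
  argument; invariance under multiplication keeps the result in \<open>M\<close>.\<close>

lemma reducing_subspace_commuting_pair:
  assumes hol: "B holomorphic_on unit_disk" and B: "B ` unit_disk \<subseteq> unit_disk"
    and red: "reducing_subspace B M"
  obtains P where "commuting_pair B P P" "\<And>f. f \<in> bergman_space \<Longrightarrow> P f \<in> M" "\<And>f. f \<in> M \<Longrightarrow> P f = f"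
proof -
  note MB = mult_operator_in[OF hol B]
  have M: "closed_bergman_subspace M" using red by (simp add: reducing_subspace_def)
  then have MH: "M \<subseteq> bergman_space" by (simp add: closed_bergman_subspace_def)
  have mB: "mult_operator B f = (\<lambda>z. B z * f z)" if "f \<in> bergman_space" for f
    using that by (simp add: mult_operator_def)
  have "\<exists>p\<in>M. \<forall>x\<in>M. bergman_inner x f = bergman_inner x p" if f: "f \<in> bergman_space" for f
  proof (rule bergman_riesz[OF M, where C = "bergman_norm f"])
    show "\<bar>Re (bergman_inner x f)\<bar> \<le> bergman_norm f * bergman_norm x" if "x \<in> M" for x
      using Re_bergman_inner_le[of x f] that f MH by (auto simp: mult.commute)
  qed (use MH f in \<open>auto simp: subset_iff bergman_inner_add_left bergman_inner_scale_left\<close>)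
  then obtain P where PM: "\<And>f. f \<in> bergman_space \<Longrightarrow> P f \<in> M"
    and P: "\<And>f x. f \<in> bergman_space \<Longrightarrow> x \<in> M \<Longrightarrow> bergman_inner x f = bergman_inner x (P f)" by metis
  have PH: "P f \<in> bergman_space" if "f \<in> bergman_space" for f using PM[OF that] MH by blast
  have eqI: "y = y'" if "y \<in> M" "y' \<in> M" "\<And>x. x \<in> M \<Longrightarrow> bergman_inner x y = bergman_inner x y'" for y y'
    by (rule bergman_eqI[OF that(1,2) MH closed_bergman_subspace_diff[OF M that(1,2)] that(3)])
  have comm: "P (\<lambda>z. B z * f z) = (\<lambda>z. B z * P f z)" if f: "f \<in> bergman_space" for f
  proof -
    have Bf: "mult_operator B f \<in> bergman_space" by (rule bergman_operatorsD(1)[OF MB f])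
    have "P (mult_operator B f) = mult_operator B (P f)"
    proof (rule eqI)
      show "P (mult_operator B f) \<in> M" by (rule PM[OF Bf])
      show "mult_operator B (P f) \<in> M" using red PM[OF f] by (auto simp: reducing_subspace_def)
      fix x assume x: "x \<in> M"
      have xH: "x \<in> bergman_space" using x MH by blast
      have aM: "bergman_adjoint (mult_operator B) x \<in> M" using red x by (auto simp: reducing_subspace_def)
      have "bergman_inner x (P (mult_operator B f)) = bergman_inner x (mult_operator B f)"
        by (rule P[OF Bf x, symmetric])
      also have "\<dots> = bergman_inner (bergman_adjoint (mult_operator B) x) f"
        by (rule bergman_inner_adjoint_left[OF MB xH f, symmetric])
      also have "\<dots> = bergman_inner (bergman_adjoint (mult_operator B) x) (P f)" by (rule P[OF f aM])
      also have "\<dots> = bergman_inner x (mult_operator B (P f))"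
        by (rule bergman_inner_adjoint_left[OF MB xH PH[OF f]])
      finally show "bergman_inner x (P (mult_operator B f)) = bergman_inner x (mult_operator B (P f))" .
    qed
    then show ?thesis by (simp add: mB f PH)
  qed
  have "commuting_pair B P P"
  proof
    fix f g assume f: "f \<in> bergman_space" and g: "g \<in> bergman_space"
    have "bergman_inner (P f) g = bergman_inner (P f) (P g)" by (rule P[OF g PM[OF f]])
    also have "\<dots> = bergman_inner f (P g)"
      unfolding bergman_inner_commute[of "P f" "P g"] bergman_inner_commute[of f "P g"] P[OF f PM[OF g]] ..
    finally show "bergman_inner (P f) g = bergman_inner f (P g)" .
  qed (use hol B PH comm in \<open>auto simp: image_subset_iff\<close>)
  moreover have "P f = f" if f: "f \<in> M" for f
    by (rule eqI) (use f MH PM P in \<open>auto simp: subset_iff\<close>)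
  ultimately show ?thesis using that PM by blast
qed

theorem proposition3p7:
  fixes B :: "complex \<Rightarrow> complex"
  assumes thin: "thin_blaschke_product B"
    and no_finite: "\<not> (\<exists>G \<in> components (riemann_surface B). G \<noteq> trivial_component B \<and>
                         (\<exists>n. has_finite_multiplicity B G n))"
  shows "vn_algebra B = range scalar_operator \<and>
         \<not> (\<exists>M. reducing_subspace B M \<and> nontrivial_subspace M)"
proof (intro conjI equalityI subsetI)
  note hol = thin_blaschke_product_properties(1)[OF thin]
  note B = thin_blaschke_product_properties(2)[OF thin]
  note MB = mult_operator_in[OF hol B]
  note scalar = commuting_pair_scalar[OF thin no_finite]
  show "T \<in> range scalar_operator" if T: "T \<in> vn_algebra B" for T
  proof -
    obtain c where "\<forall>f\<in>bergman_space. T f = (\<lambda>z. c * f z)"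
      using scalar[OF vn_algebra_commuting_pair[OF hol B T]] by blast
    then have "T = scalar_operator c"
      using T by (intro bergman_operators_ext scalar_operator_in) (auto simp: vn_algebra_def scalar_operator_def)
    then show ?thesis by blast
  qed
  show "T \<in> vn_algebra B" if T: "T \<in> range scalar_operator" for T
  proof -
    obtain c where c: "T = scalar_operator c" using T by blast
    have Tf: "T f = (\<lambda>z. c * f z)" if "f \<in> bergman_space" for f using that c by (simp add: scalar_operator_def)
    have mB: "mult_operator B f = (\<lambda>z. B z * f z)" if "f \<in> bergman_space" for f
      using that by (simp add: mult_operator_def)
    have A: "bergman_adjoint (mult_operator B) \<in> bergman_operators" by (rule bergman_adjoint_operator[OF MB])
    have "T (mult_operator B f) = mult_operator B (T f)" if f: "f \<in> bergman_space" for f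
      using bergman_operatorsD(1)[OF MB f] f by (simp add: Tf mB scale_bergman_space mult.left_commute)
    moreover have "T (bergman_adjoint (mult_operator B) f) = bergman_adjoint (mult_operator B) (T f)"
      if f: "f \<in> bergman_space" for f
      using bergman_operatorsD(1)[OF A f] bergman_operatorsD(3)[OF A f] f by (simp add: Tf)
    ultimately show ?thesis using scalar_operator_in c by (simp add: vn_algebra_def)
  qed
  show "\<not> (\<exists>M. reducing_subspace B M \<and> nontrivial_subspace M)"
  proof
    assume "\<exists>M. reducing_subspace B M \<and> nontrivial_subspace M"
    then obtain M where M: "reducing_subspace B M" "M \<noteq> {\<lambda>z. 0}" "M \<noteq> bergman_space"
      by (auto simp: nontrivial_subspace_def)
    then have MH: "M \<subseteq> bergman_space" "(\<lambda>z. 0) \<in> M"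
      by (auto simp: reducing_subspace_def closed_bergman_subspace_def)
    obtain P where P: "commuting_pair B P P" "\<And>f. f \<in> bergman_space \<Longrightarrow> P f \<in> M" "\<And>f. f \<in> M \<Longrightarrow> P f = f"
      using reducing_subspace_commuting_pair[OF hol B M(1)] by metis
    obtain c where c: "\<And>f. f \<in> bergman_space \<Longrightarrow> P f = (\<lambda>z. c * f z)" using scalar[OF P(1)] by blast
    \<comment> \<open>On a nonzero element of \<open>M\<close> the projection acts as the identity,
      which fixes the scalar as 1 and makes \<open>M\<close> the whole space.\<close>
    obtain f where f: "f \<in> M" "f \<noteq> (\<lambda>z. 0)" using M(2) MH(2) by blast
    then obtain z where "f z \<noteq> 0" by auto
    moreover have "f z = c * f z" using P(3)[OF f(1)] c[of f] f(1) MH(1) by (metis subsetD)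
    ultimately have "c = 1" by simp
    then have "g \<in> M" if "g \<in> bergman_space" for g using P(2)[OF that] c[OF that] by simp
    then show False using MH(1) M(3) by blast
  qed
qed

end
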